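(* Let $\{f_t:t\in\mathbb{N}\}$ be a countably infinite set of scaling functions totally ordered by domination. For each $t\in\mathbb{N}$ let $\Xi_t$ and $\Xi'_t$ be any scale limits. Let $\Gamma$ be any permuton, and let $\Lambda$ and $\Lambda'$ be any permutation local limits. Then there exists a sequence of permutations $(\tau_j)_{j\in\mathbb{N}}$ with $|\tau_j|\to\infty$ which converges to $\Xi_t$ at scale $f_t$ for every $t$, converges globally to $\Gamma$, and converges locally to $\Lambda$, and such that the sequence of inverses $(\tau_j^{-1})_{j\in\mathbb{N}}$ converges to $\Xi'_t$ at scale $f_t$ for every $t$ and converges locally to $\Lambda'$.
   Context: For $g,h:\mathbb{N}\to\mathbb{R}^+$ write $g\ll h$ if $g(n)/h(n)\to0$. A scaling function is a function $f:\mathbb{N}\to\mathbb{R}^+$ with $f(n)\le n$ for all $n$, $f(n)\to\infty$ and $f(n)/n\to 0$. A set of scaling functions is totally ordered by domination if for every two distinct members $f,g$ either $f\ll g$ or $g\ll f$. Let $S_n$ be the set of permutations of $[n]$ and $S=\bigcup_nS_n$. An occurrence of $\pi\in S_k$ in $\sigma\in S_n$ is a set of indices $i_1<\dots<i_k$ with $\sigma(i_1)\dots\sigma(i_k)$ order-isomorphic to $\pi$; its width is $i_k-i_1+1$. For real $f\in[k,n]$, $\rho_f(\pi,\sigma)$ is the number of occurrences of $\pi$ in $\sigma$ of width at most $f$ divided by the number of $k$-subsets of $[n]$ of width at most $f$; the global density is $\rho(\pi,\sigma)=\rho_n(\pi,\sigma)$ and the local density is $\rho_k(\pi,\sigma)$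 (consecutive occurrences). A sequence $(\sigma_j)$ with $|\sigma_j|\to\infty$ converges at scale $f$ to $\Xi\in[0,1]^S$ if $\rho_{f(|\sigma_j|)}(\pi,\sigma_j)\to\Xi_\pi$ for all $\pi\in S$; a scale limit is a $\Xi$ arising in this way for some scaling function and some sequence. The sequence converges locally to $\Lambda\in[0,1]^S$ if $\rho_{|\pi|}(\pi,\sigma_j)\to\Lambda_\pi$ for all $\pi$; a permutation local limit is a $\Lambda$ arising in this way. A permuton is a Borel probability measure $\Gamma$ on $[0,1]^2$ with uniform marginals; $\rho(\pi,\Gamma)$ is the probability that $k=|\pi|$ independent $\Gamma$-distributed points, listed in increasing order of $x$-coordinate, have $y$-coordinates order-isomorphic to $\pi$. The sequence converges globally to $\Gamma$ if $\rho(\pi,\sigma_j)\to\rho(\pi,\Gamma)$ for all $\pi$. $\tau^{-1}$ denotes the inverse permutation. *)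

theory Defs
  imports "HOL-Probability.Probability" "HOL-Combinatorics.Permutations"
begin

text \<open>Permutations of [n] in one-line notation, 0-based: a list of length n
  containing each of 0,...,n-1 exactly once. Position i (0-based) holds sigma(i+1)-1.\<close>
definition is_perm :: "nat list \<Rightarrow> bool" where
  "is_perm xs \<longleftrightarrow> distinct xs \<and> set xs = {0..<length xs}"

definition inv_perm :: "nat list \<Rightarrow> nat list" where
  "inv_perm xs = map (\<lambda>v. inv_into {0..<length xs} (\<lambda>i. xs ! i) v) [0..<length xs]"

definition order_iso :: "'a::linorder list \<Rightarrow> 'b::linorder list \<Rightarrow> bool" where
  "order_iso xs ys \<longleftrightarrow> length xs = length ys \<and>
     (\<forall>a < length xs. \<forall>b < length xs. (xs ! a < xs ! b) \<longleftrightarrow> (ys ! a < ys ! b))"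

definition width :: "nat set \<Rightarrow> nat" where
  "width I = Max I - Min I + 1"

definition windows :: "nat \<Rightarrow> nat \<Rightarrow> real \<Rightarrow> nat set set" where
  "windows n k w = {I. I \<subseteq> {0..<n} \<and> card I = k \<and> real (width I) \<le> w}"

definition occurs_at :: "nat list \<Rightarrow> nat list \<Rightarrow> nat set \<Rightarrow> bool" where
  "occurs_at \<pi> \<sigma> I \<longleftrightarrow> order_iso (map (\<lambda>i. \<sigma> ! i) (sorted_list_of_set I)) \<pi>"

definition dens :: "real \<Rightarrow> nat list \<Rightarrow> nat list \<Rightarrow> real" where
  "dens w \<pi> \<sigma> =
     real (card {I \<in> windows (length \<sigma>) (length \<pi>) w. occurs_at \<pi> \<sigma> I})
     / real (card (windows (length \<sigma>) (length \<pi>) w))"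

definition pattern :: "nat list \<Rightarrow> bool" where
  "pattern \<pi> \<longleftrightarrow> is_perm \<pi> \<and> \<pi> \<noteq> []"

text \<open>g << h. Functions are on N = {1,2,...}; the value at 0 is irrelevant.\<close>
definition dominated :: "(nat \<Rightarrow> real) \<Rightarrow> (nat \<Rightarrow> real) \<Rightarrow> bool" where
  "dominated g h \<longleftrightarrow> (\<lambda>n. g n / h n) \<longlonglongrightarrow> 0"

definition scaling_fn :: "(nat \<Rightarrow> real) \<Rightarrow> bool" where
  "scaling_fn f \<longleftrightarrow> (\<forall>n\<ge>1. 0 < f n \<and> f n \<le> real n) \<and>
     filterlim f at_top sequentially \<and> (\<lambda>n. f n / real n) \<longlonglongrightarrow> 0"

definition perm_seq :: "(nat \<Rightarrow> nat list) \<Rightarrow> bool" where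
  "perm_seq \<sigma>s \<longleftrightarrow> (\<forall>j. is_perm (\<sigma>s j)) \<and> filterlim (\<lambda>j. length (\<sigma>s j)) at_top sequentially"

definition conv_scale :: "(nat \<Rightarrow> real) \<Rightarrow> (nat \<Rightarrow> nat list) \<Rightarrow> (nat list \<Rightarrow> real) \<Rightarrow> bool" where
  "conv_scale f \<sigma>s \<Xi> \<longleftrightarrow> perm_seq \<sigma>s \<and>
     (\<forall>\<pi>. pattern \<pi> \<longrightarrow> (\<lambda>j. dens (f (length (\<sigma>s j))) \<pi> (\<sigma>s j)) \<longlonglongrightarrow> \<Xi> \<pi>)"

definition scale_limit :: "(nat list \<Rightarrow> real) \<Rightarrow> bool" where
  "scale_limit \<Xi> \<longleftrightarrow> (\<exists>f \<sigma>s. scaling_fn f \<and> conv_scale f \<sigma>s \<Xi>)"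

definition conv_local :: "(nat \<Rightarrow> nat list) \<Rightarrow> (nat list \<Rightarrow> real) \<Rightarrow> bool" where
  "conv_local \<sigma>s \<Lambda> \<longleftrightarrow> perm_seq \<sigma>s \<and>
     (\<forall>\<pi>. pattern \<pi> \<longrightarrow> (\<lambda>j. dens (real (length \<pi>)) \<pi> (\<sigma>s j)) \<longlonglongrightarrow> \<Lambda> \<pi>)"

definition local_limit :: "(nat list \<Rightarrow> real) \<Rightarrow> bool" where
  "local_limit \<Lambda> \<longleftrightarrow> (\<exists>\<sigma>s. conv_local \<sigma>s \<Lambda>)"

text \<open>Permuton: Borel probability measure on the plane whose two marginals are
  uniform on [0,1] (hence concentrated on [0,1]^2).\<close>
definition permuton :: "(real \<times> real) measure \<Rightarrow> bool" where
  "permuton \<Gamma> \<longleftrightarrow> prob_space \<Gamma> \<and> sets \<Gamma> = sets borel \<and>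
     distr \<Gamma> borel fst = uniform_measure lborel {0..1} \<and>
     distr \<Gamma> borel snd = uniform_measure lborel {0..1}"

definition permuton_dens :: "nat list \<Rightarrow> (real \<times> real) measure \<Rightarrow> real" where
  "permuton_dens \<pi> \<Gamma> = measure (PiM {0..<length \<pi>} (\<lambda>_. \<Gamma>))
     {p \<in> space (PiM {0..<length \<pi>} (\<lambda>_. \<Gamma>)).
        \<exists>s. s permutes {0..<length \<pi>} \<and>
          (\<forall>a b. a < b \<and> b < length \<pi> \<longrightarrow> fst (p (s a)) < fst (p (s b))) \<and>
          order_iso (map (\<lambda>a. snd (p (s a))) [0..<length \<pi>]) \<pi>}"

definition conv_global :: "(nat \<Rightarrow> nat list) \<Rightarrow> (real \<times> real) measure \<Rightarrow> bool" where
  "conv_global \<sigma>s \<Gamma> \<longleftrightarrow> perm_seq \<sigma>s \<and>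
     (\<forall>\<pi>. pattern \<pi> \<longrightarrow>
        (\<lambda>j. dens (real (length (\<sigma>s j))) \<pi> (\<sigma>s j)) \<longlonglongrightarrow> permuton_dens \<pi> \<Gamma>)"

end

theory Submission
  imports Defs "HOL-Combinatorics.Multiset_Permutations"
begin

text \<open>By a diagonal argument it is enough to approximate finitely many scales, up to a small error, by
  a single long permutation. A word \<open>Q\<close> whose letters are lexicographic tuples, the \<open>i\<close>-th component at
  position \<open>x\<close> being \<open>\<sigma>\<^sub>i ((x div b\<^sub>i) mod m\<^sub>i)\<close> for a permutation \<open>\<sigma>\<^sub>i\<close> of length \<open>m\<^sub>i\<close>, shows \<open>\<sigma>\<^sub>i\<close> at the
  scale of its block length \<open>b\<^sub>i\<close>: typical windows of that width lie in a single block of every coarser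
  level and meet pairwise different blocks of level \<open>i\<close>. Since one scale dominates the next, the
  \<open>b\<^sub>i\<close> can be chosen as multiples of each other.

  Two such words \<open>Q\<close> and \<open>Q'\<close> over bounded alphabets and a permutation \<open>\<gamma>\<close> sampled from the permuton
  are woven into a permutation that is globally close to \<open>\<gamma>\<close>, while over every short interval of
  positions its entries are ordered as the letters of \<open>Q\<close>, and over every short interval of values its
  inverse is ordered as the letters of \<open>Q'\<close>. Points that are close in position and carry
  different letters of \<open>Q\<close> lie in different coarse rows, and symmetrically for values and \<open>Q'\<close>, so the
  two families of constraints do not interact.\<close>

section \<open>Counting windows\<close>

text \<open>A limit found at one scale can be displayed at any other because only sizes relative to
  the width matter: if \<open>\<sigma>\<close> has length \<open>m\<close> and pattern densities
  close to \<open>\<Xi>\<close> at width \<open>w\<close>, then replacing every entry by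
  \<open>b\<close> consecutive positions hardly changes the densities at width \<open>w * b\<close>,
  provided \<open>w\<close> is large and \<open>w / m\<close> small. The order inside a block is
  immaterial, since few \<open>k\<close>-point windows have two points in one block; this is the
  room for finer levels. The local limit has no large \<open>w\<close>, so it occupies the finest
  level, with \<open>b = 1\<close>. The obstacle is that positions and values are prescribed at the
  same scales. The alphabet sizes \<open>P\<close> and \<open>P'\<close> depend on the error but not
  on the length \<open>n\<close>. Positions split into \<open>length \<gamma> * P'\<close> columns
  and values into \<open>length \<gamma> * P\<close> rows, whose lengths are fixed fractions of
  \<open>n\<close> and hence eventually exceed every scaling function: few windows cross a boundary.
  The splitting inside a block of \<open>\<gamma>\<close> affects only point sets with two points in
  one block, which are rare when \<open>\<gamma>\<close> is long.\<close>

lemma finite_windows [simp]: "finite (windows n k w)"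
  by (rule finite_subset[of _ "Pow {0..<n}"]) (auto simp: windows_def)

lemma width_le_nat_floor_iff: "0 \<le> w \<Longrightarrow> real (width I) \<le> w \<longleftrightarrow> width I \<le> nat \<lfloor>w\<rfloor>"
  by (simp add: le_nat_floor nat_floor_neg le_nat_iff le_floor_iff)

lemma windows_floor: "0 \<le> w \<Longrightarrow> windows n k w = windows n k (real (nat \<lfloor>w\<rfloor>))"
  using width_le_nat_floor_iff unfolding windows_def by auto

text \<open>Widths are integers. This is the bridge between real-valued scaling functions and the
  natural widths for which windows are counted.\<close>

lemma dens_floor: "0 \<le> w \<Longrightarrow> dens w \<pi> \<sigma> = dens (real (nat \<lfloor>w\<rfloor>)) \<pi> \<sigma>"
  unfolding dens_def by (subst (1 2) windows_floor) auto

lemma windows_full: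
  assumes "1 \<le> k"
  shows "windows n k (real n) = {I. I \<subseteq> {0..<n} \<and> card I = k}"
proof -
  have "width I \<le> n" if "I \<subseteq> {0..<n}" "card I = k" for I
  proof -
    have "finite I" "I \<noteq> {}" using that assms by (auto intro: finite_subset)
    then have "Max I \<in> I" by simp
    then show ?thesis using that by (auto simp: width_def)
  qed
  then show ?thesis unfolding windows_def by auto
qed

lemma card_windows_full: "1 \<le> k \<Longrightarrow> card (windows n k (real n)) = n choose k"
  by (simp add: windows_full n_subsets)

text \<open>A nonempty set is coded by its least element \<open>q\<close> and the set
  \<open>D\<close> of positive distances from it. For width at most \<open>W\<close> the distances
  range over \<open>{1..<W}\<close> whatever \<open>q\<close> is, so counting windows becomes
  counting pairs.\<close>

definition anchored :: "nat \<times> nat set \<Rightarrow> nat set" where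
  "anchored = (\<lambda>(q, D). insert q ((+) q ` D))"

lemma Min_anchored: "finite D \<Longrightarrow> Min (anchored (q, D)) = q"
  unfolding anchored_def by (auto intro!: Min_eqI)

lemma inj_on_anchored: "inj_on anchored (A \<times> {D. D \<subseteq> {1..<W} \<and> card D = k})"
proof (rule inj_onI, clarsimp)
  fix q D q' D'
  assume D: "D \<subseteq> {Suc 0..<W}" and D': "D' \<subseteq> {Suc 0..<W}" and eq: "anchored (q, D) = anchored (q', D')"
  have "finite D" "finite D'" using D D' by (auto intro: finite_subset)
  then have q: "q = q'" using eq by (metis Min_anchored)
  have "(+) q ` D = anchored (q, D) - {q}" "(+) q ` D' = anchored (q, D') - {q}"
    using D D' by (auto simp: anchored_def)
  then have "(+) q ` D = (+) q ` D'" using eq q by simp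
  then show "q = q' \<and> D = D'" using q by (simp add: inj_image_eq_iff)
qed

text \<open>Every window comes from a pair; the condition that its far end stays below
  \<open>n\<close> is dropped, hence only an inequality.\<close>

lemma card_windows_le:
  assumes "1 \<le> k"
  shows "card (windows n k (real W)) \<le> n * ((W - 1) choose (k - 1))"
proof -
  let ?S = "{D. D \<subseteq> {1..<W} \<and> card D = k - 1}"
  have "windows n k (real W) \<subseteq> anchored ` ({0..<n} \<times> ?S)"
  proof
    fix I assume I: "I \<in> windows n k (real W)"
    then have "I \<subseteq> {0..<n}" "card I = k" and w: "Max I - Min I + 1 \<le> W"
      by (auto simp: windows_def width_def)
    then have fin: "finite I" "I \<noteq> {}" using assms by (auto intro: finite_subset)
    define q where "q = Min I"
    have q: "q \<in> I" "\<And>x. x \<in> I \<Longrightarrow> q \<le> x" "\<And>x. x \<in> I \<Longrightarrow> x \<le> Max I"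
      using fin by (auto simp: q_def)
    define D where "D = (\<lambda>x. x - q) ` (I - {q})"
    have "card D = k - 1"
      unfolding D_def using q \<open>card I = k\<close> fin
      by (subst card_image) (auto intro!: inj_onI dest: q(2))
    moreover have "D \<subseteq> {1..<W}"
    proof
      fix d assume "d \<in> D"
      then obtain x where x: "x \<in> I" "x \<noteq> q" "d = x - q" by (auto simp: D_def)
      then show "d \<in> {1..<W}" using q(2)[of x] q(3)[of x] w by (auto simp: q_def)
    qed
    moreover have "anchored (q, D) = I"
      unfolding anchored_def D_def using q by (force simp: image_image)
    moreover have "q < n" using q \<open>I \<subseteq> {0..<n}\<close> by auto
    ultimately show "I \<in> anchored ` ({0..<n} \<times> ?S)" by force
  qed
  moreover have fin: "finite ({0..<n} \<times> ?S)"
    by (intro finite_SigmaI finite_subset[of ?S "Pow {1..<W}"]) auto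
  ultimately have "card (windows n k (real W)) \<le> card (anchored ` ({0..<n} \<times> ?S))"
    by (intro card_mono finite_imageI)
  also have "\<dots> \<le> card ({0..<n} \<times> ?S)" by (rule card_image_le[OF fin])
  finally show ?thesis by (simp add: card_cartesian_product n_subsets)
qed

text \<open>With least element at most \<open>m - w\<close> every choice of distances below
  \<open>w\<close> stays inside \<open>{0..<m}\<close>. Least elements nearer to the end are given
  up; they become the boundary loss \<open>w / m\<close> in the density estimates.\<close>

lemma card_windows_ge:
  assumes "1 \<le> k" "1 \<le> w" "w \<le> m"
  shows "(m + 1 - w) * ((w - 1) choose (k - 1)) \<le> card (windows m k (real w))"
proof -
  let ?S = "{D. D \<subseteq> {1..<w} \<and> card D = k - 1}"
  have "anchored ` ({0..<m + 1 - w} \<times> ?S) \<subseteq> windows m k (real w)"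
  proof clarsimp
    fix q D assume q: "q < Suc m - w" and D: "D \<subseteq> {Suc 0..<w}" and c: "card D = k - Suc 0"
    have fin: "finite D" using D by (auto intro: finite_subset)
    have "card (anchored (q, D)) = k"
      using fin D c assms by (auto simp: anchored_def card_image card_insert_if)
    moreover have sub: "anchored (q, D) \<subseteq> {q..<q + w}"
      using D assms by (auto simp: anchored_def)
    moreover have "Max (anchored (q, D)) \<in> anchored (q, D)"
      using fin by (intro Max_in) (auto simp: anchored_def)
    ultimately have "Max (anchored (q, D)) < q + w" "card (anchored (q, D)) = k" by auto
    moreover have "anchored (q, D) \<subseteq> {0..<m}"
    proof
      fix x assume "x \<in> anchored (q, D)"
      then have "x < q + w" using sub by auto
      then show "x \<in> {0..<m}" using q assms by simp
    qed
    moreover have "width (anchored (q, D)) \<le> w"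
      using \<open>Max (anchored (q, D)) < q + w\<close> fin assms by (simp add: width_def Min_anchored)
    ultimately show "anchored (q, D) \<in> windows m k (real w)"
      by (simp add: windows_def)
  qed
  then have "card (anchored ` ({0..<m + 1 - w} \<times> ?S)) \<le> card (windows m k (real w))"
    by (intro card_mono finite_windows)
  also have "card (anchored ` ({0..<m + 1 - w} \<times> ?S)) = card ({0..<m + 1 - w} \<times> ?S)"
    by (intro card_image inj_on_anchored)
  finally show ?thesis by (simp add: card_cartesian_product n_subsets)
qed

section \<open>Blocks and densities\<close>

lemma sorted_list_of_set_image:
  fixes \<phi> :: "nat \<Rightarrow> nat"
  assumes "finite J" "strict_mono_on J \<phi>"
  shows "sorted_list_of_set (\<phi> ` J) = map \<phi> (sorted_list_of_set J)"
proof (rule sorted_distinct_set_unique)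
  have mono: "\<phi> x \<le> \<phi> y" if "x \<in> J" "y \<in> J" "x \<le> y" for x y
    using assms(2) that by (metis monotone_onD order.order_iff_strict)
  show "sorted (map \<phi> (sorted_list_of_set J))"
    using assms(1) mono by (auto simp: sorted_map intro!: sorted_wrt_mono_rel[OF _ sorted_sorted_list_of_set[of J]])
  show "distinct (map \<phi> (sorted_list_of_set J))"
    using assms by (auto simp: distinct_map strict_mono_on_imp_inj_on)
qed (use assms in auto)

lemma occurs_at_image:
  assumes "finite J" "strict_mono_on J \<phi>"
    and "\<And>a b. a \<in> J \<Longrightarrow> b \<in> J \<Longrightarrow> \<tau> ! \<phi> a < \<tau> ! \<phi> b \<longleftrightarrow> \<sigma> ! a < \<sigma> ! b"
  shows "occurs_at \<pi> \<tau> (\<phi> ` J) \<longleftrightarrow> occurs_at \<pi> \<sigma> J"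
proof -
  have "sorted_list_of_set J ! a \<in> J" if "a < card J" for a
    using that assms(1) by (metis nth_mem set_sorted_list_of_set length_sorted_list_of_set)
  then show ?thesis
    unfolding occurs_at_def order_iso_def sorted_list_of_set_image[OF assms(1,2)]
    using assms(3) by auto
qed

text \<open>Puts the entry \<open>a\<close> of a window \<open>J\<close> of \<open>\<sigma>\<close>
  at offset \<open>r a\<close> inside the \<open>a\<close>-th block of the copy of
  \<open>\<sigma>\<close> that starts at \<open>s\<close>. There is one point per block, so the
  uncontrolled order inside blocks is never consulted.\<close>

definition lift_window :: "nat \<Rightarrow> nat \<times> nat set \<times> (nat \<Rightarrow> nat) \<Rightarrow> nat set" where
  "lift_window b = (\<lambda>(s, J, r). (\<lambda>a. s + (a * b + r a)) ` J)"

lemma add_mult_less: "a * b + r < b * m" if "r < b" "a < m" for a b r m :: nat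
proof -
  have "a * b + r < Suc a * b" using that by simp
  also have "\<dots> \<le> m * b" using that by (intro mult_right_mono) auto
  finally show ?thesis by (simp add: mult.commute)
qed

text \<open>On each interval \<open>{s..<s + b * length \<sigma>}\<close> with \<open>s \<in> C\<close>, the list \<open>\<tau>\<close> looks like an
  inflation of \<open>\<sigma>\<close> in which every entry is replaced by a block of \<open>b\<close> consecutive positions.
  The order inside a block is arbitrary.\<close>

locale blocks =
  fixes \<tau> \<sigma> :: "nat list" and C :: "nat set" and b :: nat
  assumes distinct_sigma: "distinct \<sigma>"
    and finite_C: "finite C"
    and inside: "\<And>s. s \<in> C \<Longrightarrow> s + b * length \<sigma> \<le> length \<tau>"
    and apart: "\<And>s s'. s \<in> C \<Longrightarrow> s' \<in> C \<Longrightarrow> s < s' \<Longrightarrow> s + b * length \<sigma> \<le> s'"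
    and follows: "\<And>s x y. s \<in> C \<Longrightarrow> x < b * length \<sigma> \<Longrightarrow> y < b * length \<sigma>
                   \<Longrightarrow> \<sigma> ! (x div b) < \<sigma> ! (y div b) \<Longrightarrow> \<tau> ! (s + x) < \<tau> ! (s + y)"
begin

text \<open>Offsets are extensional functions on \<open>J\<close>: values outside \<open>J\<close>
  do not affect the lifted window and would destroy injectivity.\<close>

definition lifts :: "nat set set \<Rightarrow> (nat \<times> nat set \<times> (nat \<Rightarrow> nat)) set" where
  "lifts X = (SIGMA s:C. SIGMA J:X. J \<rightarrow>\<^sub>E {0..<b})"

lemma lift_window_props:
  assumes "s \<in> C" "J \<subseteq> {0..<length \<sigma>}" "r \<in> J \<rightarrow>\<^sub>E {0..<b}"
  shows "strict_mono_on J (\<lambda>a. s + (a * b + r a))"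
    and "lift_window b (s, J, r) \<subseteq> {s..<s + b * length \<sigma>}"
    and "occurs_at \<pi> \<tau> (lift_window b (s, J, r)) \<longleftrightarrow> occurs_at \<pi> \<sigma> J"
proof -
  have r: "r a < b" if "a \<in> J" for a using assms(3) that by auto
  have J: "finite J" "\<And>a. a \<in> J \<Longrightarrow> a < length \<sigma>" using assms(2) by (auto intro: finite_subset)
  have lt: "a * b + r a < b * length \<sigma>" if "a \<in> J" for a
    using add_mult_less[OF r J(2)] that by auto
  show mono: "strict_mono_on J (\<lambda>a. s + (a * b + r a))"
  proof (rule monotone_onI)
    fix a a' assume a: "a \<in> J" "a' \<in> J" "a < a'"
    show "s + (a * b + r a) < s + (a' * b + r a')"
      using add_mult_less[OF r[OF a(1)] a(3)] by (simp add: mult.commute)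
  qed
  show "lift_window b (s, J, r) \<subseteq> {s..<s + b * length \<sigma>}"
    using lt by (auto simp: lift_window_def)
  have dv: "(a * b + r a) div b = a" if "a \<in> J" for a using r[OF that] by auto
  \<comment> \<open>\<open>follows\<close> gives one direction only. Since the entries of
    \<open>\<sigma>\<close> are distinct, applying it to the swapped pair as well yields the
    equivalence.\<close>
  have *: "\<tau> ! (s + (a * b + r a)) < \<tau> ! (s + (c * b + r c))" if "a \<in> J" "c \<in> J" "\<sigma> ! a < \<sigma> ! c" for a c
    using follows[OF assms(1) lt[OF that(1)] lt[OF that(2)]] that by (simp add: dv)
  have "\<tau> ! (s + (a * b + r a)) < \<tau> ! (s + (c * b + r c)) \<longleftrightarrow> \<sigma> ! a < \<sigma> ! c" if "a \<in> J" "c \<in> J" for a c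
  proof (cases "a = c")
    case False
    then have "\<sigma> ! a \<noteq> \<sigma> ! c" using distinct_sigma J that by (simp add: nth_eq_iff_index_eq)
    then show ?thesis using *[of a c] *[of c a] that by (meson not_less_iff_gr_or_eq)
  qed auto
  then show "occurs_at \<pi> \<tau> (lift_window b (s, J, r)) \<longleftrightarrow> occurs_at \<pi> \<sigma> J"
    unfolding lift_window_def prod.case by (intro occurs_at_image J mono)
qed

lemma lift_window_in_windows:
  assumes "s \<in> C" "J \<in> windows (length \<sigma>) k (real w)" "r \<in> J \<rightarrow>\<^sub>E {0..<b}" "w * b \<le> W" "1 \<le> k"
  shows "lift_window b (s, J, r) \<in> windows (length \<tau>) k (real W)"
proof -
  have J: "J \<subseteq> {0..<length \<sigma>}" "card J = k" and wd: "Max J - Min J + 1 \<le> w"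
    using assms(2) by (auto simp: windows_def width_def)
  have fin: "finite J" "J \<noteq> {}" using J assms(5) by (auto intro: finite_subset)
  note p = lift_window_props[OF assms(1) J(1) assms(3)]
  let ?I = "lift_window b (s, J, r)"
  have "card ?I = k"
    using p(1) J(2) by (simp add: lift_window_def card_image strict_mono_on_imp_inj_on)
  moreover have "?I \<subseteq> {0..<length \<tau>}" using p(2) inside[OF assms(1)] by auto
  moreover have "width ?I \<le> W"
  proof -
    have I: "finite ?I" "?I \<noteq> {}" using fin by (auto simp: lift_window_def)
    obtain c where c: "c \<in> J" "Max ?I = s + (c * b + r c)"
      using Max_in[OF I] by (auto simp: lift_window_def)
    obtain a where a: "a \<in> J" "Min ?I = s + (a * b + r a)"
      using Min_in[OF I] by (auto simp: lift_window_def)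
    have "c \<le> Max J" "Min J \<le> a" using fin a c by auto
    \<comment> \<open>The extreme points lie in two of at most \<open>w\<close> consecutive blocks,
      so the lifted width is at most \<open>w * b\<close>.\<close>
    then have "c + 1 \<le> a + w" using wd by linarith
    then have "(c + 1) * b \<le> (a + w) * b" by (rule mult_right_mono) simp
    then have "c * b + b \<le> a * b + w * b" by (simp add: algebra_simps)
    moreover have "r c < b" using assms(3) c by auto
    moreover have "1 \<le> w" using wd by simp
    then have "b \<le> w * b" by simp
    ultimately have "c * b + r c + 1 \<le> a * b + W" "1 \<le> W" using assms(4) by linarith+
    then show ?thesis unfolding width_def c(2) a(2) by simp
  qed
  ultimately show ?thesis by (simp add: windows_def)
qed

text \<open>All three components can be read off a lifted window: disjointness of the copies gives
  \<open>s\<close>, quotients by \<open>b\<close> give \<open>J\<close>, remainders give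
  \<open>r\<close>.\<close>

lemma inj_on_lift_window:
  assumes X: "\<And>J. J \<in> X \<Longrightarrow> J \<subseteq> {0..<length \<sigma>} \<and> J \<noteq> {}"
  shows "inj_on (lift_window b) (lifts X)"
proof (rule inj_onI)
  fix u v assume u: "u \<in> lifts X" and v: "v \<in> lifts X" and eq: "lift_window b u = lift_window b v"
  obtain s J r where u': "u = (s, J, r)" "s \<in> C" "J \<in> X" "r \<in> J \<rightarrow>\<^sub>E {0..<b}"
    using u by (auto simp: lifts_def)
  obtain s' J' r' where v': "v = (s', J', r')" "s' \<in> C" "J' \<in> X" "r' \<in> J' \<rightarrow>\<^sub>E {0..<b}"
    using v by (auto simp: lifts_def)
  let ?I = "lift_window b u"
  have "?I \<subseteq> {s..<s + b * length \<sigma>}" "?I \<subseteq> {s'..<s' + b * length \<sigma>}"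
    using lift_window_props(2)[OF u'(2) _ u'(4)] lift_window_props(2)[OF v'(2) _ v'(4)] X[OF u'(3)] X[OF v'(3)]
      eq u'(1) v'(1) by auto
  moreover have "?I \<noteq> {}" using X[OF u'(3)] u'(1) by (auto simp: lift_window_def)
  then obtain x where "x \<in> ?I" by blast
  ultimately have "x < s + b * length \<sigma>" "s' \<le> x" "x < s' + b * length \<sigma>" "s \<le> x" by (auto simp: subset_iff)
  then have s: "s = s'" using apart[OF u'(2) v'(2)] apart[OF v'(2) u'(2)] by linarith
  have r: "r a < b" if "a \<in> J" for a using u'(4) that by auto
  have r': "r' a < b" if "a \<in> J'" for a using v'(4) that by auto
  have dv: "(a * b + r a) div b = a" if "a \<in> J" for a using r[OF that] by auto
  have dv': "(a * b + r' a) div b = a" if "a \<in> J'" for a using r'[OF that] by auto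
  have "(\<lambda>x. (x - s) div b) ` ?I = (\<lambda>a. (a * b + r a) div b) ` J"
    unfolding u'(1) lift_window_def by (simp add: image_image)
  also have "\<dots> = J" using dv by simp
  finally have im: "(\<lambda>x. (x - s) div b) ` ?I = J" .
  have "(\<lambda>x. (x - s) div b) ` lift_window b v = (\<lambda>a. (a * b + r' a) div b) ` J'"
    unfolding v'(1) lift_window_def s by (simp add: image_image)
  also have "\<dots> = J'" using dv' by simp
  finally have im': "(\<lambda>x. (x - s) div b) ` ?I = J'" unfolding eq .
  have J: "J = J'" using im im' by simp
  have "r a = r' a" for a
  proof (cases "a \<in> J")
    case True
    then have "s + (a * b + r a) \<in> lift_window b u"
      unfolding u'(1) lift_window_def by auto
    then have "s + (a * b + r a) \<in> lift_window b v" unfolding eq .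
    then obtain c where c: "c \<in> J'" "s + (a * b + r a) = s' + (c * b + r' c)"
      unfolding v'(1) lift_window_def by auto
    then have "a * b + r a = c * b + r' c" using s by simp
    then have "(a * b + r a) div b = (c * b + r' c) div b" "(a * b + r a) mod b = (c * b + r' c) mod b" by simp_all
    then show ?thesis using r[OF True] r'[OF c(1)] by simp
  next
    case False
    then show ?thesis using u'(4) v'(4) J by (metis PiE_arb)
  qed
  then show "u = v" using u'(1) v'(1) s J by auto
qed

lemma card_lifts:
  assumes "finite X" "\<And>J. J \<in> X \<Longrightarrow> finite J \<and> card J = k"
  shows "card (lifts X) = card C * (card X * b ^ k)"
proof -
  have "card (SIGMA J:X. J \<rightarrow>\<^sub>E {0..<b}) = card X * b ^ k"
    using assms by (subst card_SigmaI) (auto simp: card_PiE finite_PiE)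
  then show ?thesis unfolding lifts_def using finite_C by (simp add: card_cartesian_product)
qed

text \<open>Every window of \<open>\<sigma>\<close> has the same number of lifts, and a lift is an
  occurrence exactly when the window is. So occurrences have the same proportion among the lifts as
  in \<open>\<sigma>\<close>. By \<open>many\<close> the windows of \<open>\<tau>\<close> that are
  not lifts make up at most a fraction \<open>\<epsilon>\<close>, and can shift the proportion by at
  most that much.\<close>

lemma dens_close:
  assumes k: "1 \<le> length \<pi>" and wW: "w * b \<le> W"
    and nonempty: "0 < card (windows (length \<sigma>) (length \<pi>) (real w))"
    and many: "(1 - \<epsilon>) * real (card (windows (length \<tau>) (length \<pi>) (real W)))
        \<le> real (card C * (card (windows (length \<sigma>) (length \<pi>) (real w)) * b ^ length \<pi>))"
    and \<epsilon>: "0 \<le> \<epsilon>" and C: "C \<noteq> {}" and b: "0 < b"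
  shows "\<bar>dens (real W) \<pi> \<tau> - dens (real w) \<pi> \<sigma>\<bar> \<le> \<epsilon>"
proof -
  let ?k = "length \<pi>"
  let ?V = "windows (length \<sigma>) ?k (real w)" and ?U = "windows (length \<tau>) ?k (real W)"
  let ?V1 = "{I \<in> ?V. occurs_at \<pi> \<sigma> I}" and ?U1 = "{I \<in> ?U. occurs_at \<pi> \<tau> I}"
  have V: "J \<subseteq> {0..<length \<sigma>} \<and> J \<noteq> {}" "finite J \<and> card J = ?k" if "J \<in> ?V" for J
    using that k by (auto simp: windows_def intro: finite_subset)
  have G: "card (lift_window b ` lifts X) = card C * (card X * b ^ ?k)" if "X \<subseteq> ?V" for X
  proof -
    have "inj_on (lift_window b) (lifts X)" using that V by (intro inj_on_lift_window) auto
    moreover have "card (lifts X) = card C * (card X * b ^ ?k)"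
      using that V finite_subset[OF that finite_windows] by (intro card_lifts) auto
    ultimately show ?thesis by (simp add: card_image)
  qed
  have sub: "lift_window b ` lifts ?V \<subseteq> ?U"
    using lift_window_in_windows[OF _ _ _ wW k] by (auto simp: lifts_def)
  have occ: "I \<in> lift_window b ` lifts ?V1 \<longleftrightarrow> occurs_at \<pi> \<tau> I" if "I \<in> lift_window b ` lifts ?V" for I
  proof -
    from that obtain s J r where I: "I = lift_window b (s, J, r)" "s \<in> C" "J \<in> ?V" "r \<in> J \<rightarrow>\<^sub>E {0..<b}"
      by (auto simp: lifts_def)
    have iff: "occurs_at \<pi> \<tau> I \<longleftrightarrow> occurs_at \<pi> \<sigma> J"
      using lift_window_props(3)[OF I(2) _ I(4)] V(1)[OF I(3)] I(1) by auto
    show ?thesis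
    proof
      assume "I \<in> lift_window b ` lifts ?V1"
      then obtain s' J' r' where I': "I = lift_window b (s', J', r')" "s' \<in> C" "J' \<in> ?V1" "r' \<in> J' \<rightarrow>\<^sub>E {0..<b}"
        by (auto simp: lifts_def)
      show "occurs_at \<pi> \<tau> I"
        using lift_window_props(3)[OF I'(2) _ I'(4)] V(1)[of J'] I'(1,3) by auto
    next
      assume "occurs_at \<pi> \<tau> I"
      then have "J \<in> ?V1" using I(3) iff by auto
      then have "(s, J, r) \<in> lifts ?V1" using I by (auto simp: lifts_def)
      then show "I \<in> lift_window b ` lifts ?V1" using I(1) by blast
    qed
  qed
  define c where "c = real (card C * b ^ ?k)"
  define u where "u = real (card ?U)"
  define u1 where "u1 = real (card ?U1)"
  define v where "v = real (card ?V)"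
  define v1 where "v1 = real (card ?V1)"
  have GV: "real (card (lift_window b ` lifts ?V)) = c * v" and GV1: "real (card (lift_window b ` lifts ?V1)) = c * v1"
    by (subst G; simp add: c_def v_def v1_def)+
  have "lift_window b ` lifts ?V1 \<subseteq> ?U1"
  proof
    fix I assume I: "I \<in> lift_window b ` lifts ?V1"
    then have "I \<in> lift_window b ` lifts ?V" by (auto simp: lifts_def)
    then show "I \<in> ?U1" using I occ sub by blast
  qed
  then have "card (lift_window b ` lifts ?V1) \<le> card ?U1" by (intro card_mono) auto
  then have lo: "c * v1 \<le> u1" unfolding GV1[symmetric] u1_def by simp
  \<comment> \<open>For the upper bound every window that is not a lift is counted as an
    occurrence.\<close>
  have "?U1 \<subseteq> lift_window b ` lifts ?V1 \<union> (?U - lift_window b ` lifts ?V)" using occ by auto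
  then have "card ?U1 \<le> card (lift_window b ` lifts ?V1 \<union> (?U - lift_window b ` lifts ?V))"
    using sub by (intro card_mono finite_UnI) (auto intro: finite_subset[of _ ?U] simp: \<open>lift_window b ` lifts ?V1 \<subseteq> ?U1\<close> finite_subset[OF \<open>lift_window b ` lifts ?V1 \<subseteq> ?U1\<close>])
  also have "\<dots> \<le> card (lift_window b ` lifts ?V1) + card (?U - lift_window b ` lifts ?V)" by (rule card_Un_le)
  also have "card (?U - lift_window b ` lifts ?V) = card ?U - card (lift_window b ` lifts ?V)"
    by (intro card_Diff_subset sub finite_subset[OF sub finite_windows])
  finally have "real (card ?U1) \<le> real (card (lift_window b ` lifts ?V1)) + (real (card ?U) - real (card (lift_window b ` lifts ?V)))"
    using card_mono[OF finite_windows sub] by linarith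
  then have hi: "u1 \<le> c * v1 + (u - c * v)" unfolding GV GV1 u_def u1_def .
  have cvu: "c * v \<le> u" using card_mono[OF finite_windows sub] GV u_def by (metis of_nat_le_iff)
  have m: "(1 - \<epsilon>) * u \<le> c * v" using many by (simp add: c_def u_def v_def algebra_simps)
  have v: "0 < v" "0 \<le> v1" "v1 \<le> v" "0 \<le> c" "0 \<le> u1"
    using nonempty by (auto simp: v_def v1_def c_def u1_def intro!: card_mono)
  have u1u: "u1 \<le> u" unfolding u1_def u_def by (auto intro!: card_mono)
  have d: "dens (real W) \<pi> \<tau> = u1 / u" "dens (real w) \<pi> \<sigma> = v1 / v"
    by (simp_all add: dens_def u_def u1_def v_def v1_def)
  have "0 < c" using C b finite_C by (simp add: c_def card_gt_0_iff)
  then have u: "0 < u" using cvu v by (meson less_le_trans mult_pos_pos)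
    define x where "x = v1 / v"
    have x: "0 \<le> x" "x \<le> 1" "v1 = x * v" using v by (auto simp: x_def)
    have "x * ((1 - \<epsilon>) * u) \<le> x * (c * v)" using m x by (intro mult_left_mono)
    then have "x * u - \<epsilon> * (x * u) \<le> u1" using lo x(3) by (simp add: algebra_simps)
    moreover have "\<epsilon> * (x * u) \<le> \<epsilon> * u" using x u \<epsilon> by (intro mult_left_mono) (auto intro: mult_left_le_one_le)
    ultimately have 1: "(x - \<epsilon>) * u \<le> u1" by (simp add: algebra_simps)
    have "u1 \<le> x * (c * v) + (u - c * v)" using hi x(3) by (simp add: algebra_simps)
    moreover have "x * (c * v) \<le> x * u" using cvu x by (intro mult_left_mono)
    ultimately have 2: "u1 \<le> (x + \<epsilon>) * u" using m by (simp add: algebra_simps)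
    have "x - \<epsilon> \<le> u1 / u" "u1 / u \<le> x + \<epsilon>" using 1 2 u by (simp_all add: field_simps)
    then show ?thesis unfolding d x_def[symmetric] by linarith
qed

end

section \<open>Weaving two words\<close>

lemma is_perm_nth_less: "is_perm \<sigma> \<Longrightarrow> i < length \<sigma> \<Longrightarrow> \<sigma> ! i < length \<sigma>"
  unfolding is_perm_def using nth_mem by fastforce

lemma is_perm_nth_eq_iff:
  "is_perm \<sigma> \<Longrightarrow> i < length \<sigma> \<Longrightarrow> j < length \<sigma> \<Longrightarrow> \<sigma> ! i = \<sigma> ! j \<longleftrightarrow> i = j"
  unfolding is_perm_def by (simp add: nth_eq_iff_index_eq)

lemma length_inv_perm [simp]: "length (inv_perm \<sigma>) = length \<sigma>"
  by (simp add: inv_perm_def)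

lemma bij_betw_is_perm_nth: "is_perm \<sigma> \<Longrightarrow> bij_betw ((!) \<sigma>) {0..<length \<sigma>} {0..<length \<sigma>}"
  unfolding is_perm_def by (intro bij_betw_nth) (auto simp: atLeast0LessThan)

lemma is_perm_map_upt:
  assumes "bij_betw g {0..<n} {0..<n}"
  shows "is_perm (map g [0..<n])"
  using assms by (auto simp: is_perm_def distinct_map bij_betw_def)

lemma inv_perm_nth:
  assumes "is_perm \<sigma>" "i < length \<sigma>"
  shows "inv_perm \<sigma> ! (\<sigma> ! i) = i"
proof -
  have "inv_into {0..<length \<sigma>} ((!) \<sigma>) (\<sigma> ! i) = i"
    using bij_betw_is_perm_nth[OF assms(1)] assms(2) by (intro inv_into_f_f) (auto simp: bij_betw_def)
  then show ?thesis using is_perm_nth_less[OF assms] by (simp add: inv_perm_def)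
qed

lemma is_perm_inv_perm:
  assumes "is_perm \<sigma>"
  shows "is_perm (inv_perm \<sigma>)"
  unfolding inv_perm_def
  using bij_betw_inv_into[OF bij_betw_is_perm_nth[OF assms]] by (intro is_perm_map_upt)

lemma is_perm_surj:
  assumes "is_perm \<sigma>" "v < length \<sigma>"
  obtains i where "i < length \<sigma>" "\<sigma> ! i = v"
proof -
  have "v \<in> set \<sigma>" using assms by (simp add: is_perm_def)
  then show ?thesis using that by (metis in_set_conv_nth)
qed

text \<open>Both words of a weave share the multiplicity \<open>R\<close>: the index of an
  occurrence of a letter in one word can then also serve as an occurrence index in the
  other.\<close>

definition balanced :: "(nat \<Rightarrow> nat) \<Rightarrow> nat \<Rightarrow> nat \<Rightarrow> bool" where
  "balanced Q P R \<longleftrightarrow> (\<forall>z < P * R. Q z < P) \<and> (\<forall>j < P. card {z. z < P * R \<and> Q z = j} = R)"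

text \<open>\<open>\<rho>\<close> numbers the occurrences of each letter by \<open>0..<R\<close>; a
  position then amounts to a letter together with an occurrence number.\<close>

lemma balanced_bij:
  assumes "balanced Q P R"
  obtains \<rho> where "bij_betw (\<lambda>z. (Q z, \<rho> z)) {0..<P * R} ({0..<P} \<times> {0..<R})"
proof -
  have "\<exists>h. bij_betw h {z. z < P * R \<and> Q z = j} {0..<R}" if "j < P" for j
    using ex_bij_betw_finite_nat[of "{z. z < P * R \<and> Q z = j}"] assms that by (auto simp: balanced_def)
  then obtain h where h: "\<And>j. j < P \<Longrightarrow> bij_betw (h j) {z. z < P * R \<and> Q z = j} {0..<R}"
    by metis
  have Q: "Q z < P" if "z < P * R" for z using assms that by (auto simp: balanced_def)
  let ?F = "\<lambda>z. (Q z, h (Q z) z)"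
  have "inj_on ?F {0..<P * R}"
  proof (rule inj_onI)
    fix x y assume xy: "x \<in> {0..<P * R}" "y \<in> {0..<P * R}" "?F x = ?F y"
    then have "inj_on (h (Q x)) {z. z < P * R \<and> Q z = Q x}" using h[OF Q] by (auto simp: bij_betw_def)
    then show "x = y" using xy by (auto dest: inj_onD)
  qed
  moreover have "?F ` {0..<P * R} \<subseteq> {0..<P} \<times> {0..<R}"
  proof clarsimp
    fix z assume "z < P * R"
    then show "Q z < P \<and> h (Q z) z < R" using Q[of z] h[of "Q z"] by (auto dest!: bij_betwE)
  qed
  moreover have "card (?F ` {0..<P * R}) = card ({0..<P} \<times> {0..<R})"
    using calculation(1) by (simp add: card_image card_cartesian_product)
  ultimately have "bij_betw ?F {0..<P * R} ({0..<P} \<times> {0..<R})"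
    by (simp add: bij_betw_def card_subset_eq)
  then show ?thesis by (rule that)
qed

lemma mult_add_less_mult_add:
  fixes a c L :: nat
  assumes "a < c" "x < L"
  shows "a * L + x < c * L + y"
proof -
  have "a * L + x < Suc a * L" using assms by simp
  also have "\<dots> \<le> c * L" using assms by (intro mult_right_mono) auto
  finally show ?thesis by simp
qed

lemma mult_add_eq_iff:
  fixes a c L :: nat
  assumes "x < L" "y < L"
  shows "a * L + x = c * L + y \<longleftrightarrow> a = c \<and> x = y"
proof
  assume e: "a * L + x = c * L + y"
  have "(a * L + x) div L = a" "(c * L + y) div L = c" "(a * L + x) mod L = x" "(c * L + y) mod L = y"
    using assms by auto
  then show "a = c \<and> x = y" using e by metis
qed auto

text \<open>The word starts afresh in every column of \<open>L\<close> positions. Pairs in different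
  columns and pairs with equal letters are left unconstrained, which is the freedom that the other
  word exploits.\<close>

definition follows_word :: "(nat \<Rightarrow> nat) \<Rightarrow> nat \<Rightarrow> nat list \<Rightarrow> bool" where
  "follows_word Q L \<tau> \<longleftrightarrow> (\<forall>x<length \<tau>. \<forall>y<length \<tau>.
     x div L = y div L \<longrightarrow> Q (x mod L) < Q (y mod L) \<longrightarrow> \<tau> ! x < \<tau> ! y)"

text \<open>Position \<open>(u, i, z)\<close>, in mixed radix with digit ranges \<open>length \<gamma>\<close>, \<open>P'\<close>, \<open>P * R\<close>, is sent to
  value \<open>(\<gamma> ! u, Q z, z')\<close>, with digit ranges \<open>length \<gamma>\<close>, \<open>P\<close>, \<open>P' * R\<close>, where \<open>Q' z' = i\<close> and \<open>z'\<close>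
  has the same index in its fibre of \<open>Q'\<close> as \<open>z\<close> in its fibre of \<open>Q\<close>. The digits \<open>i\<close> and \<open>Q z\<close> change
  places, so this rule and its inverse have the same shape.\<close>

lemma weave:
  assumes \<gamma>: "is_perm \<gamma>" and Q: "balanced Q P R" and Q': "balanced Q' P' R"
    and n: "n = length \<gamma> * (P' * (P * R))"
  obtains \<tau> where "is_perm \<tau>" "length \<tau> = n"
    and "\<And>x y. \<lbrakk>x < n; y < n; \<gamma> ! (x div (P' * (P * R))) < \<gamma> ! (y div (P' * (P * R)))\<rbrakk> \<Longrightarrow> \<tau> ! x < \<tau> ! y"
    and "follows_word Q (P * R) \<tau>" and "follows_word Q' (P' * R) (inv_perm \<tau>)"
proof -
  define L where "L = P * R"
  define L' where "L' = P' * R"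
  obtain \<rho> where \<rho>: "bij_betw (\<lambda>z. (Q z, \<rho> z)) {0..<L} ({0..<P} \<times> {0..<R})"
    using balanced_bij[OF Q] L_def by metis
  obtain \<rho>' where \<rho>': "bij_betw (\<lambda>z. (Q' z, \<rho>' z)) {0..<L'} ({0..<P'} \<times> {0..<R})"
    using balanced_bij[OF Q'] L'_def by metis
  \<comment> \<open>\<open>\<psi> (i, r)\<close> is the place in \<open>Q'\<close> of occurrence
    number \<open>r\<close> of the letter \<open>i\<close>.\<close>
  define \<psi> where "\<psi> = inv_into {0..<L'} (\<lambda>z. (Q' z, \<rho>' z))"
  have \<psi>: "\<psi> (i, r) < L'" "Q' (\<psi> (i, r)) = i" "\<rho>' (\<psi> (i, r)) = r" if "i < P'" "r < R" for i r
  proof -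
    have ir: "(i, r) \<in> (\<lambda>z. (Q' z, \<rho>' z)) ` {0..<L'}" using \<rho>' that by (auto simp: bij_betw_def)
    show "\<psi> (i, r) < L'" using inv_into_into[OF ir] by (simp add: \<psi>_def)
    show "Q' (\<psi> (i, r)) = i" "\<rho>' (\<psi> (i, r)) = r" using f_inv_into_f[OF ir] by (simp_all add: \<psi>_def)
  qed
  have zr: "Q z < P" "\<rho> z < R" if "z < L" for z using bij_betwE[OF \<rho>] that by auto
  have zinj: "z = z'" if "z < L" "z' < L" "Q z = Q z'" "\<rho> z = \<rho> z'" for z z'
    using \<rho> that by (auto simp: bij_betw_def dest: inj_onD)
  \<comment> \<open>\<open>U\<close> and \<open>Y\<close> name the column and \<open>Z\<close> the
    place in it; \<open>U\<close> alone is the position in \<open>\<gamma>\<close>.\<close>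
  define U where "U p = p div (P' * L)" for p
  define Y where "Y p = (p div L) mod P'" for p
  define Z where "Z p = p mod L" for p
  have nL: "n = length \<gamma> * (P' * L)" "n = length \<gamma> * P * L'" using n by (simp_all add: L_def L'_def ac_simps)
  have dig: "U p < length \<gamma>" "Y p < P'" "Z p < L" if "p < n" for p
  proof -
    have "0 < n" using that by simp
    then have pos: "0 < P'" "0 < L" using nL(1) by auto
    then show "Y p < P'" "Z p < L" by (simp_all add: Y_def Z_def)
    show "U p < length \<gamma>" unfolding U_def using that nL(1) by (simp add: less_mult_imp_div_less)
  qed
  have dec: "p = (U p * P' + Y p) * L + Z p" for p
  proof -
    have "U p * P' + Y p = p div L" unfolding U_def Y_def by (metis div_mult2_eq div_mult_mod_eq mult.commute)
    then show ?thesis by (simp add: Z_def)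
  qed
  \<comment> \<open>Rows have length \<open>L'\<close>. Among the rows of one coarse value the
    letter \<open>Q (Z p)\<close> selects the row, so inside a column ordering by letters is
    ordering by rows.\<close>
  define g where "g p = (\<gamma> ! U p * P + Q (Z p)) * L' + \<psi> (Y p, \<rho> (Z p))" for p
  have \<psi>g: "\<psi> (Y p, \<rho> (Z p)) < L'" "Q' (\<psi> (Y p, \<rho> (Z p))) = Y p" "\<rho>' (\<psi> (Y p, \<rho> (Z p))) = \<rho> (Z p)" "Q (Z p) < P"
    if "p < n" for p
    using \<psi>[of "Y p" "\<rho> (Z p)"] dig[OF that] zr[of "Z p"] by auto
  have g_less: "g p < n" if "p < n" for p
  proof -
    have "\<gamma> ! U p * P + Q (Z p) < P * length \<gamma>"
      by (rule add_mult_less[OF \<psi>g(4)[OF that] is_perm_nth_less[OF \<gamma> dig(1)[OF that]]])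
    then have "g p < L' * (P * length \<gamma>)" unfolding g_def by (rule add_mult_less[OF \<psi>g(1)[OF that]])
    then show ?thesis using nL(2) by (simp add: ac_simps)
  qed
  \<comment> \<open>Along a row \<open>U\<close> and \<open>Q (Z _)\<close> are constant, so the
    position is governed first by \<open>Y\<close>, which is the letter of \<open>Q'\<close> at the
    place in the row. This is what makes the inverse follow \<open>Q'\<close>.\<close>
  have g_row: "U x = U y \<and> Q (Z x) = Q (Z y)"
    if xy: "x < n" "y < n" and e: "g x div L' = g y div L'" for x y
  proof -
    have "\<gamma> ! U x * P + Q (Z x) = \<gamma> ! U y * P + Q (Z y)"
      using e \<psi>g[OF xy(1)] \<psi>g[OF xy(2)] by (simp add: g_def)
    then have "\<gamma> ! U x = \<gamma> ! U y \<and> Q (Z x) = Q (Z y)"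
      using mult_add_eq_iff \<psi>g(4)[OF xy(1)] \<psi>g(4)[OF xy(2)] by blast
    then show ?thesis using is_perm_nth_eq_iff[OF \<gamma>] dig(1) xy by auto
  qed
  have g_mod: "g x mod L' = \<psi> (Y x, \<rho> (Z x))" if "x < n" for x
    using \<psi>g[OF that] by (simp add: g_def)
  have inj: "x = y" if xy: "x < n" "y < n" and e: "g x = g y" for x y
  proof -
    have 1: "U x = U y" "Q (Z x) = Q (Z y)" using g_row[OF xy] e by auto
    have "\<psi> (Y x, \<rho> (Z x)) = \<psi> (Y y, \<rho> (Z y))" using g_mod xy e by metis
    then have "Y x = Y y" "\<rho> (Z x) = \<rho> (Z y)" using \<psi>g xy by metis+
    moreover have "Z x = Z y" using zinj dig xy 1 calculation by blast
    ultimately show ?thesis using dec 1 by metis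
  qed
  have bij: "bij_betw g {0..<n} {0..<n}"
    unfolding bij_betw_def
  proof
    show I: "inj_on g {0..<n}" by (auto intro!: inj_onI inj)
    show "g ` {0..<n} = {0..<n}" by (rule endo_inj_surj) (auto simp: g_less I)
  qed
  define \<tau> where "\<tau> = map g [0..<n]"
  have \<tau>: "is_perm \<tau>" "length \<tau> = n" "\<And>x. x < n \<Longrightarrow> \<tau> ! x = g x"
    using is_perm_map_upt[OF bij] by (simp_all add: \<tau>_def)
  have "follows_word Q (P * R) \<tau>"
    unfolding follows_word_def \<tau>(2)
  proof (intro allI impI)
    fix x y assume xy: "x < n" "y < n"
      and col: "x div (P * R) = y div (P * R)" and lt: "Q (x mod (P * R)) < Q (y mod (P * R))"
    have "U x = U y" using col unfolding U_def L_def by (metis div_mult2_eq mult.commute)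
    moreover have "Q (Z x) < Q (Z y)" using lt by (simp add: Z_def L_def)
    ultimately have "g x < g y" unfolding g_def
      by (intro mult_add_less_mult_add[OF _ \<psi>g(1)[OF xy(1)]]) simp
    then show "\<tau> ! x < \<tau> ! y" using \<tau>(3) xy by simp
  qed
  moreover have "follows_word Q' (P' * R) (inv_perm \<tau>)"
    unfolding follows_word_def length_inv_perm \<tau>(2)
  proof (intro allI impI)
    fix v w assume vw: "v < n" "w < n"
      and row: "v div (P' * R) = w div (P' * R)" and lt: "Q' (v mod (P' * R)) < Q' (w mod (P' * R))"
    obtain x where x: "x < n" "\<tau> ! x = v" using is_perm_surj[OF \<tau>(1)] vw(1) \<tau>(2) by metis
    obtain y where y: "y < n" "\<tau> ! y = w" using is_perm_surj[OF \<tau>(1)] vw(2) \<tau>(2) by metis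
    have v: "v = g x" and w: "w = g y" using x y \<tau>(3) by auto
    have "U x = U y" using g_row[OF x(1) y(1)] row v w by (auto simp: L'_def)
    moreover have "Y x < Y y"
      using lt g_mod[OF x(1)] g_mod[OF y(1)] \<psi>g[OF x(1)] \<psi>g[OF y(1)] v w by (simp add: L'_def)
    ultimately have "(U x * P' + Y x) * L + Z x < (U y * P' + Y y) * L + Z y"
      by (intro mult_add_less_mult_add[OF _ dig(3)[OF x(1)]]) simp
    then have "x < y" using dec by metis
    then show "inv_perm \<tau> ! v < inv_perm \<tau> ! w"
      using inv_perm_nth[OF \<tau>(1)] x y \<tau>(2) by auto
  qed
  moreover have "\<tau> ! x < \<tau> ! y" if xy: "x < n" "y < n"
      and "\<gamma> ! (x div (P' * (P * R))) < \<gamma> ! (y div (P' * (P * R)))" for x y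
  proof -
    have lt: "\<gamma> ! U x < \<gamma> ! U y" using that(3) by (simp add: U_def L_def)
    have "g x < g y" unfolding g_def
      by (intro mult_add_less_mult_add lt \<psi>g xy)
    then show "\<tau> ! x < \<tau> ! y" using \<tau>(3) xy by simp
  qed
  ultimately show ?thesis using that \<tau>(1,2) by blast
qed

section \<open>Words with prescribed levels\<close>

text \<open>The tuple is coded as one number in mixed radix with the coarsest level as leading
  digit: coarse digits are constant near a typical point, and the level of interest must overrule
  everything finer.\<close>

primrec lex_word :: "(nat \<Rightarrow> nat list) \<Rightarrow> (nat \<Rightarrow> nat) \<Rightarrow> nat \<Rightarrow> nat \<Rightarrow> nat" where
  "lex_word \<sigma> b 0 x = 0"
| "lex_word \<sigma> b (Suc i) x =
     \<sigma> i ! ((x div b i) mod length (\<sigma> i)) * (\<Prod>l<i. length (\<sigma> l)) + lex_word \<sigma> b i x"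

text \<open>\<open>e i\<close> is the number of periods of level \<open>i\<close> in a block of
  level \<open>i + 1\<close>. As it is an integer, no period straddles a boundary between coarser
  blocks.\<close>

locale levels =
  fixes \<sigma> :: "nat \<Rightarrow> nat list" and b e :: "nat \<Rightarrow> nat"
  assumes perm: "\<And>i. is_perm (\<sigma> i)"
    and nonempty: "\<And>i. 0 < length (\<sigma> i)"
    and b_0: "0 < b 0"
    and e_pos: "\<And>i. 0 < e i"
    and b_Suc: "\<And>i. b (Suc i) = b i * length (\<sigma> i) * e i"
begin

abbreviation "alph i \<equiv> \<Prod>l<i. length (\<sigma> l)"

lemma alph_pos: "0 < alph i"
  using nonempty by (simp add: prod_pos)

lemma b_pos: "0 < b i"
  by (induction i) (use b_0 e_pos nonempty in \<open>auto simp: b_Suc\<close>)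

lemma nth_mod_less: "\<sigma> i ! (x mod length (\<sigma> i)) < length (\<sigma> i)"
  using is_perm_nth_less[OF perm] nonempty by simp

lemma lex_word_less: "lex_word \<sigma> b i x < alph i"
proof (induction i)
  case (Suc i)
  show ?case using add_mult_less[OF Suc nth_mod_less[of i "x div b i"]] by (simp add: mult.commute)
qed simp

lemma period_dvd: "i < j \<Longrightarrow> b i * length (\<sigma> i) dvd b j"
proof (induction j)
  case (Suc j)
  show ?case
  proof (cases "i = j")
    case False
    then have "b i * length (\<sigma> i) dvd b j" using Suc by simp
    then show ?thesis by (simp add: b_Suc)
  qed (simp add: b_Suc)
qed simp

text \<open>A period of level \<open>i\<close> lies in one block of every coarser level, so all
  coarser digits of \<open>x\<close> and \<open>y\<close> coincide and the digit of level
  \<open>i\<close> is the leading one that differs.\<close>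

lemma lex_word_mono:
  assumes "i < T" "x div (b i * length (\<sigma> i)) = y div (b i * length (\<sigma> i))"
    and "\<sigma> i ! ((x div b i) mod length (\<sigma> i)) < \<sigma> i ! ((y div b i) mod length (\<sigma> i))"
  shows "lex_word \<sigma> b T x < lex_word \<sigma> b T y"
  using assms(1)
proof (induction T)
  case (Suc T)
  show ?case
  proof (cases "i = T")
    case True
    then show ?thesis using mult_add_less_mult_add[OF assms(3) lex_word_less] by simp
  next
    case False
    then have "i < T" using Suc by simp
    then have "x div b T = y div b T" using period_dvd[OF \<open>i < T\<close>] assms(2)
      by (metis dvd_def div_mult2_eq)
    then show ?thesis using Suc \<open>i < T\<close> by simp
  qed
qed simp

text \<open>Equidistribution of the letters in every block of level \<open>i\<close>, in product
  form to avoid a division. In the induction, the leading digit of \<open>l\<close> singles out one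
  of the \<open>length (\<sigma> i)\<close> subblocks in each of the \<open>e i\<close> periods, and
  the remaining digits are counted inside these subblocks.\<close>

lemma lex_word_count:
  "l < alph i \<Longrightarrow> card {x. x div b i = s \<and> lex_word \<sigma> b i x = l} * alph i = b i"
proof (induction i arbitrary: s l)
  case 0
  have "x div b 0 = s \<longleftrightarrow> s * b 0 \<le> x \<and> x < s * b 0 + b 0" for x
    using b_0 by (metis div_nat_eqI dividend_less_times_div add.commute mult.commute times_div_less_eq_dividend mult_Suc_right)
  then have "{x. x div b 0 = s} = {s * b 0..<s * b 0 + b 0}"
    by (intro set_eqI) (simp only: mem_Collect_eq atLeastLessThan_iff)
  then show ?case using 0 by simp
next
  case (Suc i)
  define m where "m = length (\<sigma> i)"
  define l1 where "l1 = l div alph i"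
  define l0 where "l0 = l mod alph i"
  have m: "0 < m" using nonempty by (simp add: m_def)
  have l1: "l1 < m" using Suc.prems by (simp add: l1_def m_def less_mult_imp_div_less mult.commute)
  have l0: "l0 < alph i" using alph_pos by (simp add: l0_def)
  have l: "l = l1 * alph i + l0" unfolding l1_def l0_def by (rule div_mult_mod_eq[symmetric])
  obtain a where a: "a < m" "\<sigma> i ! a = l1" using is_perm_surj[OF perm] l1 m_def by metis
  have word: "lex_word \<sigma> b (Suc i) x = l \<longleftrightarrow> (x div b i) mod m = a \<and> lex_word \<sigma> b i x = l0" for x
  proof -
    have "lex_word \<sigma> b (Suc i) x = l \<longleftrightarrow> \<sigma> i ! ((x div b i) mod m) = l1 \<and> lex_word \<sigma> b i x = l0"
      unfolding l lex_word.simps m_def by (rule mult_add_eq_iff[OF lex_word_less l0])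
    moreover have "\<sigma> i ! ((x div b i) mod m) = l1 \<longleftrightarrow> (x div b i) mod m = a"
      using is_perm_nth_eq_iff[OF perm, of "(x div b i) mod m" i a] a m by (auto simp: m_def)
    ultimately show ?thesis by simp
  qed
  \<comment> \<open>\<open>d\<close> runs over the periods of level \<open>i\<close> in block
    \<open>s\<close> of the next level; \<open>a\<close> is the subblock in which
    \<open>\<sigma> i\<close> has the required digit.\<close>
  have quot: "x div b (Suc i) = s \<and> (x div b i) mod m = a \<longleftrightarrow> (\<exists>d<e i. x div b i = (s * e i + d) * m + a)" for x
  proof -
    have "x div b (Suc i) = x div b i div m div e i" by (simp add: b_Suc m_def div_mult2_eq)
    moreover have "t div m div e i = s \<and> t mod m = a \<longleftrightarrow> (\<exists>d<e i. t = (s * e i + d) * m + a)" for t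
    proof
      assume t: "t div m div e i = s \<and> t mod m = a"
      then have "t = (s * e i + (t div m) mod e i) * m + a" by (metis div_mult_mod_eq)
      then show "\<exists>d<e i. t = (s * e i + d) * m + a" using e_pos by (meson mod_less_divisor)
    next
      assume "\<exists>d<e i. t = (s * e i + d) * m + a"
      then show "t div m div e i = s \<and> t mod m = a" using a by auto
    qed
    ultimately show ?thesis by simp
  qed
  have "x div b (Suc i) = s \<and> lex_word \<sigma> b (Suc i) x = l
      \<longleftrightarrow> (\<exists>d<e i. x div b i = (s * e i + d) * m + a \<and> lex_word \<sigma> b i x = l0)" for x
    using word[of x] quot[of x] by blast
  then have "{x. x div b (Suc i) = s \<and> lex_word \<sigma> b (Suc i) x = l}
      = {x. \<exists>d<e i. x div b i = (s * e i + d) * m + a \<and> lex_word \<sigma> b i x = l0}"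
    by (simp only:)
  then have "{x. x div b (Suc i) = s \<and> lex_word \<sigma> b (Suc i) x = l}
      = (\<Union>d\<in>{0..<e i}. {x. x div b i = (s * e i + d) * m + a \<and> lex_word \<sigma> b i x = l0})"
    by auto
  moreover have "card (\<Union>d\<in>{0..<e i}. {x. x div b i = (s * e i + d) * m + a \<and> lex_word \<sigma> b i x = l0})
     = (\<Sum>d\<in>{0..<e i}. card {x. x div b i = (s * e i + d) * m + a \<and> lex_word \<sigma> b i x = l0})"
  proof (rule card_UN_disjoint)
    have "finite {x. x div b i = t}" for t
      by (rule finite_subset[of _ "{..<Suc t * b i}"])
        (use b_pos in \<open>auto simp: dividend_less_div_times add.commute\<close>)
    then show "\<forall>d\<in>{0..<e i}. finite {x. x div b i = (s * e i + d) * m + a \<and> lex_word \<sigma> b i x = l0}"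
      by (auto intro: finite_subset[rotated])
  qed (use m in auto)
  ultimately have "card {x. x div b (Suc i) = s \<and> lex_word \<sigma> b (Suc i) x = l} * alph (Suc i)
     = (\<Sum>d\<in>{0..<e i}. card {x. x div b i = (s * e i + d) * m + a \<and> lex_word \<sigma> b i x = l0} * alph i * m)"
    by (simp add: sum_distrib_right m_def mult.assoc)
  also have "\<dots> = (\<Sum>d\<in>{0..<e i}. b i * m)" using Suc.IH[OF l0] by simp
  also have "\<dots> = b (Suc i)" by (simp add: b_Suc m_def)
  finally show ?case .
qed

text \<open>The largest period \<open>b T\<close> need not divide the length of the word, so the last incomplete period is
  filled with a word that is balanced by itself.\<close>

lemma balanced_word:
  fixes T R :: nat
  defines "P \<equiv> alph T"
  defines "L \<equiv> P * R"
  defines "L0 \<equiv> b T * (L div b T)"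
  obtains Q where "balanced Q P R"
    and "\<And>i c x y. \<lbrakk>i < T; (c + 1) * (b i * length (\<sigma> i)) \<le> L0;
           x < b i * length (\<sigma> i); y < b i * length (\<sigma> i); \<sigma> i ! (x div b i) < \<sigma> i ! (y div b i)\<rbrakk>
           \<Longrightarrow> Q (c * (b i * length (\<sigma> i)) + x) < Q (c * (b i * length (\<sigma> i)) + y)"
proof -
  \<comment> \<open>The tail can use \<open>z mod P\<close>: by equidistribution \<open>P\<close>
    divides \<open>b T\<close>, so both \<open>L0\<close> and \<open>L\<close> are multiples of
    \<open>P\<close>, and every residue is taken equally often on \<open>{L0..<L}\<close>.\<close>
  define Q where "Q z = (if z < L0 then lex_word \<sigma> b T z else z mod P)" for z
  have P: "0 < P" using alph_pos by (simp add: P_def)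
  have "P dvd b T" using lex_word_count[of 0 T 0] P unfolding P_def by (metis dvd_triv_right)
  then have "P dvd L0" by (simp add: L0_def)
  then obtain r where r: "L0 = P * r" by blast
  have L0L: "L0 \<le> L" by (simp add: L0_def)
  then have rR: "r \<le> R" using P by (simp add: r L_def)
  have "card {z. z < L \<and> Q z = l} = R" if l: "l < P" for l
  proof -
    have "{z. z < L \<and> Q z = l} = {z. z < L0 \<and> lex_word \<sigma> b T z = l} \<union> {z. L0 \<le> z \<and> z < L \<and> z mod P = l}"
      using L0L by (auto simp: Q_def)
    moreover have "card ({z. z < L0 \<and> lex_word \<sigma> b T z = l} \<union> {z. L0 \<le> z \<and> z < L \<and> z mod P = l})
       = card {z. z < L0 \<and> lex_word \<sigma> b T z = l} + card {z. L0 \<le> z \<and> z < L \<and> z mod P = l}"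
      by (rule card_Un_disjoint) auto
    moreover have "card {z. z < L0 \<and> lex_word \<sigma> b T z = l} = r"
    proof -
      have "z < L0 \<longleftrightarrow> z div b T < L div b T" for z
        unfolding L0_def using b_pos[of T] by (metis div_less_iff_less_mult mult.commute)
      then have "{z. z < L0 \<and> lex_word \<sigma> b T z = l} = {z. z div b T < L div b T \<and> lex_word \<sigma> b T z = l}"
        by (simp only:)
      also have "\<dots> = (\<Union>s\<in>{0..<L div b T}. {z. z div b T = s \<and> lex_word \<sigma> b T z = l})"
        by auto
      finally have "{z. z < L0 \<and> lex_word \<sigma> b T z = l} = (\<Union>s\<in>{0..<L div b T}. {z. z div b T = s \<and> lex_word \<sigma> b T z = l})" .
      moreover have "card \<dots> = (\<Sum>s\<in>{0..<L div b T}. card {z. z div b T = s \<and> lex_word \<sigma> b T z = l})"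
      proof (rule card_UN_disjoint)
        have "finite {x. x div b T = t}" for t
          by (rule finite_subset[of _ "{..<Suc t * b T}"])
            (use b_pos in \<open>auto simp: dividend_less_div_times add.commute\<close>)
        then show "\<forall>s\<in>{0..<L div b T}. finite {z. z div b T = s \<and> lex_word \<sigma> b T z = l}"
          by (auto intro: finite_subset[rotated])
      qed auto
      ultimately have "card {z. z < L0 \<and> lex_word \<sigma> b T z = l} * P
          = (\<Sum>s\<in>{0..<L div b T}. card {z. z div b T = s \<and> lex_word \<sigma> b T z = l} * P)"
        by (simp add: sum_distrib_right)
      also have "\<dots> = L0" using lex_word_count[of l T] l by (simp add: P_def L0_def mult.commute)
      finally show ?thesis using P r by (simp add: mult.commute)
    qed
    moreover have "card {z. L0 \<le> z \<and> z < L \<and> z mod P = l} = R - r"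
    proof -
      have "{z. L0 \<le> z \<and> z < L \<and> z mod P = l} = (\<lambda>q. q * P + l) ` {r..<R}"
      proof (intro set_eqI iffI)
        fix z assume "z \<in> {z. L0 \<le> z \<and> z < L \<and> z mod P = l}"
        then have z: "P * r \<le> z" "z < P * R" "z mod P = l" by (auto simp: r L_def)
        then have "z = (z div P) * P + l" "r \<le> z div P" "z div P < R"
          using P by (auto simp: less_eq_div_iff_mult_less_eq div_less_iff_less_mult mult.commute)
        then show "z \<in> (\<lambda>q. q * P + l) ` {r..<R}" by (intro image_eqI[of _ _ "z div P"]) auto
      next
        fix z assume "z \<in> (\<lambda>q. q * P + l) ` {r..<R}"
        then obtain q where q: "r \<le> q" "q < R" "z = q * P + l" by auto
        then have "P * r \<le> z" by (metis mult.commute mult_le_mono1 trans_le_add1)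
        moreover have "z < P * R" using add_mult_less[OF l q(2)] q(3) by simp
        ultimately show "z \<in> {z. L0 \<le> z \<and> z < L \<and> z mod P = l}" using q l by (simp add: r L_def)
      qed
      moreover have "inj_on (\<lambda>q. q * P + l) {r..<R}" using P by (auto intro: inj_onI)
      ultimately show ?thesis by (simp add: card_image)
    qed
    ultimately show ?thesis using rR by simp
  qed
  moreover have "Q z < P" for z using lex_word_less[of T z] P by (auto simp: Q_def P_def)
  ultimately have "balanced Q P R" by (simp add: balanced_def L_def)
  moreover have "Q (c * (b i * length (\<sigma> i)) + x) < Q (c * (b i * length (\<sigma> i)) + y)"
    if A: "i < T" "(c + 1) * (b i * length (\<sigma> i)) \<le> L0"
      "x < b i * length (\<sigma> i)" "y < b i * length (\<sigma> i)" "\<sigma> i ! (x div b i) < \<sigma> i ! (y div b i)"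
    for i c x y
  proof -
    let ?D = "b i * length (\<sigma> i)"
    have lt: "c * ?D + x < L0" "c * ?D + y < L0" using A by (auto simp: algebra_simps)
    have md: "((c * ?D + z) div b i) mod length (\<sigma> i) = z div b i" if "z < ?D" for z
    proof -
      have "c * ?D + z = z + b i * (c * length (\<sigma> i))" by simp
      then have "(c * ?D + z) div b i = c * length (\<sigma> i) + z div b i"
        using b_pos[of i] by (simp only: div_mult_self2)
      moreover have "z div b i < length (\<sigma> i)" using that by (simp add: less_mult_imp_div_less mult.commute)
      ultimately show ?thesis by simp
    qed
    have "lex_word \<sigma> b T (c * ?D + x) < lex_word \<sigma> b T (c * ?D + y)"
    proof (rule lex_word_mono[OF A(1)])
      have "(c * ?D + z) div ?D = c" if "z < ?D" for z
        by (rule div_nat_eqI) (use that in \<open>simp_all add: mult.commute\<close>)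
      then show "(c * ?D + x) div ?D = (c * ?D + y) div ?D" using A by simp
    qed (use A md in simp)
    then show ?thesis using lt by (simp add: Q_def)
  qed
  ultimately show ?thesis using that by blast
qed

end

section \<open>Binomial estimates and the losses in the density\<close>

lemma diff_power_le_choose_mult_fact: "k \<le> n \<Longrightarrow> (n - k) ^ k \<le> (n choose k) * fact k"
proof (induction k)
  case (Suc k)
  have "Suc k * (n choose Suc k) = (n - k) * (n choose k)"
    using binomial_absorption[of k n] binomial_absorb_comp[of n k] by simp
  then have eq: "(n choose Suc k) * fact (Suc k) = (n - k) * ((n choose k) * fact k)"
    by (simp only: fact_Suc of_nat_id) (metis mult.assoc mult.commute)
  have "(n - Suc k) ^ Suc k \<le> (n - k) * (n - k) ^ k" by (simp add: mult_mono power_mono)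
  also have "\<dots> \<le> (n - k) * ((n choose k) * fact k)" using Suc by (intro mult_left_mono) auto
  finally show ?case unfolding eq .
qed simp

text \<open>After multiplication by \<open>fact (k - 1)\<close> the left coefficient is at most
  \<open>W ^ (k - 1)\<close> and the right one at least \<open>(w - k) ^ (k - 1)\<close>. Their
  comparison costs a power of \<open>(1 - k / w) / (1 + \<delta>)\<close>, which is at least
  \<open>1 - x\<close> for \<open>x = k / w + \<delta>\<close>; Bernoulli's inequality makes the
  loss linear.\<close>

lemma choose_ratio:
  fixes \<delta> :: real
  assumes w: "1 \<le> k" "k \<le> w" and W: "real W \<le> (1 + \<delta>) * real (w * b)" and \<delta>: "0 \<le> \<delta>"
  shows "(1 - real k * (real k / real w + \<delta>)) * real ((W - 1) choose (k - 1))
    \<le> real (b ^ (k - 1) * ((w - 1) choose (k - 1)))"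
proof (cases "real k * (real k / real w + \<delta>) \<le> 1")
  \<comment> \<open>The left side is then not positive, so only the other case needs an
    estimate.\<close>
  case False
  then show ?thesis
    by (meson less_le_trans mult_nonpos_nonneg of_nat_0_le_iff diff_le_0_iff_le le_less_linear less_imp_le order_trans)
next
  case True
  define x where "x = real k / real w + \<delta>"
  define j where "j = k - 1"
  have wpos: "0 < real w" using w by simp
  have x: "0 \<le> x" using \<delta> by (simp add: x_def)
  have "x \<le> real k * x" using x w by (simp add: mult_le_cancel_right1)
  then have x1: "x \<le> 1" using True by (simp add: x_def)
  have "real w - real k \<ge> (1 - x) * (1 + \<delta>) * real w"
  proof -
    have "(1 - x) * (1 + \<delta>) * real w = real w - real k - \<delta> * real k - \<delta>\<^sup>2 * real w"
      unfolding x_def using wpos by (simp add: field_simps power2_eq_square)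
    moreover have "0 \<le> \<delta> * real k" "0 \<le> \<delta>\<^sup>2 * real w" using \<delta> by auto
    ultimately show ?thesis by linarith
  qed
  then have wk: "(1 - x) * (1 + \<delta>) * real w \<le> real (w - k)" using w by simp
  have "1 - real k * x \<le> 1 - real j * x" using x by (simp add: j_def mult_right_mono)
  also have "\<dots> \<le> (1 - x) ^ j" using Bernoulli_inequality[of "- x" j] x1 by simp
  finally have bern: "1 - real k * x \<le> (1 - x) ^ j" .
  have "real ((W - 1) choose j) * fact j \<le> real ((W - 1) ^ j)"
    using binomial_fact_pow[of "W - 1" j] by (metis of_nat_fact of_nat_le_iff of_nat_mult)
  also have "\<dots> \<le> real W ^ j" by (simp add: power_mono)
  also have "\<dots> \<le> ((1 + \<delta>) * real (w * b)) ^ j" using W by (simp add: power_mono)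
  finally have up: "real ((W - 1) choose j) * fact j \<le> ((1 + \<delta>) * real (w * b)) ^ j" .
  have "(w - 1 - j) ^ j \<le> ((w - 1) choose j) * fact j"
    using w by (intro diff_power_le_choose_mult_fact) (simp add: j_def)
  then have "(w - k) ^ j \<le> ((w - 1) choose j) * fact j" using w by (simp add: j_def)
  then have lo: "real (w - k) ^ j \<le> real ((w - 1) choose j) * fact j"
    by (metis of_nat_fact of_nat_le_iff of_nat_mult of_nat_power)
  have "(1 - real k * x) * (real ((W - 1) choose j) * fact j) \<le> (1 - x) ^ j * ((1 + \<delta>) * real (w * b)) ^ j"
    by (intro mult_mono bern up) (use x1 in auto)
  also have "\<dots> = ((1 - x) * (1 + \<delta>) * real w) ^ j * real b ^ j"
    by (simp add: power_mult_distrib)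
  also have "\<dots> \<le> real (w - k) ^ j * real b ^ j"
    using wk x1 \<delta> by (intro mult_right_mono power_mono) auto
  also have "\<dots> \<le> real ((w - 1) choose j) * fact j * real b ^ j"
    by (intro mult_right_mono lo) auto
  finally have "((1 - real k * x) * real ((W - 1) choose j)) * fact j \<le> (real b ^ j * real ((w - 1) choose j)) * fact j"
    by (simp add: mult_ac)
  then show ?thesis by (simp add: x_def j_def)
qed

lemma prod3_ge:
  fixes a b c :: real
  assumes "0 \<le> a" "0 \<le> b" "0 \<le> c" "a + b + c \<le> 1"
  shows "1 - (a + b + c) \<le> (1 - a) * ((1 - b) * (1 - c))"
proof -
  have "0 \<le> b * c * (1 - a)" "0 \<le> a * b" "0 \<le> a * c" using assms by auto
  then show ?thesis by (simp add: algebra_simps)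
qed

context blocks begin

text \<open>Three losses add up: \<open>\<eta>\<close> for positions outside the copies of
  \<open>\<sigma>\<close>, \<open>w / length \<sigma>\<close> for windows that start near the end of
  a copy, and \<open>x\<close> for the deficit of lifts against all windows from a given
  start.\<close>

lemma dens_close_width:
  fixes \<eta> x :: real
  assumes k: "1 \<le> length \<pi>" "length \<pi> \<le> w" and w: "w \<le> length \<sigma>" "w * b \<le> W"
    and dense: "(1 - \<eta>) * real (length \<tau>) \<le> real (card C * (b * length \<sigma>))"
    and ratio: "(1 - x) * real ((W - 1) choose (length \<pi> - 1)) \<le> real (b ^ (length \<pi> - 1) * ((w - 1) choose (length \<pi> - 1)))"
    and pos: "0 \<le> \<eta>" "0 \<le> x" and C: "C \<noteq> {}" and b: "0 < b"
  shows "\<bar>dens (real W) \<pi> \<tau> - dens (real w) \<pi> \<sigma>\<bar> \<le> \<eta> + real w / real (length \<sigma>) + x"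
proof (rule dens_close[OF k(1) w(2)])
  let ?k = "length \<pi>" and ?m = "length \<sigma>" and ?n = "length \<tau>"
  let ?\<epsilon> = "\<eta> + real w / real ?m + x"
  let ?B = "real ((w - 1) choose (?k - 1))" and ?B' = "real ((W - 1) choose (?k - 1))"
  have "0 < ?m" using k w by linarith
  then have m: "0 < real ?m" by simp
  have ge: "(?m + 1 - w) * ((w - 1) choose (?k - 1)) \<le> card (windows ?m ?k (real w))"
    using k w by (intro card_windows_ge) auto
  have "0 < (?m + 1 - w) * ((w - 1) choose (?k - 1))" using k w by simp
  then show "0 < card (windows ?m ?k (real w))" using ge by linarith
  show "0 \<le> ?\<epsilon>" using pos by simp
  show "(1 - ?\<epsilon>) * real (card (windows ?n ?k (real W))) \<le> real (card C * (card (windows ?m ?k (real w)) * b ^ ?k))"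
  proof (cases "?\<epsilon> \<le> 1")
    case False
    then have "(1 - ?\<epsilon>) * real (card (windows ?n ?k (real W))) \<le> 0" by (intro mult_nonpos_nonneg) auto
    then show ?thesis by (rule order_trans) simp
  next
    case True
    have wm: "0 \<le> real w / real ?m" by simp
    have x1: "x \<le> 1" "\<eta> \<le> 1" using True pos wm by linarith+
    have p3: "1 - ?\<epsilon> \<le> (1 - \<eta>) * ((1 - real w / real ?m) * (1 - x))"
      using True pos wm by (intro prod3_ge) auto
    have "real (card (windows ?n ?k (real W))) \<le> real ?n * ?B'"
      using card_windows_le[OF k(1), of ?n W] by (metis of_nat_le_iff of_nat_mult)
    then have "(1 - ?\<epsilon>) * real (card (windows ?n ?k (real W))) \<le> ((1 - \<eta>) * ((1 - real w / real ?m) * (1 - x))) * (real ?n * ?B')"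
      using True pos wm p3 by (intro mult_mono) linarith+
    also have "\<dots> = ((1 - \<eta>) * real ?n) * ((1 - real w / real ?m) * ((1 - x) * ?B'))" by (simp add: mult_ac)
    also have "\<dots> \<le> real (card C * (b * ?m)) * ((1 - real w / real ?m) * real (b ^ (?k - 1) * ((w - 1) choose (?k - 1))))"
      using w m x1 by (intro mult_mono dense mult_left_mono ratio mult_nonneg_nonneg) auto
    also have "\<dots> = real (card C) * real (b ^ (?k - 1) * b) * ((real ?m - real w) * ?B)"
      using m by (simp add: field_simps)
    also have "b ^ (?k - 1) * b = b ^ ?k" using k by (metis One_nat_def Suc_pred less_eq_Suc_le power_Suc2)
    also have "real (card C) * real (b ^ ?k) * ((real ?m - real w) * ?B) \<le> real (card C) * real (b ^ ?k) * real (card (windows ?m ?k (real w)))"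
    proof (rule mult_left_mono)
      have "(real ?m - real w) * ?B \<le> real ((?m + 1 - w) * ((w - 1) choose (?k - 1)))"
        using w by (simp add: of_nat_diff mult_right_mono)
      then show "(real ?m - real w) * ?B \<le> real (card (windows ?m ?k (real w)))" using ge by linarith
    qed simp
    finally show ?thesis by (simp add: mult_ac)
  qed
qed (use C b in auto)

lemma dens_close_scale:
  fixes \<eta> \<delta> :: real
  assumes k: "1 \<le> length \<pi>" "length \<pi> \<le> w" and w: "w \<le> length \<sigma>" "w * b \<le> W"
    and W: "real W \<le> (1 + \<delta>) * real (w * b)" and \<delta>: "0 \<le> \<delta>"
    and dense: "(1 - \<eta>) * real (length \<tau>) \<le> real (card C * (b * length \<sigma>))"
    and pos: "0 \<le> \<eta>" and C: "C \<noteq> {}" and b: "0 < b"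
  shows "\<bar>dens (real W) \<pi> \<tau> - dens (real w) \<pi> \<sigma>\<bar>
    \<le> \<eta> + real w / real (length \<sigma>) + real (length \<pi>) * (real (length \<pi>) / real w + \<delta>)"
  by (rule dens_close_width[OF k w dense choose_ratio[OF k W \<delta>]]) (use pos C b \<delta> in auto)

text \<open>With \<open>b = 1\<close> and width equal to the pattern length both binomial
  coefficients are \<open>1\<close>, so the loss \<open>x\<close> vanishes.\<close>

lemma dens_close_local:
  fixes \<eta> :: real
  assumes k: "1 \<le> length \<pi>" "length \<pi> \<le> length \<sigma>" and b: "b = 1"
    and dense: "(1 - \<eta>) * real (length \<tau>) \<le> real (card C * length \<sigma>)"
    and pos: "0 \<le> \<eta>" and C: "C \<noteq> {}"
  shows "\<bar>dens (real (length \<pi>)) \<pi> \<tau> - dens (real (length \<pi>)) \<pi> \<sigma>\<bar> \<le> \<eta> + real (length \<pi>) / real (length \<sigma>)"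
  using dens_close_width[of \<pi> "length \<pi>" "length \<pi>" \<eta> 0] assms by simp

lemma dens_close_global:
  assumes k: "1 \<le> length \<pi>" "length \<pi> \<le> length \<sigma>" and C: "C = {0}" and n: "length \<tau> = b * length \<sigma>" and b: "0 < b"
  shows "\<bar>dens (real (length \<tau>)) \<pi> \<tau> - dens (real (length \<sigma>)) \<pi> \<sigma>\<bar> \<le> real (length \<pi>) * (real (length \<pi>) / real (length \<sigma>))"
proof (rule dens_close)
  let ?k = "length \<pi>" and ?m = "length \<sigma>" and ?n = "length \<tau>"
  let ?x = "real ?k / real ?m"
  have "0 < ?m" using k by linarith
  then have m: "0 < real ?m" by simp
  show "0 < card (windows ?m ?k (real ?m))" using k by (simp add: card_windows_full)
  have x: "0 \<le> ?x" "?x \<le> 1" using k m by auto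
  have bern: "1 - real ?k * ?x \<le> (1 - ?x) ^ ?k" using Bernoulli_inequality[of "- ?x" ?k] x by simp
  have "real (?n choose ?k) * fact ?k \<le> real ?n ^ ?k"
    using binomial_fact_pow[of ?n ?k] by (metis of_nat_fact of_nat_le_iff of_nat_mult of_nat_power)
  then have "(1 - real ?k * ?x) * (real (?n choose ?k) * fact ?k) \<le> (1 - ?x) ^ ?k * real ?n ^ ?k"
    using bern x by (intro mult_mono) auto
  also have "\<dots> = ((1 - ?x) * real ?m) ^ ?k * real b ^ ?k" unfolding n by (simp add: power_mult_distrib)
  also have "(1 - ?x) * real ?m = real (?m - ?k)" using m k by (simp add: field_simps of_nat_diff)
  also have "real (?m - ?k) ^ ?k * real b ^ ?k \<le> (real (?m choose ?k) * fact ?k) * real b ^ ?k"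
    using diff_power_le_choose_mult_fact[OF k(2)]
    by (intro mult_right_mono) (metis of_nat_fact of_nat_le_iff of_nat_mult of_nat_power, simp)
  finally have "((1 - real ?k * ?x) * real (?n choose ?k)) * fact ?k \<le> (real (?m choose ?k) * real b ^ ?k) * fact ?k"
    by (simp add: mult_ac)
  then show "(1 - real ?k * ?x) * real (card (windows ?n ?k (real ?n)))
      \<le> real (card C * (card (windows ?m ?k (real ?m)) * b ^ ?k))"
    using k C by (simp add: card_windows_full)
qed (use assms in \<open>auto simp: mult.commute\<close>)

end

section \<open>Copies of a level inside the columns\<close>

context levels begin

text \<open>In each of the \<open>G\<close> columns the periods of level \<open>i\<close> tile
  exactly the first \<open>L0\<close> places, because the period divides \<open>b T\<close>. The
  part of a column that is lost is therefore the same for all levels.\<close>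

lemma column_blocks:
  fixes G R T i :: nat and Q :: "nat \<Rightarrow> nat"
  defines "L \<equiv> alph T * R"
  defines "L0 \<equiv> b T * (L div b T)"
  defines "D \<equiv> b i * length (\<sigma> i)"
  assumes i: "i < T" and len: "length \<tau> = G * L"
    and Q: "\<And>c x y. \<lbrakk>(c + 1) * D \<le> L0; x < D; y < D; \<sigma> i ! (x div b i) < \<sigma> i ! (y div b i)\<rbrakk>
           \<Longrightarrow> Q (c * D + x) < Q (c * D + y)"
    and col: "\<And>x y. \<lbrakk>x < G * L; y < G * L; x div L = y div L; Q (x mod L) < Q (y mod L)\<rbrakk> \<Longrightarrow> \<tau> ! x < \<tau> ! y"
  obtains C where "blocks \<tau> (\<sigma> i) C (b i)" "card C * D = G * L0"
proof
  define C where "C = (\<lambda>(c, d). c * L + d * D) ` ({0..<G} \<times> {0..<L0 div D})"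
  have D: "0 < D" using b_pos nonempty by (simp add: D_def)
  have "D dvd L0" unfolding D_def L0_def using period_dvd[OF i] by simp
  then have L0: "L0 div D * D = L0" by simp
  have dD: "d * D + D \<le> L0" if "d < L0 div D" for d
  proof -
    have "(d + 1) * D \<le> L0 div D * D" using that by (intro mult_right_mono) auto
    then show ?thesis using L0 by simp
  qed
  have L0L: "L0 \<le> L" by (simp add: L0_def)
  have inj: "inj_on (\<lambda>(c, d). c * L + d * D) ({0..<G} \<times> {0..<L0 div D})"
  proof (rule inj_onI, clarsimp)
    fix c d c' d' assume d: "d < L0 div D" "d' < L0 div D" and e: "c * L + d * D = c' * L + d' * D"
    have "d * D < L" "d' * D < L" using dD[OF d(1)] dD[OF d(2)] L0L D by linarith+
    then show "c = c' \<and> d = d'" using e mult_add_eq_iff D by (metis mult_cancel2 less_numeral_extra(3))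
  qed
  show "card C * D = G * L0"
    unfolding C_def using L0 by (simp add: card_image[OF inj] card_cartesian_product)
  show "blocks \<tau> (\<sigma> i) C (b i)"
  proof
    show "distinct (\<sigma> i)" using perm by (simp add: is_perm_def)
    show "finite C" by (simp add: C_def)
    fix s assume "s \<in> C"
    then obtain c d where s: "s = c * L + d * D" "c < G" "d < L0 div D" by (auto simp: C_def)
    have "s + D \<le> c * L + L" using dD[OF s(3)] L0L s(1) by linarith
    also have "\<dots> \<le> G * L" using mult_right_mono[of "Suc c" G L] s(2) by simp
    finally have sD: "s + D \<le> G * L" .
    then show "s + b i * length (\<sigma> i) \<le> length \<tau>" by (simp add: D_def len)
    show "\<tau> ! (s + x) < \<tau> ! (s + y)"
      if A: "x < b i * length (\<sigma> i)" "y < b i * length (\<sigma> i)" "\<sigma> i ! (x div b i) < \<sigma> i ! (y div b i)" for x y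
    proof (rule col)
      have x: "x < D" "y < D" using A by (simp_all add: D_def)
      then show "s + x < G * L" "s + y < G * L" using sD by linarith+
      have lt: "d * D + x < L" "d * D + y < L" using x dD[OF s(3)] L0L by linarith+
      have eq: "s + z = c * L + (d * D + z)" for z using s by simp
      show "(s + x) div L = (s + y) div L" unfolding eq using lt by simp
      have "(s + x) mod L = d * D + x" "(s + y) mod L = d * D + y" unfolding eq using lt by simp_all
      then show "Q ((s + x) mod L) < Q ((s + y) mod L)"
        using Q[of d x y] dD[OF s(3)] x A(3) by (simp add: add.commute)
    qed
    fix s' assume "s' \<in> C" "s < s'"
    then obtain c' d' where s': "s' = c' * L + d' * D" "c' < G" "d' < L0 div D" by (auto simp: C_def)
    have "s + D \<le> s'"
    proof (cases "c = c'")
      case True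
      then have "d * D < d' * D" using \<open>s < s'\<close> s s' by simp
      then have "(d + 1) * D \<le> d' * D" using D by (intro mult_right_mono) auto
      then show ?thesis using True s s' by simp
    next
      case False
      have "c < c'"
      proof (rule ccontr)
        assume "\<not> c < c'"
        then have "c' < c" using False by simp
        then have "s' < s" unfolding s(1) s'(1)
          using dD[OF s'(3)] L0L D by (intro mult_add_less_mult_add) auto
        then show False using \<open>s < s'\<close> by simp
      qed
      then have "c * L + L \<le> c' * L" using mult_right_mono[of "Suc c" c' L] by simp
      then show ?thesis using dD[OF s(3)] L0L s s' by linarith
    qed
    then show "s + b i * length (\<sigma> i) \<le> s'" by (simp add: D_def)
  qed
qed

end

section \<open>Sampling from a permuton\<close>

text \<open>\<open>J\<close> refers to the sample points as drawn, and \<open>xs\<close> lists them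
  from left to right. Index sets chosen independently of the sample give events that depend only on
  the coordinates in \<open>J\<close>.\<close>

definition sample_occ :: "nat list \<Rightarrow> (nat \<Rightarrow> real \<times> real) \<Rightarrow> nat set \<Rightarrow> bool" where
  "sample_occ \<pi> \<omega> J \<longleftrightarrow> (\<exists>xs\<in>permutations_of_set J.
     sorted_wrt (\<lambda>i j. fst (\<omega> i) < fst (\<omega> j)) xs \<and> order_iso (map (\<lambda>i. snd (\<omega> i)) xs) \<pi>)"

lemma sample_occ_cong:
  assumes "\<And>i. i \<in> J \<Longrightarrow> \<omega> i = \<omega>' i"
  shows "sample_occ \<pi> \<omega> J \<longleftrightarrow> sample_occ \<pi> \<omega>' J"
proof -
  have *: "sorted_wrt (\<lambda>i j. fst (\<omega> i) < fst (\<omega> j)) xs \<longleftrightarrow> sorted_wrt (\<lambda>i j. fst (\<omega>' i) < fst (\<omega>' j)) xs"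
       "map (\<lambda>i. snd (\<omega> i)) xs = map (\<lambda>i. snd (\<omega>' i)) xs" if "xs \<in> permutations_of_set J" for xs
  proof -
    have "set xs = J" using that by (simp add: permutations_of_set_def)
    then show "map (\<lambda>i. snd (\<omega> i)) xs = map (\<lambda>i. snd (\<omega>' i)) xs" using assms by simp
    have "\<omega> (xs ! i) = \<omega>' (xs ! i)" if "i < length xs" for i using \<open>set xs = J\<close> assms that by auto
    then show "sorted_wrt (\<lambda>i j. fst (\<omega> i) < fst (\<omega> j)) xs \<longleftrightarrow> sorted_wrt (\<lambda>i j. fst (\<omega>' i) < fst (\<omega>' j)) xs"
      unfolding sorted_wrt_iff_nth_less by simp
  qed
  show ?thesis unfolding sample_occ_def by (intro bex_cong refl) (simp only: *)
qed

lemma sample_occ_image: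
  assumes "inj_on f A"
  shows "sample_occ \<pi> \<omega> (f ` A) \<longleftrightarrow> sample_occ \<pi> (\<lambda>i. \<omega> (f i)) A"
  unfolding sample_occ_def permutations_of_set_image_inj[OF assms]
  by (simp add: sorted_wrt_map comp_def)

lemma permuton_event_eq_sample_occ:
  fixes p :: "nat \<Rightarrow> real \<times> real"
  shows "(\<exists>s. s permutes {0..<k} \<and> (\<forall>a b. a < b \<and> b < k \<longrightarrow> fst (p (s a)) < fst (p (s b))) \<and>
          order_iso (map (\<lambda>a. snd (p (s a))) [0..<k]) \<pi>) \<longleftrightarrow> sample_occ \<pi> p {0..<k}"
    (is "?l \<longleftrightarrow> ?r")
proof
  assume ?l
  then obtain s where s: "s permutes {0..<k}" "\<And>a b. a < b \<Longrightarrow> b < k \<Longrightarrow> fst (p (s a)) < fst (p (s b))"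
    "order_iso (map (\<lambda>a. snd (p (s a))) [0..<k]) \<pi>" by blast
  have "map s [0..<k] \<in> permutations_of_set {0..<k}"
    using permutes_image[OF s(1)] permutes_inj_on[OF s(1)] by (auto simp: permutations_of_set_def distinct_map)
  moreover have "sorted_wrt (\<lambda>i j. fst (p i) < fst (p j)) (map s [0..<k])"
    using s(2) by (auto simp: sorted_wrt_iff_nth_less)
  ultimately show ?r unfolding sample_occ_def using s(3) by (auto simp: comp_def intro!: bexI[of _ "map s [0..<k]"])
next
  assume ?r
  then obtain xs where xs: "xs \<in> permutations_of_set {0..<k}"
    "sorted_wrt (\<lambda>i j. fst (p i) < fst (p j)) xs" "order_iso (map (\<lambda>i. snd (p i)) xs) \<pi>"
    unfolding sample_occ_def by blast
  have len: "length xs = k" using length_finite_permutations_of_set[OF xs(1)] by simp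
  have "mset xs = mset [0..<k]"
    using xs(1) by (intro set_eq_iff_mset_eq_distinct[THEN iffD1]) (auto simp: permutations_of_set_def)
  then obtain s where s: "s permutes {..<length [0..<k]}" "permute_list s [0..<k] = xs"
    by (rule mset_eq_permutation)
  then have s': "s permutes {0..<k}" by (simp add: atLeast0LessThan)
  have "s x < k" if "x < k" for x using permutes_in_image[OF s', of x] that by simp
  then have "xs = map s [0..<k]"
    unfolding s(2)[symmetric] permute_list_def by simp
  then show ?l using xs s' len by (intro exI[of _ s]) (auto simp: sorted_wrt_iff_nth_less comp_def)
qed

locale sampling =
  fixes \<Gamma> :: "(real \<times> real) measure" and N :: nat
  assumes permuton: "permuton \<Gamma>"
begin

abbreviation "M \<equiv> PiM {0..<N} (\<lambda>_. \<Gamma>)"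

lemma prob_Gamma: "prob_space \<Gamma>" and sets_Gamma [measurable_cong]: "sets \<Gamma> = sets borel"
  using permuton by (auto simp: permuton_def)

lemma fst_snd_Gamma [measurable]: "fst \<in> borel_measurable \<Gamma>" "snd \<in> borel_measurable \<Gamma>"
proof -
  have "fst \<in> borel_measurable (borel :: (real \<times> real) measure)" "snd \<in> borel_measurable (borel :: (real \<times> real) measure)"
    by (auto intro!: borel_measurable_continuous_onI continuous_intros)
  then show "fst \<in> borel_measurable \<Gamma>" "snd \<in> borel_measurable \<Gamma>"
    by (simp_all add: measurable_cong_sets[OF sets_Gamma refl])
qed

lemma prob_PiM: "prob_space (PiM I (\<lambda>_. \<Gamma>))"
  by (rule prob_space_PiM) (rule prob_Gamma)

lemma sample_occ_measurable:
  assumes "finite I" "J \<subseteq> I"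
  shows "{\<omega> \<in> space (PiM I (\<lambda>_. \<Gamma>)). sample_occ \<pi> \<omega> J} \<in> sets (PiM I (\<lambda>_. \<Gamma>))"
proof -
  have less: "Measurable.pred (PiM I (\<lambda>_. \<Gamma>)) (\<lambda>\<omega>. fst (\<omega> i) < fst (\<omega> j))"
       "Measurable.pred (PiM I (\<lambda>_. \<Gamma>)) (\<lambda>\<omega>. snd (\<omega> i) < snd (\<omega> j))" if "i \<in> I" "j \<in> I" for i j
    using that by measurable
  have "Measurable.pred (PiM I (\<lambda>_. \<Gamma>)) (\<lambda>\<omega>. sample_occ \<pi> \<omega> J)"
    unfolding sample_occ_def
  proof (intro pred_intros_finite(4) finite_permutations_of_set pred_intros_logic)
    fix xs assume "xs \<in> permutations_of_set J"
    then have xs: "xs ! i \<in> I" if "i < length xs" for i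
      using that assms(2) nth_mem by (fastforce simp: permutations_of_set_def)
    have sorted: "sorted_wrt (\<lambda>i j. fst (\<omega> i) < fst (\<omega> j)) xs \<longleftrightarrow>
        (\<forall>i\<in>{..<length xs}. \<forall>j\<in>{..<length xs}. i < j \<longrightarrow> fst (\<omega> (xs ! i)) < fst (\<omega> (xs ! j)))" for \<omega>
      by (auto simp: sorted_wrt_iff_nth_less)
    show "Measurable.pred (PiM I (\<lambda>_. \<Gamma>)) (\<lambda>\<omega>. sorted_wrt (\<lambda>i j. fst (\<omega> i) < fst (\<omega> j)) xs)"
      unfolding sorted by (intro pred_intros_finite(3) pred_intros_logic less finite_lessThan) (auto intro: xs)
    have iso: "order_iso (map (\<lambda>i. snd (\<omega> i)) xs) \<pi> \<longleftrightarrow> length xs = length \<pi> \<and>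
        (\<forall>i\<in>{..<length xs}. \<forall>j\<in>{..<length xs}. (snd (\<omega> (xs ! i)) < snd (\<omega> (xs ! j))) \<longleftrightarrow> (\<pi> ! i < \<pi> ! j))" for \<omega>
      by (auto simp: order_iso_def)
    show "Measurable.pred (PiM I (\<lambda>_. \<Gamma>)) (\<lambda>\<omega>. order_iso (map (\<lambda>i. snd (\<omega> i)) xs) \<pi>)"
      unfolding iso by (intro pred_intros_finite(3) pred_intros_logic less finite_lessThan) (auto intro: xs)
  qed
  then show ?thesis by (simp add: pred_def)
qed

text \<open>Any \<open>length \<pi>\<close> of the independent draws have the joint law that defines
  \<open>permuton_dens\<close>. Reindexing by the increasing enumeration of \<open>J\<close> is
  harmless, because the event ignores how its points are numbered.\<close>

lemma prob_sample_occ: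
  assumes "J \<subseteq> {0..<N}" "card J = length \<pi>"
  shows "measure M {\<omega> \<in> space M. sample_occ \<pi> \<omega> J} = permuton_dens \<pi> \<Gamma>"
proof -
  let ?k = "length \<pi>"
  let ?K = "PiM {0..<?k} (\<lambda>_. \<Gamma>)"
  have fin: "finite J" using assms(1) finite_subset by blast
  define f where "f = (!) (sorted_list_of_set J)"
  have bij: "bij_betw f {0..<?k} J"
    unfolding f_def using assms fin by (intro bij_betw_nth) (auto simp: atLeast0LessThan)
  then have f: "inj_on f {0..<?k}" "f \<in> {0..<?k} \<rightarrow> {0..<N}" "f ` {0..<?k} = J"
    using assms(1) by (auto simp: bij_betw_def)
  let ?t = "\<lambda>\<omega>. \<lambda>n\<in>{0..<?k}. \<omega> (f n)"
  have t: "?t \<in> measurable M ?K"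
    using f(2) by (intro measurable_restrict measurable_component_singleton) auto
  have "permuton_dens \<pi> \<Gamma> = measure ?K {p \<in> space ?K. sample_occ \<pi> p {0..<?k}}"
    unfolding permuton_dens_def permuton_event_eq_sample_occ ..
  also have "?K = distr M ?K ?t"
    using distr_PiM_reindex[of "{0..<N}" "\<lambda>_. \<Gamma>", OF prob_Gamma f(1,2)] by simp
  also have "measure (distr M ?K ?t) {p \<in> space (distr M ?K ?t). sample_occ \<pi> p {0..<?k}}
      = measure M (?t -` {p \<in> space ?K. sample_occ \<pi> p {0..<?k}} \<inter> space M)"
    using sample_occ_measurable[of "{0..<?k}" "{0..<?k}" \<pi>] t by (simp add: measure_distr)
  also have "?t -` {p \<in> space ?K. sample_occ \<pi> p {0..<?k}} \<inter> space M = {\<omega> \<in> space M. sample_occ \<pi> \<omega> J}"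
  proof -
    have "sample_occ \<pi> (?t \<omega>) {0..<?k} \<longleftrightarrow> sample_occ \<pi> \<omega> J" for \<omega>
      unfolding f(3)[symmetric] sample_occ_image[OF f(1)] by (rule sample_occ_cong) simp
    then show ?thesis using measurable_space[OF t] by auto
  qed
  finally show ?thesis by simp
qed

lemma indep_coordinates:
  assumes "0 < N"
  shows "prob_space.indep_vars M (\<lambda>_. \<Gamma>) (\<lambda>i \<omega>. \<omega> i) {0..<N}"
proof -
  interpret prob_space M by (rule prob_PiM)
  have "distr M M (\<lambda>\<omega>. \<lambda>i\<in>{0..<N}. \<omega> i) = distr M M (\<lambda>\<omega>. \<omega>)"
    by (intro distr_cong) (auto simp: space_PiM PiE_def extensional_def fun_eq_iff)
  also have "\<dots> = M" by (rule distr_id)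
  also have "\<dots> = PiM {0..<N} (\<lambda>i. distr M \<Gamma> (\<lambda>\<omega>. \<omega> i))"
    using distr_PiM_component[of "{0..<N}" "\<lambda>_. \<Gamma>"] prob_Gamma by (intro PiM_cong) auto
  finally show ?thesis
    using assms by (subst indep_vars_iff_distr_eq_PiM') auto
qed

text \<open>The events depend on disjoint sets of independent coordinates. This makes the
  covariances of disjoint index sets vanish in the variance bound.\<close>

lemma prob_sample_occ_disjoint:
  assumes "J \<subseteq> {0..<N}" "J' \<subseteq> {0..<N}" "J \<inter> J' = {}" "0 < N"
  shows "measure M {\<omega> \<in> space M. sample_occ \<pi> \<omega> J \<and> sample_occ \<pi> \<omega> J'}
     = measure M {\<omega> \<in> space M. sample_occ \<pi> \<omega> J} * measure M {\<omega> \<in> space M. sample_occ \<pi> \<omega> J'}"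
proof -
  interpret prob_space M by (rule prob_PiM)
  let ?A = "\<lambda>J. {\<omega> \<in> space (PiM J (\<lambda>_. \<Gamma>)). sample_occ \<pi> \<omega> J}"
  have fin: "finite J" "finite J'" using assms finite_subset by blast+
  have ind: "indep_var (PiM J (\<lambda>_. \<Gamma>)) (\<lambda>\<omega>. restrict (\<lambda>i. \<omega> i) J) (PiM J' (\<lambda>_. \<Gamma>)) (\<lambda>\<omega>. restrict (\<lambda>i. \<omega> i) J')"
    by (rule indep_var_restrict[OF indep_coordinates[OF assms(4)]]) (use assms in auto)
  have pre: "restrict \<omega> I \<in> ?A I \<longleftrightarrow> sample_occ \<pi> \<omega> I" if "I \<subseteq> {0..<N}" "\<omega> \<in> space M" for I \<omega>
  proof -
    have "restrict \<omega> I \<in> space (PiM I (\<lambda>_. \<Gamma>))" using that by (auto simp: space_PiM PiE_def Pi_def)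
    moreover have "sample_occ \<pi> (restrict \<omega> I) I \<longleftrightarrow> sample_occ \<pi> \<omega> I" by (rule sample_occ_cong) simp
    ultimately show ?thesis by simp
  qed
  have "prob ((\<lambda>\<omega>. (restrict \<omega> J, restrict \<omega> J')) -` (?A J \<times> ?A J') \<inter> space M)
      = prob ((\<lambda>\<omega>. restrict \<omega> J) -` ?A J \<inter> space M) * prob ((\<lambda>\<omega>. restrict \<omega> J') -` ?A J' \<inter> space M)"
    by (rule indep_varD[OF ind]) (use sample_occ_measurable fin in auto)
  moreover have "(\<lambda>\<omega>. (restrict \<omega> J, restrict \<omega> J')) -` (?A J \<times> ?A J') \<inter> space M = {\<omega> \<in> space M. sample_occ \<pi> \<omega> J \<and> sample_occ \<pi> \<omega> J'}"
    using pre assms(1,2) by (intro set_eqI) (simp only: vimage_eq Int_iff mem_Times_iff fst_conv snd_conv mem_Collect_eq, blast)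
  moreover have "(\<lambda>\<omega>. restrict \<omega> I) -` ?A I \<inter> space M = {\<omega> \<in> space M. sample_occ \<pi> \<omega> I}" if "I \<subseteq> {0..<N}" for I
    using pre[OF that] by (intro set_eqI) (simp only: vimage_eq Int_iff mem_Collect_eq, blast)
  ultimately show ?thesis using assms(1,2) by simp
qed

text \<open>The uniform law has no atoms, so by Fubini two independent uniform variables almost
  surely differ. \<open>c\<close> is meant to be either coordinate projection.\<close>

lemma AE_no_tie:
  assumes c: "c \<in> borel_measurable \<Gamma>" "distr \<Gamma> borel c = uniform_measure lborel {0..1::real}"
    and ij: "i < N" "j < N" "i \<noteq> j"
  shows "AE \<omega> in M. c (\<omega> i) \<noteq> c (\<omega> j)"
proof -
  interpret prob_space M by (rule prob_PiM)
  let ?U = "uniform_measure lborel {0..1::real}"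
  have "0 < N" using ij by simp
  have "indep_var (PiM {i} (\<lambda>_. \<Gamma>)) (\<lambda>\<omega>. restrict (\<lambda>i. \<omega> i) {i}) (PiM {j} (\<lambda>_. \<Gamma>)) (\<lambda>\<omega>. restrict (\<lambda>i. \<omega> i) {j})"
    by (rule indep_var_restrict[OF indep_coordinates[OF \<open>0 < N\<close>]]) (use ij in auto)
  then have "indep_var borel ((\<lambda>f. c (f i)) \<circ> (\<lambda>\<omega>. restrict (\<lambda>i. \<omega> i) {i})) borel ((\<lambda>f. c (f j)) \<circ> (\<lambda>\<omega>. restrict (\<lambda>i. \<omega> i) {j}))"
    by (rule indep_var_compose) (use c(1) in measurable)
  then have ind: "indep_var borel (\<lambda>\<omega>. c (\<omega> i)) borel (\<lambda>\<omega>. c (\<omega> j))" by (simp add: comp_def)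
  have comp: "distr M borel (\<lambda>\<omega>. c (\<omega> l)) = ?U" if "l < N" for l
  proof -
    have "distr M borel (\<lambda>\<omega>. c (\<omega> l)) = distr (distr M \<Gamma> (\<lambda>\<omega>. \<omega> l)) borel c"
      using that c(1) by (subst distr_distr) (auto simp: comp_def)
    then show ?thesis using that c(2) distr_PiM_component[of "{0..<N}" "\<lambda>_. \<Gamma>" l] prob_Gamma by simp
  qed
  interpret U: prob_space ?U by (rule prob_space_uniform_measure) auto
  interpret UU: pair_sigma_finite ?U ?U ..
  have joint: "distr M (borel \<Otimes>\<^sub>M borel) (\<lambda>\<omega>. (c (\<omega> i), c (\<omega> j))) = ?U \<Otimes>\<^sub>M ?U"
    using ind ij comp unfolding indep_var_distribution_eq by simp
  have U0: "emeasure ?U {x} = 0" for x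
    by (simp add: uniform_measure_def emeasure_density nn_integral_0_iff_AE)
  have "AE p in ?U \<Otimes>\<^sub>M ?U. fst p \<noteq> snd p"
  proof (rule UU.AE_pair_measure)
    show "{p \<in> space (?U \<Otimes>\<^sub>M ?U). fst p \<noteq> snd p} \<in> sets (?U \<Otimes>\<^sub>M ?U)" by measurable
    have "AE y in ?U. x \<noteq> y" for x
      by (rule AE_I[where N="{x}"]) (use U0 in auto)
    then show "AE x in ?U. AE y in ?U. fst (x, y) \<noteq> snd (x, y)" by simp
  qed
  moreover have "(\<lambda>\<omega>. (c (\<omega> i), c (\<omega> j))) \<in> measurable M (borel \<Otimes>\<^sub>M borel)"
    by (rule measurable_Pair[OF indep_var_rv1[OF ind] indep_var_rv2[OF ind]])
  ultimately have "AE \<omega> in M. fst (c (\<omega> i), c (\<omega> j)) \<noteq> snd (c (\<omega> i), c (\<omega> j))"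
    unfolding joint[symmetric] by (rule AE_distrD[rotated])
  then show ?thesis by simp
qed

lemma AE_generic:
  "AE \<omega> in M. inj_on (\<lambda>i. fst (\<omega> i)) {0..<N} \<and> inj_on (\<lambda>i. snd (\<omega> i)) {0..<N}"
proof -
  have "AE \<omega> in M. \<forall>i\<in>{0..<N}. \<forall>j\<in>{0..<N}. i \<noteq> j \<longrightarrow> fst (\<omega> i) \<noteq> fst (\<omega> j) \<and> snd (\<omega> i) \<noteq> snd (\<omega> j)"
  proof (intro AE_finite_allI finite_atLeastLessThan)
    fix i j assume "i \<in> {0..<N}" "j \<in> {0..<N}"
    then show "AE \<omega> in M. i \<noteq> j \<longrightarrow> fst (\<omega> i) \<noteq> fst (\<omega> j) \<and> snd (\<omega> i) \<noteq> snd (\<omega> j)"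
      using AE_no_tie[of fst i j] AE_no_tie[of snd i j] permuton by (cases "i = j") (auto simp: permuton_def)
  qed
  then show ?thesis by (rule eventually_mono) (auto simp: inj_on_def)
qed

end

text \<open>Counts the index sets that can be correlated with \<open>J\<close>: \<open>k\<close>
  choices of a common point, each with at most \<open>(N - 1) choose (k - 1)\<close> sets, and
  \<open>N * ((N - 1) choose (k - 1)) = k * (N choose k)\<close>.\<close>

lemma card_subsets_meeting:
  assumes "J \<subseteq> {0..<N}" "card J = k" "1 \<le> k"
  shows "real (card {J'. J' \<subseteq> {0..<N} \<and> card J' = k \<and> J \<inter> J' \<noteq> {}}) * real N \<le> real (k * k) * real (N choose k)"
proof -
  have fin: "finite J" using assms(1) finite_subset by blast
  have one: "card {J'. J' \<subseteq> {0..<N} \<and> card J' = k \<and> j \<in> J'} \<le> (N - 1) choose (k - 1)" if "j \<in> J" for j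
  proof -
    have j: "j < N" using that assms by auto
    let ?S = "{D. D \<subseteq> {0..<N} - {j} \<and> card D = k - 1}"
    have fS: "finite ?S" by (rule finite_subset[of _ "Pow {0..<N}"]) auto
    have "{J'. J' \<subseteq> {0..<N} \<and> card J' = k \<and> j \<in> J'} \<subseteq> insert j ` ?S"
    proof clarify
      fix J' assume J': "J' \<subseteq> {0..<N}" "j \<in> J'" "k = card J'"
      then have "finite J'" using finite_subset by blast
      then have "J' - {j} \<in> {D. D \<subseteq> {0..<N} - {j} \<and> card D = card J' - 1}" using J' by auto
      then show "J' \<in> insert j ` {D. D \<subseteq> {0..<N} - {j} \<and> card D = card J' - 1}"
        using J'(2) by (intro image_eqI[of _ _ "J' - {j}"]) auto
    qed
    then have "card {J'. J' \<subseteq> {0..<N} \<and> card J' = k \<and> j \<in> J'} \<le> card (insert j ` ?S)"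
      by (intro card_mono finite_imageI fS)
    also have "\<dots> \<le> card ?S" by (rule card_image_le[OF fS])
    also have "\<dots> = card ({0..<N} - {j}) choose (k - 1)" by (rule n_subsets) simp
    finally show ?thesis using j by simp
  qed
  have "{J'. J' \<subseteq> {0..<N} \<and> card J' = k \<and> J \<inter> J' \<noteq> {}} = (\<Union>j\<in>J. {J'. J' \<subseteq> {0..<N} \<and> card J' = k \<and> j \<in> J'})"
    by auto
  then have "card {J'. J' \<subseteq> {0..<N} \<and> card J' = k \<and> J \<inter> J' \<noteq> {}} \<le> (\<Sum>j\<in>J. card {J'. J' \<subseteq> {0..<N} \<and> card J' = k \<and> j \<in> J'})"
    using card_UN_le[OF fin] by simp
  also have "\<dots> \<le> (\<Sum>j\<in>J. (N - 1) choose (k - 1))" by (intro sum_mono one)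
  also have "\<dots> = k * ((N - 1) choose (k - 1))" using assms by simp
  finally have "card {J'. J' \<subseteq> {0..<N} \<and> card J' = k \<and> J \<inter> J' \<noteq> {}} * N \<le> k * ((N - 1) choose (k - 1)) * N"
    by (rule mult_right_mono) simp
  also have "\<dots> = k * (k * (N choose k))"
    using times_binomial_minus1_eq[of k N] assms(3) by (simp add: ac_simps)
  finally have "card {J'. J' \<subseteq> {0..<N} \<and> card J' = k \<and> J \<inter> J' \<noteq> {}} * N \<le> k * k * (N choose k)"
    by (simp only: mult.assoc)
  then show ?thesis by (simp only: of_nat_mult[symmetric] of_nat_le_iff)
qed

context sampling begin

definition emp :: "nat list \<Rightarrow> (nat \<Rightarrow> real \<times> real) \<Rightarrow> real" where
  "emp \<pi> \<omega> = real (card {J. J \<subseteq> {0..<N} \<and> card J = length \<pi> \<and> sample_occ \<pi> \<omega> J}) / real (N choose length \<pi>)"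

text \<open>\<open>emp\<close> is an unbiased U-statistic, so this is its variance. In the expanded
  square, pairs of disjoint index sets contribute nothing and the others at most \<open>1\<close>
  each; the intersecting pairs are a fraction of at most \<open>k * k / N\<close> of all pairs, for
  patterns of length \<open>k\<close>.\<close>

lemma second_moment:
  assumes k: "1 \<le> length \<pi>" "length \<pi> \<le> N"
  shows "integrable M (\<lambda>\<omega>. (emp \<pi> \<omega> - permuton_dens \<pi> \<Gamma>)\<^sup>2)"
    and "(\<integral>\<omega>. (emp \<pi> \<omega> - permuton_dens \<pi> \<Gamma>)\<^sup>2 \<partial>M) \<le> real (length \<pi> * length \<pi>) / real N"
proof -
  interpret prob_space M by (rule prob_PiM)
  let ?k = "length \<pi>"
  let ?p = "permuton_dens \<pi> \<Gamma>"
  define \<J> where "\<J> = {J. J \<subseteq> {0..<N} \<and> card J = ?k}"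
  define A where "A J = {\<omega> \<in> space M. sample_occ \<pi> \<omega> J}" for J
  define C where "C = real (N choose ?k)"
  have fin: "finite \<J>" unfolding \<J>_def by (rule finite_subset[of _ "Pow {0..<N}"]) auto
  have cJ: "real (card \<J>) = C" unfolding \<J>_def C_def by (simp add: n_subsets)
  have Cpos: "0 < C" using k by (simp add: C_def)
  have N: "0 < N" using k by linarith
  have A [measurable]: "A J \<in> sets M" if "J \<in> \<J>" for J
    unfolding A_def using that by (intro sample_occ_measurable) (auto simp: \<J>_def)
  have pA: "prob (A J) = ?p" if "J \<in> \<J>" for J
    unfolding A_def using that by (intro prob_sample_occ) (auto simp: \<J>_def)
  have p: "0 \<le> ?p" "?p \<le> 1"
  proof -
    have "\<J> \<noteq> {}" using cJ Cpos by auto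
    then obtain J where "J \<in> \<J>" by blast
    then show "0 \<le> ?p" "?p \<le> 1" using pA[of J] prob_le_1[of "A J"] measure_nonneg[of M "A J"] by auto
  qed
  let ?X = "\<lambda>J \<omega>. indicator (A J) \<omega> - ?p"
  have emp: "emp \<pi> \<omega> - ?p = (\<Sum>J\<in>\<J>. ?X J \<omega>) / C" if "\<omega> \<in> space M" for \<omega>
  proof -
    have "{J. J \<subseteq> {0..<N} \<and> card J = ?k \<and> sample_occ \<pi> \<omega> J} = {J\<in>\<J>. \<omega> \<in> A J}"
      using that by (auto simp: \<J>_def A_def)
    moreover have "(\<Sum>J\<in>\<J>. indicator (A J) \<omega>) = real (card {J\<in>\<J>. \<omega> \<in> A J})"
      using fin by (simp add: indicator_def of_bool_def sum.If_cases Int_def)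
    ultimately show ?thesis
      using Cpos by (simp add: emp_def C_def[symmetric] sum_subtractf cJ diff_divide_distrib)
  qed
  have sq: "(emp \<pi> \<omega> - ?p)\<^sup>2 = (\<Sum>J\<in>\<J>. \<Sum>J'\<in>\<J>. ?X J \<omega> * ?X J' \<omega>) / C\<^sup>2" if "\<omega> \<in> space M" for \<omega>
    unfolding emp[OF that] by (simp add: power2_eq_square sum_product)
  have mix: "?X J \<omega> * ?X J' \<omega> = indicator (A J \<inter> A J') \<omega> - ?p * indicator (A J) \<omega> - ?p * indicator (A J') \<omega> + ?p * ?p" for J J' \<omega>
    by (simp add: indicator_inter_arith algebra_simps)
  have intX: "integrable M (\<lambda>\<omega>. ?X J \<omega> * ?X J' \<omega>)" if "J \<in> \<J>" "J' \<in> \<J>" for J J'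
    unfolding mix using A[OF that(1)] A[OF that(2)]
    by (intro Bochner_Integration.integrable_add Bochner_Integration.integrable_diff integrable_mult_right integrable_real_indicator)
       (auto simp: emeasure_eq_measure)
  have EX: "(\<integral>\<omega>. ?X J \<omega> * ?X J' \<omega> \<partial>M) = prob (A J \<inter> A J') - ?p * ?p" if "J \<in> \<J>" "J' \<in> \<J>" for J J'
    unfolding mix using A[OF that(1)] A[OF that(2)] pA[OF that(1)] pA[OF that(2)]
    by (simp add: emeasure_eq_measure prob_space)
  show "integrable M (\<lambda>\<omega>. (emp \<pi> \<omega> - ?p)\<^sup>2)"
    by (subst Bochner_Integration.integrable_cong[OF refl sq]) (auto intro!: Bochner_Integration.integrable_sum intX)
  have "(\<integral>\<omega>. (emp \<pi> \<omega> - ?p)\<^sup>2 \<partial>M) = (\<integral>\<omega>. (\<Sum>J\<in>\<J>. \<Sum>J'\<in>\<J>. ?X J \<omega> * ?X J' \<omega>) / C\<^sup>2 \<partial>M)"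
    by (rule Bochner_Integration.integral_cong[OF refl sq])
  also have "\<dots> = (\<Sum>J\<in>\<J>. \<Sum>J'\<in>\<J>. prob (A J \<inter> A J') - ?p * ?p) / C\<^sup>2"
    by (simp add: Bochner_Integration.integral_sum Bochner_Integration.integrable_sum intX EX cong: sum.cong)
  also have "\<dots> \<le> (\<Sum>J\<in>\<J>. \<Sum>J'\<in>\<J>. indicator {J'. J \<inter> J' \<noteq> {}} J') / C\<^sup>2"
  proof (intro divide_right_mono sum_mono)
    fix J J' assume J: "J \<in> \<J>" "J' \<in> \<J>"
    show "prob (A J \<inter> A J') - ?p * ?p \<le> indicator {J'. J \<inter> J' \<noteq> {}} J'"
    proof (cases "J \<inter> J' = {}")
      case True
      have "A J \<inter> A J' = {\<omega> \<in> space M. sample_occ \<pi> \<omega> J \<and> sample_occ \<pi> \<omega> J'}" by (auto simp: A_def)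
      then have "prob (A J \<inter> A J') = prob (A J) * prob (A J')"
        using prob_sample_occ_disjoint[of J J' \<pi>] True J N by (auto simp: A_def \<J>_def)
      then show ?thesis using pA J True by simp
    next
      case False
      have "prob (A J \<inter> A J') \<le> 1" "0 \<le> ?p * ?p" using p by auto
      moreover have "indicator {J'. J \<inter> J' \<noteq> {}} J' = (1 :: real)" using False by simp
      ultimately show ?thesis by linarith
    qed
  qed simp
  also have "\<dots> \<le> (\<Sum>J\<in>\<J>. real (?k * ?k) * C / real N) / C\<^sup>2"
  proof (intro divide_right_mono sum_mono)
    fix J assume J: "J \<in> \<J>"
    have "(\<Sum>J'\<in>\<J>. indicator {J'. J \<inter> J' \<noteq> {}} J') = real (card {J'. J' \<subseteq> {0..<N} \<and> card J' = ?k \<and> J \<inter> J' \<noteq> {}})"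
      using fin by (simp add: indicator_def of_bool_def sum.If_cases Int_def \<J>_def conj_assoc)
    moreover have "real (card {J'. J' \<subseteq> {0..<N} \<and> card J' = ?k \<and> J \<inter> J' \<noteq> {}}) * real N \<le> real (?k * ?k) * C"
      unfolding C_def using J k by (intro card_subsets_meeting) (auto simp: \<J>_def)
    ultimately show "(\<Sum>J'\<in>\<J>. indicator {J'. J \<inter> J' \<noteq> {}} J') \<le> real (?k * ?k) * C / real N"
      using N by (simp add: field_simps)
  qed simp
  also have "\<dots> = real (?k * ?k) / real N"
    using Cpos by (simp add: cJ power2_eq_square)
  finally show "(\<integral>\<omega>. (emp \<pi> \<omega> - ?p)\<^sup>2 \<partial>M) \<le> real (?k * ?k) / real N" .
qed

text \<open>The sum of all squared errors has mean below \<open>\<epsilon>\<^sup>2\<close>, so it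
  cannot be at least \<open>\<epsilon>\<^sup>2\<close> almost surely. As almost every sample has
  distinct coordinates, some sample with distinct coordinates is good for all patterns at
  once.\<close>

lemma exists_good_sample:
  assumes "finite \<P>" "\<And>\<pi>. \<pi> \<in> \<P> \<Longrightarrow> 1 \<le> length \<pi> \<and> length \<pi> \<le> K" "K \<le> N" "0 < \<epsilon>"
    and "real (card \<P>) * real (K * K) / real N < \<epsilon>\<^sup>2"
  obtains \<omega> where "inj_on (\<lambda>i. fst (\<omega> i)) {0..<N}" "inj_on (\<lambda>i. snd (\<omega> i)) {0..<N}"
    "\<And>\<pi>. \<pi> \<in> \<P> \<Longrightarrow> \<bar>emp \<pi> \<omega> - permuton_dens \<pi> \<Gamma>\<bar> \<le> \<epsilon>"
proof -
  interpret prob_space M by (rule prob_PiM)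
  let ?f = "\<lambda>\<omega>. \<Sum>\<pi>\<in>\<P>. (emp \<pi> \<omega> - permuton_dens \<pi> \<Gamma>)\<^sup>2"
  let ?G = "\<lambda>\<omega>. inj_on (\<lambda>i. fst (\<omega> i)) {0..<N} \<and> inj_on (\<lambda>i. snd (\<omega> i)) {0..<N}"
  have int: "integrable M ?f"
    using assms by (intro Bochner_Integration.integrable_sum second_moment) force+
  have "(\<integral>\<omega>. ?f \<omega> \<partial>M) = (\<Sum>\<pi>\<in>\<P>. \<integral>\<omega>. (emp \<pi> \<omega> - permuton_dens \<pi> \<Gamma>)\<^sup>2 \<partial>M)"
    using assms by (intro Bochner_Integration.integral_sum second_moment) force+
  also have "\<dots> \<le> (\<Sum>\<pi>\<in>\<P>. real (K * K) / real N)"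
  proof (rule sum_mono)
    fix \<pi> assume \<pi>: "\<pi> \<in> \<P>"
    have "(\<integral>\<omega>. (emp \<pi> \<omega> - permuton_dens \<pi> \<Gamma>)\<^sup>2 \<partial>M) \<le> real (length \<pi> * length \<pi>) / real N"
      using assms(2)[OF \<pi>] assms(3) by (intro second_moment) auto
    also have "\<dots> \<le> real (K * K) / real N"
      using assms(2)[OF \<pi>] by (intro divide_right_mono of_nat_mono mult_mono) auto
    finally show "(\<integral>\<omega>. (emp \<pi> \<omega> - permuton_dens \<pi> \<Gamma>)\<^sup>2 \<partial>M) \<le> real (K * K) / real N" .
  qed
  also have "\<dots> < \<epsilon>\<^sup>2" using assms(5) by simp
  finally have lt: "(\<integral>\<omega>. ?f \<omega> \<partial>M) < \<epsilon>\<^sup>2" .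
  have "\<exists>\<omega>. ?G \<omega> \<and> ?f \<omega> < \<epsilon>\<^sup>2"
  proof (rule ccontr)
    assume "\<not> ?thesis"
    then have "\<And>\<omega>. ?G \<omega> \<Longrightarrow> \<epsilon>\<^sup>2 \<le> ?f \<omega>" by (meson not_less)
    then have "AE \<omega> in M. \<epsilon>\<^sup>2 \<le> ?f \<omega>" using AE_generic by (rule eventually_mono[rotated])
    then have "\<epsilon>\<^sup>2 \<le> (\<integral>\<omega>. ?f \<omega> \<partial>M)" by (rule integral_ge_const[OF int])
    then show False using lt by simp
  qed
  then obtain \<omega> where \<omega>: "?G \<omega>" "?f \<omega> < \<epsilon>\<^sup>2" by blast
  have "\<bar>emp \<pi> \<omega> - permuton_dens \<pi> \<Gamma>\<bar> \<le> \<epsilon>" if "\<pi> \<in> \<P>" for \<pi>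
  proof -
    have "(emp \<pi> \<omega> - permuton_dens \<pi> \<Gamma>)\<^sup>2 \<le> ?f \<omega>"
      using that assms(1) by (intro member_le_sum) auto
    then have "(emp \<pi> \<omega> - permuton_dens \<pi> \<Gamma>)\<^sup>2 \<le> \<epsilon>\<^sup>2" using \<omega>(2) by simp
    then show ?thesis using assms(4) by (metis abs_le_square_iff abs_of_pos)
  qed
  then show ?thesis using that \<omega>(1) by blast
qed

text \<open>Listing the points from left to right and replacing heights by ranks turns the sample
  into a permutation. The listing \<open>xs\<close> maps sets of positions bijectively to sets of
  sample points, so the densities agree exactly.\<close>

lemma perm_of_sample:
  assumes x: "inj_on (\<lambda>i. fst (\<omega> i)) {0..<N}" and y: "inj_on (\<lambda>i. snd (\<omega> i)) {0..<N}"
  obtains \<gamma> where "is_perm \<gamma>" "length \<gamma> = N"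
    "\<And>\<pi>. 1 \<le> length \<pi> \<Longrightarrow> dens (real N) \<pi> \<gamma> = emp \<pi> \<omega>"
proof -
  define xs where "xs = sort_key (\<lambda>i. fst (\<omega> i)) [0..<N]"
  define rk where "rk i = card {j. j < N \<and> snd (\<omega> j) < snd (\<omega> i)}" for i
  define \<gamma> where "\<gamma> = map rk xs"
  have xs: "set xs = {0..<N}" "distinct xs" "length xs = N" "sorted (map (\<lambda>i. fst (\<omega> i)) xs)"
    by (simp_all add: xs_def)
  have rk_mono: "rk i < rk j" if "i < N" "snd (\<omega> i) < snd (\<omega> j)" for i j
    unfolding rk_def using that by (intro psubset_card_mono) auto
  have rk: "rk i < rk j \<longleftrightarrow> snd (\<omega> i) < snd (\<omega> j)" if "i < N" "j < N" for i j
  proof (cases "i = j")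
    case False
    then have "snd (\<omega> i) \<noteq> snd (\<omega> j)" using y that by (auto dest: inj_onD)
    then show ?thesis using rk_mono[of i j] rk_mono[of j i] that
      by (cases "snd (\<omega> i) < snd (\<omega> j)") auto
  qed simp
  have rk_less: "rk i < N" if "i < N" for i
  proof -
    have "{j. j < N \<and> snd (\<omega> j) < snd (\<omega> i)} \<subseteq> {0..<N} - {i}" by auto
    then have "rk i \<le> card ({0..<N} - {i})" unfolding rk_def by (intro card_mono) simp_all
    then show ?thesis using that by simp
  qed
  have dist: "distinct \<gamma>" unfolding \<gamma>_def distinct_map
  proof (intro conjI xs inj_onI)
    fix i j assume "i \<in> set xs" "j \<in> set xs" "rk i = rk j"
    then have ij: "i < N" "j < N" "\<not> rk i < rk j" "\<not> rk j < rk i" using xs by auto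
    then have "snd (\<omega> i) = snd (\<omega> j)" using rk[of i j] rk[of j i] by simp
    then show "i = j" using ij by (intro inj_onD[OF y]) auto
  qed
  have len: "length \<gamma> = N" by (simp add: \<gamma>_def xs)
  have "set \<gamma> \<subseteq> {0..<N}" using rk_less xs by (auto simp: \<gamma>_def)
  then have "set \<gamma> = {0..<N}" using dist len by (intro card_subset_eq) (auto simp: distinct_card)
  then have perm: "is_perm \<gamma>" using dist len by (simp add: is_perm_def)
  have bij: "bij_betw ((!) xs) {0..<N} {0..<N}"
    using xs by (intro bij_betw_nth) (auto simp: atLeast0LessThan)
  have occ: "occurs_at \<pi> \<gamma> I \<longleftrightarrow> sample_occ \<pi> \<omega> ((!) xs ` I)" if I: "I \<subseteq> {0..<N}" for I \<pi>
  proof -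
    have finI: "finite I" using I finite_subset by blast
    define vs where "vs = sorted_list_of_set I"
    have vs: "set vs = I" "distinct vs" "sorted vs" using finI by (simp_all add: vs_def)
    define ys where "ys = map ((!) xs) vs"
    have injI: "inj_on ((!) xs) I" using bij I by (auto simp: bij_betw_def intro: inj_on_subset)
    have ys: "set ys = (!) xs ` I" "distinct ys" using vs injI by (simp_all add: ys_def distinct_map)
    have isn: "i < N" if "i \<in> set vs" for i using that vs I by auto
    have fst_mono: "fst (\<omega> (xs ! i)) < fst (\<omega> (xs ! j))" if "i < j" "j < N" for i j
    proof -
      have "fst (\<omega> (xs ! i)) \<le> fst (\<omega> (xs ! j))" using sorted_nth_mono[OF xs(4), of i j] that xs(3) by simp
      moreover have "xs ! i \<noteq> xs ! j" using xs that by (simp add: nth_eq_iff_index_eq)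
      moreover have "xs ! i < N" "xs ! j < N" using bij that by (auto simp: bij_betw_def)
      moreover have "fst (\<omega> (xs ! i)) \<noteq> fst (\<omega> (xs ! j))"
        using calculation inj_onD[OF x, of "xs ! i" "xs ! j"] by auto
      ultimately show ?thesis by simp
    qed
    have srt: "sorted_wrt (\<lambda>i j. fst (\<omega> i) < fst (\<omega> j)) ys"
      unfolding ys_def sorted_wrt_map
    proof (rule sorted_wrt_mono_rel[of vs "(<)"])
      show "sorted_wrt (<) vs" using vs by (simp add: strict_sorted_iff)
    qed (use fst_mono isn in auto)
    have sub: "set ys \<subseteq> {0..<N}" using ys bij I by (auto simp: bij_betw_def)
    \<comment> \<open>Distinct x-coordinates admit just one increasing listing, so only
      \<open>ys\<close> can witness the existential quantifier in \<open>sample_occ\<close>.\<close>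
    have uniq: "zs = ys" if zs: "zs \<in> permutations_of_set ((!) xs ` I)" "sorted_wrt (\<lambda>i j. fst (\<omega> i) < fst (\<omega> j)) zs" for zs
    proof -
      let ?f = "\<lambda>i. fst (\<omega> i)"
      have sz: "set zs = set ys" using zs ys by (simp add: permutations_of_set_def)
      have "sorted_wrt (<) (map ?f zs)" "sorted_wrt (<) (map ?f ys)" using zs(2) srt by (simp_all add: sorted_wrt_map)
      then have "map ?f zs = map ?f ys"
        using sz by (intro sorted_distinct_set_unique) (auto simp: strict_sorted_iff)
      moreover have "inj_on ?f (set zs \<union> set ys)" using x sub sz by (auto intro: inj_on_subset)
      ultimately show ?thesis by (simp add: inj_on_map_eq_map)
    qed
    have ysP: "ys \<in> permutations_of_set ((!) xs ` I)" using ys by auto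
    have "sample_occ \<pi> \<omega> ((!) xs ` I) \<longleftrightarrow> order_iso (map (\<lambda>i. snd (\<omega> i)) ys) \<pi>"
      unfolding sample_occ_def using ysP srt uniq by blast
    also have "\<dots> \<longleftrightarrow> order_iso (map rk ys) \<pi>"
    proof -
      have "ys ! a < N" if "a < length ys" for a
        using nth_mem[OF that] sub by auto
      then show ?thesis unfolding order_iso_def using rk by auto
    qed
    also have "map rk ys = map (\<lambda>i. \<gamma> ! i) vs"
      unfolding ys_def \<gamma>_def using isn xs(3) by auto
    finally show ?thesis unfolding occurs_at_def vs_def by simp
  qed
  have "dens (real N) \<pi> \<gamma> = emp \<pi> \<omega>" if k: "1 \<le> length \<pi>" for \<pi>
  proof -
    let ?A = "{I. I \<subseteq> {0..<N} \<and> card I = length \<pi>}"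
    have injP: "inj_on ((`) ((!) xs)) (Pow {0..<N})"
      using bij by (intro inj_on_image_Pow) (auto simp: bij_betw_def)
    have "(`) ((!) xs) ` {I \<in> ?A. sample_occ \<pi> \<omega> ((!) xs ` I)} = {J. J \<subseteq> {0..<N} \<and> card J = length \<pi> \<and> sample_occ \<pi> \<omega> J}"
    proof (intro set_eqI iffI)
      fix J assume "J \<in> (`) ((!) xs) ` {I \<in> ?A. sample_occ \<pi> \<omega> ((!) xs ` I)}"
      then obtain I where I: "J = (!) xs ` I" "I \<subseteq> {0..<N}" "card I = length \<pi>" "sample_occ \<pi> \<omega> J" by auto
      have "inj_on ((!) xs) I" using bij I by (auto simp: bij_betw_def intro: inj_on_subset)
      then have "card J = length \<pi>" using I by (simp add: card_image)
      moreover have "J \<subseteq> {0..<N}" using I bij by (auto simp: bij_betw_def)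
      ultimately show "J \<in> {J. J \<subseteq> {0..<N} \<and> card J = length \<pi> \<and> sample_occ \<pi> \<omega> J}" using I by simp
    next
      fix J assume J: "J \<in> {J. J \<subseteq> {0..<N} \<and> card J = length \<pi> \<and> sample_occ \<pi> \<omega> J}"
      then have "J \<subseteq> (!) xs ` {0..<N}" using bij by (simp add: bij_betw_def)
      then obtain I where I: "I \<subseteq> {0..<N}" "J = (!) xs ` I" by (meson subset_imageE)
      have "inj_on ((!) xs) I" using bij I by (auto simp: bij_betw_def intro: inj_on_subset)
      then have "card I = length \<pi>" using I J by (simp add: card_image)
      then show "J \<in> (`) ((!) xs) ` {I \<in> ?A. sample_occ \<pi> \<omega> ((!) xs ` I)}" using I J by auto
    qed
    moreover have "inj_on ((`) ((!) xs)) {I \<in> ?A. sample_occ \<pi> \<omega> ((!) xs ` I)}"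
      by (rule inj_on_subset[OF injP]) auto
    ultimately have "bij_betw ((`) ((!) xs)) {I \<in> ?A. sample_occ \<pi> \<omega> ((!) xs ` I)}
        {J. J \<subseteq> {0..<N} \<and> card J = length \<pi> \<and> sample_occ \<pi> \<omega> J}"
      by (intro bij_betw_imageI)
    then have "card {I \<in> ?A. sample_occ \<pi> \<omega> ((!) xs ` I)} = card {J. J \<subseteq> {0..<N} \<and> card J = length \<pi> \<and> sample_occ \<pi> \<omega> J}"
      by (rule bij_betw_same_card)
    moreover have "{I \<in> windows N (length \<pi>) (real N). occurs_at \<pi> \<gamma> I} = {I \<in> ?A. sample_occ \<pi> \<omega> ((!) xs ` I)}"
      unfolding windows_full[OF k] using occ by auto
    ultimately show ?thesis
      unfolding dens_def emp_def len card_windows_full[OF k] by simp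
  qed
  then show ?thesis using that perm len by blast
qed

end

lemma finite_patterns: "finite {\<pi>. pattern \<pi> \<and> length \<pi> \<le> K}"
proof (rule finite_subset)
  show "{\<pi>. pattern \<pi> \<and> length \<pi> \<le> K} \<subseteq> {xs. set xs \<subseteq> {0..<K} \<and> length xs \<le> K}"
    by (auto simp: pattern_def is_perm_def)
qed (simp add: finite_lists_length_le)

text \<open>Every sufficiently large length is provided, because the length of
  \<open>\<gamma>\<close> must later be raised until the loss caused by inflating it is
  small.\<close>

lemma permuton_approx:
  assumes "permuton \<Gamma>" "0 < \<epsilon>"
  obtains N0 where "\<forall>N\<ge>N0. \<exists>\<gamma>. is_perm \<gamma> \<and> length \<gamma> = N \<and>
    (\<forall>\<pi>. pattern \<pi> \<and> length \<pi> \<le> K \<longrightarrow> \<bar>dens (real N) \<pi> \<gamma> - permuton_dens \<pi> \<Gamma>\<bar> \<le> \<epsilon>)"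
proof -
  define \<P> where "\<P> = {\<pi>. pattern \<pi> \<and> length \<pi> \<le> K}"
  have fin: "finite \<P>" unfolding \<P>_def by (rule finite_patterns)
  have "(\<lambda>N. real (card \<P>) * real (K * K) / real N) \<longlonglongrightarrow> 0"
    by (rule lim_const_over_n)
  then have "eventually (\<lambda>N. real (card \<P>) * real (K * K) / real N < \<epsilon>\<^sup>2) sequentially"
    using assms(2) by (intro order_tendstoD(2)) auto
  then obtain N1 where N1: "\<And>N. N1 \<le> N \<Longrightarrow> real (card \<P>) * real (K * K) / real N < \<epsilon>\<^sup>2"
    by (auto simp: eventually_sequentially)
  show ?thesis
  proof (rule that[of "max N1 K"], intro allI impI)
    fix N assume N: "max N1 K \<le> N"
    interpret sampling \<Gamma> N by standard (rule assms)
    have len: "1 \<le> length \<pi> \<and> length \<pi> \<le> K" if "\<pi> \<in> \<P>" for \<pi>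
      using that by (cases \<pi>) (auto simp: \<P>_def pattern_def)
    obtain \<omega> where \<omega>: "inj_on (\<lambda>i. fst (\<omega> i)) {0..<N}" "inj_on (\<lambda>i. snd (\<omega> i)) {0..<N}"
      "\<And>\<pi>. \<pi> \<in> \<P> \<Longrightarrow> \<bar>emp \<pi> \<omega> - permuton_dens \<pi> \<Gamma>\<bar> \<le> \<epsilon>"
      by (rule exists_good_sample[OF fin len]) (use N N1 assms(2) in auto)
    obtain \<gamma> where \<gamma>: "is_perm \<gamma>" "length \<gamma> = N" "\<And>\<pi>. 1 \<le> length \<pi> \<Longrightarrow> dens (real N) \<pi> \<gamma> = emp \<pi> \<omega>"
      by (rule perm_of_sample[OF \<omega>(1,2)]) blast
    have "\<bar>dens (real N) \<pi> \<gamma> - permuton_dens \<pi> \<Gamma>\<bar> \<le> \<epsilon>" if "pattern \<pi>" "length \<pi> \<le> K" for \<pi>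
    proof -
      have "\<pi> \<in> \<P>" using that by (simp add: \<P>_def)
      then show ?thesis using \<omega>(3) \<gamma>(3) len by simp
    qed
    then show "\<exists>\<gamma>. is_perm \<gamma> \<and> length \<gamma> = N \<and>
        (\<forall>\<pi>. pattern \<pi> \<and> length \<pi> \<le> K \<longrightarrow> \<bar>dens (real N) \<pi> \<gamma> - permuton_dens \<pi> \<Gamma>\<bar> \<le> \<epsilon>)"
      using \<gamma>(1,2) by blast
  qed
qed

section \<open>Choosing the block lengths\<close>

text \<open>The maximum with \<open>1\<close> only keeps the block lengths positive for small arguments.\<close>

primrec block_len :: "(nat \<Rightarrow> nat) \<Rightarrow> (nat \<Rightarrow> nat) \<Rightarrow> (nat \<Rightarrow> nat) \<Rightarrow> nat \<Rightarrow> nat" where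
  "block_len m w g 0 = 1"
| "block_len m w g (Suc i) = block_len m w g i * m i *
     max 1 (g (Suc i) div (w (Suc i) * (block_len m w g i * m i)))"

lemma block_len_pos: "(\<And>i. 0 < m i) \<Longrightarrow> 0 < block_len m w g i"
  by (induction i) auto

text \<open>For \<open>q = g div (w * D)\<close> rounding down loses less than one unit
  \<open>w * D\<close>, and the assumed room forces \<open>q\<close> above
  \<open>1 / \<delta>\<close>, so that this unit is at most a fraction \<open>\<delta>\<close> of
  what is kept. The maximum with \<open>1\<close> is then inactive.\<close>

lemma round_to_multiple:
  fixes \<delta> :: real
  assumes "0 < D" "0 < w" "0 < \<delta>" "(1 + 1 / \<delta>) * real (w * D) \<le> real g"
  defines "b \<equiv> D * max 1 (g div (w * D))"
  shows "w * b \<le> g" "real g \<le> (1 + \<delta>) * real (w * b)"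
proof -
  define q where "q = g div (w * D)"
  have wD: "0 < w * D" using assms by simp
  have "1 * real (w * D) \<le> (1 + 1 / \<delta>) * real (w * D)" using assms(3) by (intro mult_right_mono) auto
  then have "real (w * D) \<le> real g" using assms(4) by linarith
  then have "w * D \<le> g" by (simp only: of_nat_le_iff)
  then have "1 \<le> q" unfolding q_def using wD by (simp add: Suc_le_eq div_greater_zero_iff)
  then have b: "b = D * q" by (simp add: b_def q_def)
  have "q * (w * D) \<le> g" by (simp add: q_def)
  then show "w * b \<le> g" unfolding b by (simp add: mult_ac)
  have g: "g < (q + 1) * (w * D)" using wD unfolding q_def by (metis Suc_eq_plus1 dividend_less_div_times mult_Suc add.commute)
  then have "real g < real ((q + 1) * (w * D))" by (rule of_nat_less_iff[THEN iffD2])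
  then have g': "real g < (real q + 1) * real (w * D)" by (simp only: of_nat_mult of_nat_add of_nat_1)
  then have "(1 + 1 / \<delta>) * real (w * D) < (real q + 1) * real (w * D)" using assms(4) by linarith
  then have "1 + 1 / \<delta> < real q + 1" using wD by (simp only: mult_less_cancel_right_pos of_nat_0_less_iff)
  then have "1 \<le> \<delta> * real q" using assms(3) by (simp add: field_simps)
  then have "(real q + 1) * real (w * D) \<le> (1 + \<delta>) * real q * real (w * D)"
    by (intro mult_right_mono) (simp_all add: algebra_simps)
  then show "real g \<le> (1 + \<delta>) * real (w * b)" using g' unfolding b by (simp add: mult_ac)
qed

lemma eventually_room:
  fixes F D :: "nat \<Rightarrow> real"
  assumes F: "filterlim F at_top sequentially" and DF: "(\<lambda>n. D n / F n) \<longlonglongrightarrow> 0" and c: "0 < c"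
  shows "eventually (\<lambda>n. c * D n \<le> real (nat \<lfloor>F n\<rfloor>)) sequentially"
proof -
  \<comment> \<open>The factor \<open>2\<close> pays for the floor:
    \<open>F n / 2 \<le> F n - 1\<close> once \<open>F n \<ge> 2\<close>.\<close>
  have "eventually (\<lambda>n. D n / F n < 1 / (2 * c)) sequentially"
    using DF c by (intro order_tendstoD(2)) auto
  moreover have "eventually (\<lambda>n. 2 \<le> F n) sequentially" using F by (simp add: filterlim_at_top)
  ultimately show ?thesis
  proof eventually_elim
    case (elim n)
    then have "c * D n \<le> F n / 2" using c by (simp add: field_simps)
    also have "\<dots> \<le> F n - 1" using elim by simp
    also have "\<dots> \<le> real (nat \<lfloor>F n\<rfloor>)" using elim by linarith
    finally show ?case .
  qed
qed

text \<open>The two claims feed each other: a period that is small against the next scale leaves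
  room to fit the next block length, and a fitted block length is at most its scale, hence small
  against the scale after that. Cutting the target to \<open>0\<close> above \<open>T\<close> makes
  the block length at \<open>Suc T\<close> equal to the period of level \<open>T\<close>.\<close>

lemma block_len_asymp:
  fixes F :: "nat \<Rightarrow> nat \<Rightarrow> real" and T :: nat and m w :: "nat \<Rightarrow> nat"
  defines "B n \<equiv> block_len m w (\<lambda>l. if l \<le> T then nat \<lfloor>F l n\<rfloor> else 0)"
  assumes m: "\<And>i. 0 < m i" and w: "\<And>i. 0 < w i"
    and F: "\<And>i. 1 \<le> i \<Longrightarrow> i \<le> Suc T \<Longrightarrow> filterlim (F i) at_top sequentially"
    and dom: "\<And>i. 1 \<le> i \<Longrightarrow> i \<le> T \<Longrightarrow> (\<lambda>n. F i n / F (Suc i) n) \<longlonglongrightarrow> 0"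
  shows block_len_small: "i \<le> T \<Longrightarrow> (\<lambda>n. real (B n i * m i) / F (Suc i) n) \<longlonglongrightarrow> 0"
    and block_len_fits: "0 < \<delta> \<Longrightarrow> eventually (\<lambda>n. \<forall>i\<in>{1..T}. w i * B n i \<le> nat \<lfloor>F i n\<rfloor>
          \<and> real (nat \<lfloor>F i n\<rfloor>) \<le> (1 + \<delta>) * real (w i * B n i)) sequentially"
proof -
  have Bpos: "0 < B n i" for n i unfolding B_def by (rule block_len_pos[OF m])
  have fit: "eventually (\<lambda>n. w (Suc i) * B n (Suc i) \<le> nat \<lfloor>F (Suc i) n\<rfloor>
          \<and> real (nat \<lfloor>F (Suc i) n\<rfloor>) \<le> (1 + \<delta>) * real (w (Suc i) * B n (Suc i))) sequentially"
    if "Suc i \<le> T" "(\<lambda>n. real (B n i * m i) / F (Suc i) n) \<longlonglongrightarrow> 0" "0 < \<delta>" for i \<delta>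
  proof -
    have "eventually (\<lambda>n. ((1 + 1 / \<delta>) * real (w (Suc i))) * real (B n i * m i) \<le> real (nat \<lfloor>F (Suc i) n\<rfloor>)) sequentially"
      using that F[of "Suc i"] w[of "Suc i"] by (intro eventually_room) (auto intro!: mult_pos_pos add_pos_pos)
    then show ?thesis
    proof eventually_elim
      case (elim n)
      have D: "0 < B n i * m i" using Bpos m by simp
      have "B n (Suc i) = B n i * m i * max 1 (nat \<lfloor>F (Suc i) n\<rfloor> div (w (Suc i) * (B n i * m i)))"
        using that(1) by (simp add: B_def)
      then show ?case
        using round_to_multiple[OF D w[of "Suc i"] that(3), of "nat \<lfloor>F (Suc i) n\<rfloor>"] elim by (simp add: mult.assoc)
    qed
  qed
  show small: "(\<lambda>n. real (B n i * m i) / F (Suc i) n) \<longlonglongrightarrow> 0" if "i \<le> T" for i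
    using that
  proof (induction i)
    case 0
    have "(\<lambda>n. real (m 0) * inverse (F (Suc 0) n)) \<longlonglongrightarrow> real (m 0) * 0"
      by (intro tendsto_mult tendsto_const tendsto_inverse_0_at_top F) auto
    then show ?case by (simp add: B_def divide_inverse)
  next
    case (Suc i)
    have lim: "(\<lambda>n. real (m (Suc i)) * (F (Suc i) n / F (Suc (Suc i)) n)) \<longlonglongrightarrow> 0"
      using tendsto_mult[OF tendsto_const dom[of "Suc i"], of "real (m (Suc i))"] Suc.prems by simp
    have "eventually (\<lambda>n. 0 \<le> F (Suc i) n) sequentially" "eventually (\<lambda>n. 1 \<le> F (Suc (Suc i)) n) sequentially"
      using F[of "Suc i"] F[of "Suc (Suc i)"] Suc.prems by (auto simp: filterlim_at_top)
    then have ev: "eventually (\<lambda>n. norm (real (B n (Suc i) * m (Suc i)) / F (Suc (Suc i)) n)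
        \<le> real (m (Suc i)) * (F (Suc i) n / F (Suc (Suc i)) n)) sequentially"
      using fit[OF Suc.prems Suc.IH[OF Suc_leD[OF Suc.prems]] zero_less_one]
    proof eventually_elim
      case (elim n)
      have "B n (Suc i) \<le> w (Suc i) * B n (Suc i)" using w[of "Suc i"] by simp
      then have "B n (Suc i) \<le> nat \<lfloor>F (Suc i) n\<rfloor>" using elim by linarith
      then have "real (B n (Suc i)) \<le> F (Suc i) n" using elim by linarith
      then have "real (B n (Suc i)) * real (m (Suc i)) / F (Suc (Suc i)) n \<le> F (Suc i) n * real (m (Suc i)) / F (Suc (Suc i)) n"
        using elim by (intro divide_right_mono mult_right_mono) auto
      then show ?case using elim by (simp add: mult.commute)
    qed
    show ?case by (rule Lim_null_comparison[OF ev lim])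
  qed
  show "eventually (\<lambda>n. \<forall>i\<in>{1..T}. w i * B n i \<le> nat \<lfloor>F i n\<rfloor>
          \<and> real (nat \<lfloor>F i n\<rfloor>) \<le> (1 + \<delta>) * real (w i * B n i)) sequentially" if "0 < \<delta>" for \<delta>
  proof (intro eventually_ball_finite ballI finite_atLeastAtMost)
    fix i assume "i \<in> {1..T}"
    then obtain i' where i': "i = Suc i'" "Suc i' \<le> T" by (cases i) auto
    then show "eventually (\<lambda>n. w i * B n i \<le> nat \<lfloor>F i n\<rfloor> \<and> real (nat \<lfloor>F i n\<rfloor>) \<le> (1 + \<delta>) * real (w i * B n i)) sequentially"
      unfolding i'(1) using small[of i'] that by (intro fit) auto
  qed
qed

section \<open>Finite data extracted from the given limits\<close>

lemma eventually_patterns: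
  fixes a :: "nat \<Rightarrow> nat list \<Rightarrow> real"
  assumes "\<And>\<pi>. pattern \<pi> \<Longrightarrow> (\<lambda>j. a j \<pi>) \<longlonglongrightarrow> c \<pi>" "0 < \<epsilon>"
  shows "eventually (\<lambda>j. \<forall>\<pi>. pattern \<pi> \<and> length \<pi> \<le> K \<longrightarrow> \<bar>a j \<pi> - c \<pi>\<bar> \<le> \<epsilon>) sequentially"
proof -
  have "eventually (\<lambda>j. \<forall>\<pi>\<in>{\<pi>. pattern \<pi> \<and> length \<pi> \<le> K}. \<bar>a j \<pi> - c \<pi>\<bar> \<le> \<epsilon>) sequentially"
  proof (intro eventually_ball_finite finite_patterns ballI)
    fix \<pi> assume "\<pi> \<in> {\<pi>. pattern \<pi> \<and> length \<pi> \<le> K}"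
    then have "eventually (\<lambda>j. dist (a j \<pi>) (c \<pi>) < \<epsilon>) sequentially"
      using assms by (intro tendstoD) auto
    then show "eventually (\<lambda>j. \<bar>a j \<pi> - c \<pi>\<bar> \<le> \<epsilon>) sequentially"
      by (rule eventually_mono) (simp add: dist_real_def)
  qed
  then show ?thesis by (rule eventually_mono) auto
qed

lemma local_limit_approx:
  assumes "local_limit \<Lambda>" "0 < \<epsilon>"
  shows "\<exists>\<sigma>. is_perm \<sigma> \<and> N \<le> length \<sigma> \<and>
    (\<forall>\<pi>. pattern \<pi> \<and> length \<pi> \<le> K \<longrightarrow> \<bar>dens (real (length \<pi>)) \<pi> \<sigma> - \<Lambda> \<pi>\<bar> \<le> \<epsilon>)"
proof -
  obtain s where s: "\<And>j. is_perm (s j)" "filterlim (\<lambda>j. length (s j)) at_top sequentially"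
    "\<And>\<pi>. pattern \<pi> \<Longrightarrow> (\<lambda>j. dens (real (length \<pi>)) \<pi> (s j)) \<longlonglongrightarrow> \<Lambda> \<pi>"
    using assms(1) by (auto simp: local_limit_def conv_local_def perm_seq_def)
  have "eventually (\<lambda>j. N \<le> length (s j)) sequentially" using s(2) by (simp add: filterlim_at_top)
  then have "eventually (\<lambda>j. N \<le> length (s j) \<and> (\<forall>\<pi>. pattern \<pi> \<and> length \<pi> \<le> K \<longrightarrow>
      \<bar>dens (real (length \<pi>)) \<pi> (s j) - \<Lambda> \<pi>\<bar> \<le> \<epsilon>)) sequentially"
    using eventually_patterns[OF s(3) assms(2)] by (rule eventually_conj)
  then show ?thesis using s(1) by (auto simp: eventually_sequentially)
qed

text \<open>What is kept of a scale limit is one permutation and one width, large in itself and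
  small against the length. The scaling function that produced the limit disappears, so
  \<open>\<Xi>\<close> can be shown at another scale.\<close>

lemma scale_limit_approx:
  assumes "scale_limit \<Xi>" "0 < \<epsilon>"
  shows "\<exists>\<sigma> w. is_perm \<sigma> \<and> N \<le> w \<and> real w \<le> \<epsilon> * real (length \<sigma>) \<and>
    (\<forall>\<pi>. pattern \<pi> \<and> length \<pi> \<le> K \<longrightarrow> \<bar>dens (real w) \<pi> \<sigma> - \<Xi> \<pi>\<bar> \<le> \<epsilon>)"
proof -
  obtain g s where g: "scaling_fn g" and s: "\<And>j. is_perm (s j)" "filterlim (\<lambda>j. length (s j)) at_top sequentially"
    "\<And>\<pi>. pattern \<pi> \<Longrightarrow> (\<lambda>j. dens (g (length (s j))) \<pi> (s j)) \<longlonglongrightarrow> \<Xi> \<pi>"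
    using assms(1) by (auto simp: scale_limit_def conv_scale_def perm_seq_def)
  have "eventually (\<lambda>n. real N + 1 \<le> g n) sequentially"
    using g by (simp add: scaling_fn_def filterlim_at_top)
  moreover have "eventually (\<lambda>n. g n / real n < \<epsilon>) sequentially"
    using g assms(2) by (intro order_tendstoD(2)) (auto simp: scaling_fn_def)
  ultimately have "eventually (\<lambda>n. real N + 1 \<le> g n \<and> g n / real n < \<epsilon> \<and> 0 < n) sequentially"
    using eventually_gt_at_top[of 0] by eventually_elim auto
  then have "eventually (\<lambda>j. real N + 1 \<le> g (length (s j)) \<and> g (length (s j)) / real (length (s j)) < \<epsilon> \<and> 0 < length (s j)) sequentially"
    by (rule eventually_compose_filterlim[OF _ s(2)])
  then have "eventually (\<lambda>j. (real N + 1 \<le> g (length (s j)) \<and> g (length (s j)) / real (length (s j)) < \<epsilon> \<and> 0 < length (s j)) \<and>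
      (\<forall>\<pi>. pattern \<pi> \<and> length \<pi> \<le> K \<longrightarrow> \<bar>dens (g (length (s j))) \<pi> (s j) - \<Xi> \<pi>\<bar> \<le> \<epsilon>)) sequentially"
    using eventually_patterns[OF s(3) assms(2)] by (rule eventually_conj)
  then obtain j where j: "real N + 1 \<le> g (length (s j))" "g (length (s j)) / real (length (s j)) < \<epsilon>" "0 < length (s j)"
      "\<forall>\<pi>. pattern \<pi> \<and> length \<pi> \<le> K \<longrightarrow> \<bar>dens (g (length (s j))) \<pi> (s j) - \<Xi> \<pi>\<bar> \<le> \<epsilon>"
    by (auto simp: eventually_sequentially)
  define w where "w = nat \<lfloor>g (length (s j))\<rfloor>"
  have g0: "0 \<le> g (length (s j))" using j(1) by linarith
  have "N \<le> w" using j(1) by (simp add: w_def le_nat_floor)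
  moreover have "real w \<le> \<epsilon> * real (length (s j))"
  proof -
    have "real w \<le> g (length (s j))" using g0 by (simp add: w_def)
    also have "\<dots> \<le> \<epsilon> * real (length (s j))" using j(2,3) by (simp add: field_simps)
    finally show ?thesis .
  qed
  ultimately show ?thesis
    using s(1) j(4) dens_floor[OF g0] unfolding w_def by metis
qed

section \<open>Approximation at finitely many scales\<close>

lemma levels_block_len:
  assumes "\<And>i. is_perm (\<sigma> i)" "\<And>i. 0 < length (\<sigma> i)"
  shows "levels \<sigma> (block_len (\<lambda>i. length (\<sigma> i)) w g)
    (\<lambda>i. max 1 (g (Suc i) div (w (Suc i) * (block_len (\<lambda>i. length (\<sigma> i)) w g i * length (\<sigma> i)))))"
  by standard (use assms in auto)

text \<open>Level \<open>0\<close> carries the local limit, level \<open>i \<ge> 1\<close> the scale limit \<open>X i\<close>.\<close>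

definition level_data :: "real \<Rightarrow> nat \<Rightarrow> (nat list \<Rightarrow> real) \<Rightarrow> (nat \<Rightarrow> nat list \<Rightarrow> real)
    \<Rightarrow> (nat \<Rightarrow> nat list) \<Rightarrow> (nat \<Rightarrow> nat) \<Rightarrow> bool" where
  "level_data \<epsilon> K \<Lambda> X \<sigma> w \<longleftrightarrow>
     (\<forall>i. is_perm (\<sigma> i) \<and> 0 < length (\<sigma> i) \<and> 0 < w i) \<and>
     K \<le> length (\<sigma> 0) \<and> real K \<le> \<epsilon> * real (length (\<sigma> 0)) \<and>
     (\<forall>\<pi>. pattern \<pi> \<and> length \<pi> \<le> K \<longrightarrow> \<bar>dens (real (length \<pi>)) \<pi> (\<sigma> 0) - \<Lambda> \<pi>\<bar> \<le> \<epsilon>) \<and>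
     (\<forall>i\<ge>1. K \<le> w i \<and> real (K * K) \<le> \<epsilon> * real (w i) \<and> real (w i) \<le> \<epsilon> * real (length (\<sigma> i)) \<and>
        (\<forall>\<pi>. pattern \<pi> \<and> length \<pi> \<le> K \<longrightarrow> \<bar>dens (real (w i)) \<pi> (\<sigma> i) - X i \<pi>\<bar> \<le> \<epsilon>))"

lemma level_data_exists:
  assumes \<Lambda>: "local_limit \<Lambda>" and X: "\<And>i. scale_limit (X i)" and \<epsilon>: "0 < \<epsilon>"
  obtains \<sigma> w where "level_data \<epsilon> K \<Lambda> X \<sigma> w"
proof -
  \<comment> \<open>The bounds match the error terms of the density estimates: pattern length
    squared over \<open>w\<close>, and pattern length over the length of the local
    permutation.\<close>
  obtain N where N: "real (K * K) / \<epsilon> \<le> real N" "real K / \<epsilon> \<le> real N" "K \<le> N" "1 \<le> N"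
  proof -
    obtain a c where "real (K * K) / \<epsilon> \<le> real a" "real K / \<epsilon> \<le> real c" by (meson real_arch_simple)
    then show ?thesis by (intro that[of "max (max a c) (max K 1)"]) auto
  qed
  obtain \<sigma>0 where \<sigma>0: "is_perm \<sigma>0" "N \<le> length \<sigma>0"
    "\<forall>\<pi>. pattern \<pi> \<and> length \<pi> \<le> K \<longrightarrow> \<bar>dens (real (length \<pi>)) \<pi> \<sigma>0 - \<Lambda> \<pi>\<bar> \<le> \<epsilon>"
    using local_limit_approx[OF \<Lambda> \<epsilon>] by blast
  have "\<forall>i. \<exists>\<sigma> w. is_perm \<sigma> \<and> N \<le> w \<and> real w \<le> \<epsilon> * real (length \<sigma>) \<and>
    (\<forall>\<pi>. pattern \<pi> \<and> length \<pi> \<le> K \<longrightarrow> \<bar>dens (real w) \<pi> \<sigma> - X i \<pi>\<bar> \<le> \<epsilon>)"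
    using scale_limit_approx[OF X \<epsilon>] by blast
  then obtain \<sigma> w where \<sigma>: "\<And>i. is_perm (\<sigma> i)" "\<And>i. N \<le> w i" "\<And>i. real (w i) \<le> \<epsilon> * real (length (\<sigma> i))"
    "\<And>i \<pi>. pattern \<pi> \<and> length \<pi> \<le> K \<Longrightarrow> \<bar>dens (real (w i)) \<pi> (\<sigma> i) - X i \<pi>\<bar> \<le> \<epsilon>"
    by metis
  have len: "0 < length (\<sigma> i)" for i
  proof (rule ccontr)
    assume "\<not> 0 < length (\<sigma> i)"
    then have "real (w i) \<le> 0" using \<sigma>(3)[of i] by simp
    then show False using \<sigma>(2)[of i] N(4) by simp
  qed
  have wN: "real N \<le> real (w i)" for i using \<sigma>(2) by simp
  have "real (K * K) \<le> \<epsilon> * real (w i)" for i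
  proof -
    have "real (K * K) / \<epsilon> \<le> real (w i)" using N(1) wN[of i] by linarith
    then show ?thesis using \<epsilon> by (simp add: field_simps)
  qed
  moreover have "real K \<le> \<epsilon> * real (length \<sigma>0)"
  proof -
    have "real N \<le> real (length \<sigma>0)" using \<sigma>0(2) by simp
    then have "real K / \<epsilon> \<le> real (length \<sigma>0)" using N(2) by linarith
    then show ?thesis using \<epsilon> by (simp add: field_simps)
  qed
  moreover have "K \<le> w i" "0 < w i" for i using \<sigma>(2)[of i] N by linarith+
  moreover have "K \<le> length \<sigma>0" "\<sigma>0 \<noteq> []" using \<sigma>0(2) N by auto
  ultimately have "level_data \<epsilon> K \<Lambda> X (\<lambda>i. if i = 0 then \<sigma>0 else \<sigma> i) w"
    unfolding level_data_def using \<sigma> \<sigma>0 len by auto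
  then show ?thesis by (rule that)
qed

lemma level_data_dens_close:
  fixes F :: "nat \<Rightarrow> real" and Q :: "nat \<Rightarrow> nat"
  assumes data: "level_data \<epsilon> K \<Lambda> X \<sigma> w" and \<epsilon>: "0 < \<epsilon>" "\<epsilon> < 1" and K: "1 \<le> K"
    and B_def: "B = block_len (\<lambda>i. length (\<sigma> i)) w (\<lambda>l. if l \<le> T then nat \<lfloor>F l\<rfloor> else 0)"
    and L_def: "L = (\<Prod>l<Suc T. length (\<sigma> l)) * R"
    and len: "length \<tau> = G * L" and pos: "0 < length \<tau>"
    and Q: "\<And>i c x y. \<lbrakk>i < Suc T; (c + 1) * (B i * length (\<sigma> i)) \<le> B (Suc T) * (L div B (Suc T));
           x < B i * length (\<sigma> i); y < B i * length (\<sigma> i); \<sigma> i ! (x div B i) < \<sigma> i ! (y div B i)\<rbrakk>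
           \<Longrightarrow> Q (c * (B i * length (\<sigma> i)) + x) < Q (c * (B i * length (\<sigma> i)) + y)"
    and col: "\<And>x y. \<lbrakk>x < G * L; y < G * L; x div L = y div L; Q (x mod L) < Q (y mod L)\<rbrakk> \<Longrightarrow> \<tau> ! x < \<tau> ! y"
    and fit: "\<And>i. 1 \<le> i \<Longrightarrow> i \<le> T \<Longrightarrow> w i * B i \<le> nat \<lfloor>F i\<rfloor> \<and> real (nat \<lfloor>F i\<rfloor>) \<le> (1 + \<epsilon> / real K) * real (w i * B i)"
    and F: "\<And>i. 1 \<le> i \<Longrightarrow> i \<le> T \<Longrightarrow> 0 \<le> F i"
    and few: "real (B (Suc T) * G) \<le> \<epsilon> * real (length \<tau>)"
    and \<pi>: "pattern \<pi>" "length \<pi> \<le> K"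
  shows "\<bar>dens (real (length \<pi>)) \<pi> \<tau> - \<Lambda> \<pi>\<bar> \<le> 5 * \<epsilon>"
    and "1 \<le> i \<Longrightarrow> i \<le> T \<Longrightarrow> \<bar>dens (F i) \<pi> \<tau> - X i \<pi>\<bar> \<le> 5 * \<epsilon>"
proof -
  note data' = data[unfolded level_data_def]
  interpret levels \<sigma> B "\<lambda>i. max 1 ((if Suc i \<le> T then nat \<lfloor>F (Suc i)\<rfloor> else 0) div (w (Suc i) * (B i * length (\<sigma> i))))"
    unfolding B_def using levels_block_len[of \<sigma> w "\<lambda>l. if l \<le> T then nat \<lfloor>F l\<rfloor> else 0"] data' by simp
  define L0 where "L0 = B (Suc T) * (L div B (Suc T))"
  have dense0: "(1 - \<epsilon>) * real (length \<tau>) \<le> real (G * L0)"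
  proof -
    have "L < L0 + B (Suc T)" unfolding L0_def
      using dividend_less_times_div[OF b_pos[of "Suc T"], of L] by (simp add: add.commute)
    then have "G * L \<le> G * (L0 + B (Suc T))" by (intro mult_left_mono) auto
    then have "real (G * L) \<le> real (G * L0) + real (B (Suc T) * G)"
      by (metis (mono_tags) distrib_left mult.commute of_nat_add of_nat_le_iff)
    then show ?thesis using few len by (simp add: algebra_simps)
  qed
  have blk: "\<exists>C. blocks \<tau> (\<sigma> i) C (B i) \<and> (1 - \<epsilon>) * real (length \<tau>) \<le> real (card C * (B i * length (\<sigma> i))) \<and> C \<noteq> {}"
    if i: "i < Suc T" for i
  proof -
    obtain C where C: "blocks \<tau> (\<sigma> i) C (B i)" "card C * (B i * length (\<sigma> i)) = G * L0"
      by (rule column_blocks[where Q = Q and T = "Suc T" and R = R and G = G and \<tau> = \<tau>, OF i])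
        (use len Q[OF i] col in \<open>unfold L_def L0_def, blast+\<close>)
    have "0 < (1 - \<epsilon>) * real (length \<tau>)" using \<epsilon> pos by simp
    then have "0 < real (card C * (B i * length (\<sigma> i)))" using dense0 unfolding C(2) by linarith
    then have "C \<noteq> {}" by auto
    moreover have "(1 - \<epsilon>) * real (length \<tau>) \<le> real (card C * (B i * length (\<sigma> i)))"
      unfolding C(2) by (rule dense0)
    ultimately show ?thesis using C(1) by blast
  qed
  have k: "1 \<le> length \<pi>" using \<pi> by (cases \<pi>) (auto simp: pattern_def)
  show "\<bar>dens (real (length \<pi>)) \<pi> \<tau> - \<Lambda> \<pi>\<bar> \<le> 5 * \<epsilon>"
  proof -
    obtain C where C: "blocks \<tau> (\<sigma> 0) C (B 0)" "(1 - \<epsilon>) * real (length \<tau>) \<le> real (card C * (B 0 * length (\<sigma> 0)))" "C \<noteq> {}"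
      using blk[of 0] by auto
    have B0: "B 0 = 1" by (simp add: B_def)
    have kK: "length \<pi> \<le> length (\<sigma> 0)" using data' \<pi> by linarith
    have "\<bar>dens (real (length \<pi>)) \<pi> \<tau> - dens (real (length \<pi>)) \<pi> (\<sigma> 0)\<bar> \<le> \<epsilon> + real (length \<pi>) / real (length (\<sigma> 0))"
      by (rule blocks.dens_close_local[OF C(1) k kK B0]) (use C B0 \<epsilon> in auto)
    moreover have "real (length \<pi>) / real (length (\<sigma> 0)) \<le> \<epsilon>"
    proof -
      have "real (length \<pi>) \<le> real K" using \<pi> by simp
      also have "real K \<le> \<epsilon> * real (length (\<sigma> 0))" using data' by blast
      finally show ?thesis using nonempty[of 0] by (simp add: pos_divide_le_eq)
    qed
    moreover have "\<bar>dens (real (length \<pi>)) \<pi> (\<sigma> 0) - \<Lambda> \<pi>\<bar> \<le> \<epsilon>" using data' \<pi> by blast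
    ultimately show ?thesis using \<epsilon> by linarith
  qed
  show "\<bar>dens (F i) \<pi> \<tau> - X i \<pi>\<bar> \<le> 5 * \<epsilon>" if i: "1 \<le> i" "i \<le> T"
  proof -
    obtain C where C: "blocks \<tau> (\<sigma> i) C (B i)" "(1 - \<epsilon>) * real (length \<tau>) \<le> real (card C * (B i * length (\<sigma> i)))" "C \<noteq> {}"
      using blk[of i] i by auto
    have d: "K \<le> w i" "real (K * K) \<le> \<epsilon> * real (w i)" "real (w i) \<le> \<epsilon> * real (length (\<sigma> i))"
        "\<bar>dens (real (w i)) \<pi> (\<sigma> i) - X i \<pi>\<bar> \<le> \<epsilon>" "0 < w i"
      using data' i \<pi> by blast+
    have m: "0 < real (length (\<sigma> i))" using nonempty[of i] by (simp only: of_nat_0_less_iff)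
    have wm: "w i \<le> length (\<sigma> i)"
    proof -
      have "\<epsilon> * real (length (\<sigma> i)) \<le> 1 * real (length (\<sigma> i))" using \<epsilon> by (intro mult_right_mono) auto
      then show ?thesis using d(3) by linarith
    qed
    have kw: "length \<pi> \<le> w i" using d(1) \<pi> by linarith
    have "\<bar>dens (real (nat \<lfloor>F i\<rfloor>)) \<pi> \<tau> - dens (real (w i)) \<pi> (\<sigma> i)\<bar>
       \<le> \<epsilon> + real (w i) / real (length (\<sigma> i)) + real (length \<pi>) * (real (length \<pi>) / real (w i) + \<epsilon> / real K)"
      by (rule blocks.dens_close_scale[OF C(1) k kw wm]) (use C \<epsilon> fit[OF i] b_pos in auto)
    moreover have "real (w i) / real (length (\<sigma> i)) \<le> \<epsilon>" using d(3) m by (simp add: pos_divide_le_eq)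
    moreover have "real (length \<pi>) * (real (length \<pi>) / real (w i) + \<epsilon> / real K) \<le> 2 * \<epsilon>"
    proof -
      have "real (length \<pi>) * (real (length \<pi>) / real (w i) + \<epsilon> / real K) \<le> real K * (real K / real (w i) + \<epsilon> / real K)"
        using \<pi> \<epsilon> by (intro mult_mono add_mono divide_right_mono) auto
      also have "\<dots> = real (K * K) / real (w i) + \<epsilon>" using K by (simp add: field_simps)
      also have "real (K * K) / real (w i) \<le> \<epsilon>" using d(2,5) by (simp add: pos_divide_le_eq)
      finally show ?thesis by simp
    qed
    moreover have "dens (F i) \<pi> \<tau> = dens (real (nat \<lfloor>F i\<rfloor>)) \<pi> \<tau>" by (rule dens_floor[OF F[OF i]])
    ultimately show ?thesis using d(4) by linarith
  qed
qed

text \<open>A dominated function is eventually strictly smaller. At one argument \<open>n\<close>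
  beyond the finitely many thresholds, sorting by values is therefore sorting by domination.\<close>

lemma sorted_by_domination:
  fixes f :: "nat \<Rightarrow> nat \<Rightarrow> real"
  assumes scaling: "\<And>t. scaling_fn (f t)"
    and total: "\<And>s t. s \<noteq> t \<Longrightarrow> dominated (f s) (f t) \<or> dominated (f t) (f s)"
  obtains ts where "set ts = {0..<T}" "length ts = T"
    "\<forall>i. Suc i < T \<longrightarrow> dominated (f (ts ! i)) (f (ts ! Suc i))"
proof -
  have "eventually (\<lambda>n. \<forall>p\<in>{0..<T} \<times> {0..<T}. dominated (f (fst p)) (f (snd p)) \<longrightarrow> f (fst p) n < f (snd p) n) sequentially"
  proof (intro eventually_ball_finite ballI)
    fix p :: "nat \<times> nat"
    show "eventually (\<lambda>n. dominated (f (fst p)) (f (snd p)) \<longrightarrow> f (fst p) n < f (snd p) n) sequentially"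
    proof (cases "dominated (f (fst p)) (f (snd p))")
      case True
      then have "eventually (\<lambda>n. f (fst p) n / f (snd p) n < 1) sequentially"
        by (intro order_tendstoD(2)) (auto simp: dominated_def)
      then show ?thesis using eventually_ge_at_top[of 1]
      proof eventually_elim
        case (elim n)
        have "0 < f (snd p) n" using scaling elim(2) by (simp add: scaling_fn_def)
        then show ?case using elim(1) by (simp add: pos_divide_less_eq)
      qed
    qed simp
  qed simp
  then obtain n where n: "\<And>s t. s < T \<Longrightarrow> t < T \<Longrightarrow> dominated (f s) (f t) \<Longrightarrow> f s n < f t n"
    unfolding eventually_sequentially by force
  define ts where "ts = sort_key (\<lambda>t. f t n) [0..<T]"
  have ts: "distinct ts" "set ts = {0..<T}" "length ts = T" "sorted (map (\<lambda>t. f t n) ts)" by (simp_all add: ts_def)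
  have "dominated (f (ts ! i)) (f (ts ! Suc i))" if i: "Suc i < T" for i
  proof (rule ccontr)
    assume not: "\<not> dominated (f (ts ! i)) (f (ts ! Suc i))"
    have "ts ! i \<noteq> ts ! Suc i" using ts i by (simp add: nth_eq_iff_index_eq)
    then have "dominated (f (ts ! Suc i)) (f (ts ! i))" using total not by blast
    moreover have "ts ! i < T" "ts ! Suc i < T" using ts i nth_mem[of i ts] nth_mem[of "Suc i" ts] by auto
    ultimately have "f (ts ! Suc i) n < f (ts ! i) n" using n by blast
    moreover have "f (ts ! i) n \<le> f (ts ! Suc i) n" using sorted_nth_mono[OF ts(4), of i "Suc i"] i ts(3) by simp
    ultimately show False by simp
  qed
  then show ?thesis using that ts by blast
qed

definition approximates :: "real \<Rightarrow> nat \<Rightarrow> nat \<Rightarrow> (nat \<Rightarrow> nat \<Rightarrow> real) \<Rightarrow> (nat list \<Rightarrow> real)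
    \<Rightarrow> (nat \<Rightarrow> nat list \<Rightarrow> real) \<Rightarrow> nat list \<Rightarrow> bool" where
  "approximates \<epsilon> K T f \<Lambda> \<Xi> \<tau> \<longleftrightarrow> (\<forall>\<pi>. pattern \<pi> \<and> length \<pi> \<le> K \<longrightarrow>
     \<bar>dens (real (length \<pi>)) \<pi> \<tau> - \<Lambda> \<pi>\<bar> \<le> \<epsilon> \<and> (\<forall>t<T. \<bar>dens (f t (length \<tau>)) \<pi> \<tau> - \<Xi> t \<pi>\<bar> \<le> \<epsilon>))"

text \<open>\<open>G\<close> and the alphabet are fixed before \<open>n\<close>, so the column
  length \<open>n / G\<close> is linear in \<open>n\<close>. \<open>Q\<close> is chosen after
  \<open>n\<close>, because its block lengths depend on the scaling functions at \<open>n\<close>.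
  The conclusion covers every list following \<open>Q\<close>, so it applies to a permutation and to
  an inverse alike.\<close>

lemma level_data_approximates:
  fixes f :: "nat \<Rightarrow> nat \<Rightarrow> real"
  assumes data: "level_data \<epsilon> K \<Lambda> (\<lambda>i. \<Xi> (ts ! (i - 1))) \<sigma> w" and \<epsilon>: "0 < \<epsilon>" "\<epsilon> < 1" and K: "1 \<le> K"
    and scaling: "\<And>t. scaling_fn (f t)"
    and ts: "set ts = {0..<T}" "length ts = T" "\<And>i. Suc i < T \<Longrightarrow> dominated (f (ts ! i)) (f (ts ! Suc i))"
    and G: "0 < G"
  obtains n1 where "\<forall>n R. n1 \<le> n \<longrightarrow> n = G * ((\<Prod>l<Suc T. length (\<sigma> l)) * R) \<longrightarrow>
     (\<exists>Q. balanced Q (\<Prod>l<Suc T. length (\<sigma> l)) R \<and>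
       (\<forall>\<tau>. length \<tau> = n \<longrightarrow> follows_word Q ((\<Prod>l<Suc T. length (\<sigma> l)) * R) \<tau> \<longrightarrow>
         approximates (5 * \<epsilon>) K T f \<Lambda> \<Xi> \<tau>))"
proof -
  note data' = data[unfolded level_data_def]
  \<comment> \<open>The identity is appended as a scale above all others; its growth makes the last
    period short against the columns.\<close>
  define F where "F i n = (if i \<le> T then f (ts ! (i - 1)) n else real n)" for i n
  define m where "m i = length (\<sigma> i)" for i
  define B where "B n = block_len m w (\<lambda>l. if l \<le> T then nat \<lfloor>F l n\<rfloor> else 0)" for n
  have mw: "\<And>i. 0 < m i" "\<And>i. 0 < w i" using data' by (auto simp: m_def)
  have F_top: "filterlim (F i) at_top sequentially" if "1 \<le> i" "i \<le> Suc T" for i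
  proof (cases "i \<le> T")
    case True
    then have "F i = f (ts ! (i - 1))" by (auto simp: F_def)
    then show ?thesis using scaling by (simp add: scaling_fn_def)
  next
    case False
    then have "F i = real" by (auto simp: F_def)
    then show ?thesis by (simp add: filterlim_real_sequentially)
  qed
  have F_dom: "(\<lambda>n. F i n / F (Suc i) n) \<longlonglongrightarrow> 0" if i: "1 \<le> i" "i \<le> T" for i
  proof (cases "i = T")
    case True
    then have "F i = f (ts ! (i - 1))" "F (Suc i) = real" using i by (auto simp: F_def)
    then show ?thesis using scaling by (simp add: scaling_fn_def)
  next
    case False
    then have "F i = f (ts ! (i - 1))" "F (Suc i) = f (ts ! Suc (i - 1))" "Suc (i - 1) < T" using i by (auto simp: F_def)
    then show ?thesis using ts(3)[of "i - 1"] by (simp add: dominated_def)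
  qed
  have "(\<lambda>n. real (B n T * m T) / F (Suc T) n) \<longlonglongrightarrow> 0"
    unfolding B_def using mw F_top F_dom by (intro block_len_small) auto
  then have "eventually (\<lambda>n. real (B n T * m T) / real n < \<epsilon> / real G) sequentially"
    using \<epsilon> G by (intro order_tendstoD(2)) (auto simp: F_def)
  moreover have "eventually (\<lambda>n. \<forall>i\<in>{1..T}. w i * B n i \<le> nat \<lfloor>F i n\<rfloor>
          \<and> real (nat \<lfloor>F i n\<rfloor>) \<le> (1 + \<epsilon> / real K) * real (w i * B n i)) sequentially"
    unfolding B_def using mw F_top F_dom \<epsilon> K by (intro block_len_fits) auto
  ultimately have "eventually (\<lambda>n. real (B n T * m T) / real n < \<epsilon> / real G \<and> (\<forall>i\<in>{1..T}. w i * B n i \<le> nat \<lfloor>F i n\<rfloor>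
          \<and> real (nat \<lfloor>F i n\<rfloor>) \<le> (1 + \<epsilon> / real K) * real (w i * B n i)) \<and> 0 < n) sequentially"
    using eventually_gt_at_top[of 0] by eventually_elim auto
  then obtain n1 where N1: "\<forall>n\<ge>n1. real (B n T * m T) / real n < \<epsilon> / real G \<and> (\<forall>i\<in>{1..T}. w i * B n i \<le> nat \<lfloor>F i n\<rfloor>
          \<and> real (nat \<lfloor>F i n\<rfloor>) \<le> (1 + \<epsilon> / real K) * real (w i * B n i)) \<and> 0 < n"
    unfolding eventually_sequentially by blast
  have n1: "real (B n T * m T) / real n < \<epsilon> / real G" "0 < n"
    "\<And>i. 1 \<le> i \<Longrightarrow> i \<le> T \<Longrightarrow> w i * B n i \<le> nat \<lfloor>F i n\<rfloor>
          \<and> real (nat \<lfloor>F i n\<rfloor>) \<le> (1 + \<epsilon> / real K) * real (w i * B n i)" if "n1 \<le> n" for n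
    using N1 that by (blast, blast, meson atLeastAtMost_iff)
  let ?P = "\<Prod>l<Suc T. length (\<sigma> l)"
  show ?thesis
  proof (rule that[of n1], intro allI impI)
    fix n R assume n: "n1 \<le> n" "n = G * (?P * R)"
    let ?L = "?P * R"
    interpret levels \<sigma> "B n" "\<lambda>i. max 1 ((if Suc i \<le> T then nat \<lfloor>F (Suc i) n\<rfloor> else 0) div (w (Suc i) * (B n i * length (\<sigma> i))))"
      unfolding B_def m_def using levels_block_len[of \<sigma> w "\<lambda>l. if l \<le> T then nat \<lfloor>F l n\<rfloor> else 0"] data' by simp
    obtain Q where Q: "balanced Q ?P R"
      "\<And>i c x y. \<lbrakk>i < Suc T; (c + 1) * (B n i * length (\<sigma> i)) \<le> B n (Suc T) * (?L div B n (Suc T));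
           x < B n i * length (\<sigma> i); y < B n i * length (\<sigma> i); \<sigma> i ! (x div B n i) < \<sigma> i ! (y div B n i)\<rbrakk>
           \<Longrightarrow> Q (c * (B n i * length (\<sigma> i)) + x) < Q (c * (B n i * length (\<sigma> i)) + y)"
      using balanced_word[of "Suc T" R] by blast
    have few: "real (B n (Suc T) * G) \<le> \<epsilon> * real n"
    proof -
      have "B n (Suc T) = B n T * m T" by (simp add: B_def)
      moreover have "real (B n T * m T) * real G \<le> \<epsilon> * real n"
        using n1(1)[OF n(1)] n1(2)[OF n(1)] G by (simp add: field_simps)
      ultimately show ?thesis by simp
    qed
    have "approximates (5 * \<epsilon>) K T f \<Lambda> \<Xi> \<tau>"
      if \<tau>: "length \<tau> = n" and col: "follows_word Q ?L \<tau>" for \<tau>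
      unfolding approximates_def
    proof (intro allI impI conjI)
      fix \<pi> assume "pattern \<pi> \<and> length \<pi> \<le> K"
      then have \<pi>: "pattern \<pi>" "length \<pi> \<le> K" by auto
      have F0: "0 \<le> F i n" if "1 \<le> i" "i \<le> T" for i
        using scaling[of "ts ! (i - 1)"] n1(2)[OF n(1)] that by (simp add: F_def scaling_fn_def less_imp_le)
      have len: "length \<tau> = G * ?L" "0 < length \<tau>" using \<tau> n n1(2)[OF n(1)] by auto
      have few': "real (B n (Suc T) * G) \<le> \<epsilon> * real (length \<tau>)" using few \<tau> by simp
      have col': "\<tau> ! x < \<tau> ! y"
        if "x < G * ?L" "y < G * ?L" "x div ?L = y div ?L" "Q (x mod ?L) < Q (y mod ?L)" for x y
        using col that len(1) unfolding follows_word_def by metis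
      have Bn: "B n = block_len (\<lambda>i. length (\<sigma> i)) w (\<lambda>l. if l \<le> T then nat \<lfloor>F l n\<rfloor> else 0)"
        by (simp add: B_def m_def[abs_def])
      have main: "\<bar>dens (real (length \<pi>)) \<pi> \<tau> - \<Lambda> \<pi>\<bar> \<le> 5 * \<epsilon>"
        "\<And>i. 1 \<le> i \<Longrightarrow> i \<le> T \<Longrightarrow> \<bar>dens (F i n) \<pi> \<tau> - \<Xi> (ts ! (i - 1)) \<pi>\<bar> \<le> 5 * \<epsilon>"
        by (rule level_data_dens_close[where F = "\<lambda>i. F i n" and Q = Q, OF data \<epsilon> K Bn refl len Q(2) col' n1(3)[OF n(1)] F0 few' \<pi>];
            use n in simp)+
      show "\<bar>dens (real (length \<pi>)) \<pi> \<tau> - \<Lambda> \<pi>\<bar> \<le> 5 * \<epsilon>" by (rule main(1))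
      fix t assume "t < T"
      then have "t \<in> set ts" using ts(1) by simp
      then obtain i where i: "i < T" "ts ! i = t" using ts(2) by (auto simp: in_set_conv_nth)
      then show "\<bar>dens (f t (length \<tau>)) \<pi> \<tau> - \<Xi> t \<pi>\<bar> \<le> 5 * \<epsilon>"
        using main(2)[of "Suc i"] \<tau> by (simp add: F_def)
    qed
    then show "\<exists>Q. balanced Q ?P R \<and>
       (\<forall>\<tau>. length \<tau> = n \<longrightarrow> follows_word Q ?L \<tau> \<longrightarrow> approximates (5 * \<epsilon>) K T f \<Lambda> \<Xi> \<tau>)"
      using Q(1) by blast
  qed
qed

lemma approximates_mono:
  "approximates \<epsilon> K T f \<Lambda> \<Xi> \<tau> \<Longrightarrow> \<epsilon> \<le> \<epsilon>' \<Longrightarrow> K' \<le> K \<Longrightarrow> approximates \<epsilon>' K' T f \<Lambda> \<Xi> \<tau>"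
  unfolding approximates_def by (meson order_trans)

text \<open>The levels fix \<open>P\<close> and \<open>P'\<close>, then the length \<open>N0\<close>
  of \<open>\<gamma>\<close> is chosen, and only then \<open>R\<close> and with it the length of the
  result. There are \<open>N0 * P'\<close> columns and \<open>N0 * P\<close> rows, the two values
  used for \<open>G\<close>.\<close>

lemma exists_approximation:
  fixes f :: "nat \<Rightarrow> nat \<Rightarrow> real"
  assumes scaling: "\<And>t. scaling_fn (f t)"
    and total: "\<And>s t. s \<noteq> t \<Longrightarrow> dominated (f s) (f t) \<or> dominated (f t) (f s)"
    and Xi: "\<And>t. scale_limit (\<Xi> t)"
    and Xi': "\<And>t. scale_limit (\<Xi>' t)"
    and Gamma: "permuton \<Gamma>"
    and Lambda: "local_limit \<Lambda>"
    and Lambda': "local_limit \<Lambda>'"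
    and eps: "0 < e"
  shows "\<exists>\<tau>. is_perm \<tau> \<and> N \<le> length \<tau> \<and> approximates e k T f \<Lambda> \<Xi> \<tau> \<and> approximates e k T f \<Lambda>' \<Xi>' (inv_perm \<tau>) \<and>
    (\<forall>\<pi>. pattern \<pi> \<and> length \<pi> \<le> k \<longrightarrow> \<bar>dens (real (length \<tau>)) \<pi> \<tau> - permuton_dens \<pi> \<Gamma>\<bar> \<le> e)"
proof -
  \<comment> \<open>\<open>e / 5\<close> undoes the factor \<open>5\<close> of the error budget, and
    \<open>1 / 2\<close> keeps \<open>\<epsilon> < 1\<close>.\<close>
  define \<epsilon> where "\<epsilon> = min (e / 5) (1 / 2)"
  define K where "K = max k 1"
  have \<epsilon>: "0 < \<epsilon>" "\<epsilon> < 1" "5 * \<epsilon> \<le> e" using eps by (auto simp: \<epsilon>_def min_def)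
  have K: "1 \<le> K" "k \<le> K" by (auto simp: K_def)
  obtain ts where ts: "set ts = {0..<T}" "length ts = T"
    "\<forall>i. Suc i < T \<longrightarrow> dominated (f (ts ! i)) (f (ts ! Suc i))"
    by (rule sorted_by_domination[where f = f and T = T, OF scaling total])
  obtain \<sigma> w where data: "level_data \<epsilon> K \<Lambda> (\<lambda>i. \<Xi> (ts ! (i - 1))) \<sigma> w"
    by (rule level_data_exists[where X = "\<lambda>i. \<Xi> (ts ! (i - 1))", OF Lambda Xi \<epsilon>(1)])
  obtain \<sigma>' w' where data': "level_data \<epsilon> K \<Lambda>' (\<lambda>i. \<Xi>' (ts ! (i - 1))) \<sigma>' w'"
    by (rule level_data_exists[where X = "\<lambda>i. \<Xi>' (ts ! (i - 1))", OF Lambda' Xi' \<epsilon>(1)])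
  define P where "P = (\<Prod>l<Suc T. length (\<sigma> l))"
  define P' where "P' = (\<Prod>l<Suc T. length (\<sigma>' l))"
  have P: "0 < P" "0 < P'" unfolding P_def P'_def using data data' by (auto simp: level_data_def intro!: prod_pos)
  obtain N1 where N1: "\<forall>N\<ge>N1. \<exists>\<gamma>. is_perm \<gamma> \<and> length \<gamma> = N \<and>
    (\<forall>\<pi>. pattern \<pi> \<and> length \<pi> \<le> K \<longrightarrow> \<bar>dens (real N) \<pi> \<gamma> - permuton_dens \<pi> \<Gamma>\<bar> \<le> \<epsilon>)"
    by (rule permuton_approx[where K = K, OF Gamma \<epsilon>(1)])
  obtain N2 where N2: "real (K * K) / \<epsilon> \<le> real N2" by (meson real_arch_simple)
  define N0 where "N0 = max (max N1 N2) K"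
  have "N1 \<le> N0" by (simp add: N0_def)
  then obtain \<gamma> where \<gamma>: "is_perm \<gamma>" "length \<gamma> = N0"
    "\<forall>\<pi>. pattern \<pi> \<and> length \<pi> \<le> K \<longrightarrow> \<bar>dens (real N0) \<pi> \<gamma> - permuton_dens \<pi> \<Gamma>\<bar> \<le> \<epsilon>"
    using N1 by blast
  have N0: "K \<le> N0" "0 < N0" using K by (auto simp: N0_def)
  have "0 < N0 * P'" "0 < N0 * P" using N0 P by auto
  obtain n1 where n1: "\<forall>n R. n1 \<le> n \<longrightarrow> n = N0 * P' * (P * R) \<longrightarrow>
     (\<exists>Q. balanced Q P R \<and> (\<forall>\<tau>. length \<tau> = n \<longrightarrow> follows_word Q (P * R) \<tau> \<longrightarrow>
         approximates (5 * \<epsilon>) K T f \<Lambda> \<Xi> \<tau>))"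
    unfolding P_def by (rule level_data_approximates[where f = f and \<Xi> = \<Xi> and ts = ts, OF data \<epsilon>(1,2) K(1) scaling ts(1,2) ts(3)[rule_format] \<open>0 < N0 * P'\<close>])
  obtain n2 where n2: "\<forall>n R. n2 \<le> n \<longrightarrow> n = N0 * P * (P' * R) \<longrightarrow>
     (\<exists>Q. balanced Q P' R \<and> (\<forall>\<tau>. length \<tau> = n \<longrightarrow> follows_word Q (P' * R) \<tau> \<longrightarrow>
         approximates (5 * \<epsilon>) K T f \<Lambda>' \<Xi>' \<tau>))"
    unfolding P'_def by (rule level_data_approximates[where f = f and \<Xi> = \<Xi>' and ts = ts, OF data' \<epsilon>(1,2) K(1) scaling ts(1,2) ts(3)[rule_format] \<open>0 < N0 * P\<close>])
  \<comment> \<open>\<open>R\<close> is the last free parameter; as \<open>R \<le> n\<close>, it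
    lifts the length above both thresholds and above \<open>N\<close>.\<close>
  define R where "R = max (max n1 n2) (max N 1)"
  define n where "n = length \<gamma> * (P' * (P * R))"
  have "1 \<le> N0 * P' * P" using N0 P by simp
  then have "1 * R \<le> N0 * P' * P * R" by (rule mult_right_mono) simp
  then have nR: "R \<le> n" by (simp add: n_def \<gamma>(2) mult_ac)
  then have big: "n1 \<le> n" "n2 \<le> n" "N \<le> n" "0 < n" by (auto simp: R_def)
  have nP: "n = N0 * P' * (P * R)" "n = N0 * P * (P' * R)" by (simp_all add: n_def \<gamma>(2) mult_ac)
  obtain Q where Q: "balanced Q P R"
      "\<forall>\<tau>. length \<tau> = n \<longrightarrow> follows_word Q (P * R) \<tau> \<longrightarrow> approximates (5 * \<epsilon>) K T f \<Lambda> \<Xi> \<tau>"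
    using n1 big(1) nP(1) by blast
  obtain Q' where Q': "balanced Q' P' R"
      "\<forall>\<tau>. length \<tau> = n \<longrightarrow> follows_word Q' (P' * R) \<tau> \<longrightarrow> approximates (5 * \<epsilon>) K T f \<Lambda>' \<Xi>' \<tau>"
    using n2 big(2) nP(2) by blast
  obtain \<tau> where \<tau>: "is_perm \<tau>" "length \<tau> = n"
    and glob: "\<And>x y. \<lbrakk>x < n; y < n; \<gamma> ! (x div (P' * (P * R))) < \<gamma> ! (y div (P' * (P * R)))\<rbrakk> \<Longrightarrow> \<tau> ! x < \<tau> ! y"
    and cols: "follows_word Q (P * R) \<tau>" and rows: "follows_word Q' (P' * R) (inv_perm \<tau>)"
    using weave[OF \<gamma>(1) Q(1) Q'(1) n_def] by metis
  have "approximates e k T f \<Lambda> \<Xi> \<tau>"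
    using Q(2) \<tau>(2) cols by (blast intro: approximates_mono[OF _ \<epsilon>(3) K(2)])
  moreover have "approximates e k T f \<Lambda>' \<Xi>' (inv_perm \<tau>)"
    using Q'(2) \<tau>(2) rows length_inv_perm[of \<tau>] by (metis approximates_mono[OF _ \<epsilon>(3) K(2)])
  moreover have "\<bar>dens (real (length \<tau>)) \<pi> \<tau> - permuton_dens \<pi> \<Gamma>\<bar> \<le> e" if \<pi>: "pattern \<pi>" "length \<pi> \<le> k" for \<pi>
  proof -
    let ?b = "P' * (P * R)"
    have kK: "length \<pi> \<le> K" using \<pi> K by simp
    have bk: "blocks \<tau> \<gamma> {0} ?b"
    proof
      show "distinct \<gamma>" using \<gamma>(1) by (simp add: is_perm_def)
      show "s + ?b * length \<gamma> \<le> length \<tau>" if "s \<in> {0}" for s using that \<tau>(2) by (simp add: n_def mult.commute)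
      show "\<tau> ! (s + x) < \<tau> ! (s + y)"
        if "s \<in> {0}" "x < ?b * length \<gamma>" "y < ?b * length \<gamma>" "\<gamma> ! (x div ?b) < \<gamma> ! (y div ?b)" for s x y
        using that glob[of x y] by (simp add: n_def mult.commute)
    qed auto
    have k: "1 \<le> length \<pi>" using \<pi> by (cases \<pi>) (auto simp: pattern_def)
    have k2: "length \<pi> \<le> length \<gamma>" using kK N0 \<gamma>(2) by simp
    have nb: "length \<tau> = ?b * length \<gamma>" using \<tau>(2) by (simp add: n_def mult.commute)
    have b0: "0 < ?b" using P by (simp add: R_def)
    have "\<bar>dens (real (length \<tau>)) \<pi> \<tau> - dens (real (length \<gamma>)) \<pi> \<gamma>\<bar> \<le> real (length \<pi>) * (real (length \<pi>) / real (length \<gamma>))"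
      by (rule blocks.dens_close_global[OF bk k k2 refl nb b0])
    also have "\<dots> \<le> \<epsilon>"
    proof -
      have "real (length \<pi>) * real (length \<pi>) \<le> real K * real K" using kK by (intro mult_mono) auto
      moreover have "real (K * K) / \<epsilon> \<le> real N0"
      proof -
        have "real N2 \<le> real N0" by (simp add: N0_def)
        then show ?thesis using N2 by linarith
      qed
      then have "real K * real K \<le> \<epsilon> * real N0" using \<epsilon>(1) by (simp add: field_simps)
      ultimately have "real (length \<pi>) * real (length \<pi>) \<le> \<epsilon> * real N0" by linarith
      then show ?thesis using N0(2) \<gamma>(2) by (simp add: pos_divide_le_eq)
    qed
    finally have "\<bar>dens (real (length \<tau>)) \<pi> \<tau> - dens (real N0) \<pi> \<gamma>\<bar> \<le> \<epsilon>" using \<gamma>(2) by simp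
    then show ?thesis using \<gamma>(3)[rule_format, OF conjI[OF \<pi>(1) kK]] \<epsilon> by linarith
  qed
  ultimately show ?thesis using \<tau> big(3) by blast
qed

section \<open>The diagonal sequence\<close>

lemma tendsto_of_diagonal_bound:
  fixes a :: "nat \<Rightarrow> real"
  assumes "\<And>j. j0 \<le> j \<Longrightarrow> \<bar>a j - c\<bar> \<le> 1 / real (Suc j)"
  shows "a \<longlonglongrightarrow> c"
proof (rule LIM_zero_cancel, rule Lim_null_comparison)
  show "eventually (\<lambda>j. norm (a j - c) \<le> 1 / real (Suc j)) sequentially"
    using assms by (auto simp: eventually_sequentially)
  show "(\<lambda>j. 1 / real (Suc j)) \<longlonglongrightarrow> 0" using LIMSEQ_inverse_real_of_nat by (simp add: inverse_eq_divide)
qed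

theorem mainTheorem12:
  fixes f :: "nat \<Rightarrow> nat \<Rightarrow> real"
    and \<Xi> \<Xi>' :: "nat \<Rightarrow> nat list \<Rightarrow> real"
    and \<Gamma> :: "(real \<times> real) measure"
    and \<Lambda> \<Lambda>' :: "nat list \<Rightarrow> real"
  assumes scaling: "\<And>t. scaling_fn (f t)"
    and total: "\<And>s t. s \<noteq> t \<Longrightarrow> dominated (f s) (f t) \<or> dominated (f t) (f s)"
    and Xi: "\<And>t. scale_limit (\<Xi> t)"
    and Xi': "\<And>t. scale_limit (\<Xi>' t)"
    and Gamma: "permuton \<Gamma>"
    and Lambda: "local_limit \<Lambda>"
    and Lambda': "local_limit \<Lambda>'"
  shows "\<exists>\<tau> :: nat \<Rightarrow> nat list.
           perm_seq \<tau> \<and>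
           (\<forall>t. conv_scale (f t) \<tau> (\<Xi> t)) \<and>
           conv_global \<tau> \<Gamma> \<and>
           conv_local \<tau> \<Lambda> \<and>
           (\<forall>t. conv_scale (f t) (\<lambda>j. inv_perm (\<tau> j)) (\<Xi>' t)) \<and>
           conv_local (\<lambda>j. inv_perm (\<tau> j)) \<Lambda>'"
proof -
  \<comment> \<open>The index \<open>j\<close> serves at once as bound on the pattern length, number
    of scales, lower bound for the length and, through \<open>1 / Suc j\<close>, as error.\<close>
  have "\<forall>j. \<exists>\<tau>. is_perm \<tau> \<and> j \<le> length \<tau> \<and> approximates (1 / real (Suc j)) j j f \<Lambda> \<Xi> \<tau> \<and>
      approximates (1 / real (Suc j)) j j f \<Lambda>' \<Xi>' (inv_perm \<tau>) \<and>
      (\<forall>\<pi>. pattern \<pi> \<and> length \<pi> \<le> j \<longrightarrow> \<bar>dens (real (length \<tau>)) \<pi> \<tau> - permuton_dens \<pi> \<Gamma>\<bar> \<le> 1 / real (Suc j))"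
    by (intro allI exists_approximation) (use assms in auto)
  then obtain \<tau> where \<tau>: "\<And>j. is_perm (\<tau> j)" "\<And>j. j \<le> length (\<tau> j)"
    "\<And>j. approximates (1 / real (Suc j)) j j f \<Lambda> \<Xi> (\<tau> j)"
    "\<And>j. approximates (1 / real (Suc j)) j j f \<Lambda>' \<Xi>' (inv_perm (\<tau> j))"
    "\<And>j \<pi>. pattern \<pi> \<Longrightarrow> length \<pi> \<le> j \<Longrightarrow> \<bar>dens (real (length (\<tau> j))) \<pi> (\<tau> j) - permuton_dens \<pi> \<Gamma>\<bar> \<le> 1 / real (Suc j)"
    by metis
  have "filterlim (\<lambda>j. length (\<tau> j)) at_top sequentially"
    by (rule filterlim_at_top_mono[OF filterlim_ident]) (use \<tau>(2) in auto)
  then have seq: "perm_seq \<tau>" "perm_seq (\<lambda>j. inv_perm (\<tau> j))"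
    using \<tau>(1) is_perm_inv_perm by (auto simp: perm_seq_def)
  have scale: "conv_scale (f t) s (X t)" and loc: "conv_local s M"
    if "perm_seq s" and s: "\<And>j. approximates (1 / real (Suc j)) j j f M X (s j)" for s M X t
  proof -
    have A: "\<bar>dens (real (length \<pi>)) \<pi> (s j) - M \<pi>\<bar> \<le> 1 / real (Suc j)"
        "t < j \<Longrightarrow> \<bar>dens (f t (length (s j))) \<pi> (s j) - X t \<pi>\<bar> \<le> 1 / real (Suc j)"
      if "pattern \<pi>" "length \<pi> \<le> j" for \<pi> j t
      using s[of j] that unfolding approximates_def by blast+
    show "conv_local s M"
      unfolding conv_local_def by (intro conjI allI impI that(1) tendsto_of_diagonal_bound[OF A(1)])
    show "conv_scale (f t) s (X t)"
      unfolding conv_scale_def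
    proof (intro conjI allI impI that(1))
      fix \<pi> assume "pattern \<pi>"
      \<comment> \<open>The bound is available once \<open>j\<close> is at least
        \<open>length \<pi>\<close> and exceeds \<open>t\<close>, hence the start
        \<open>max (length \<pi>) (Suc t)\<close>.\<close>
      then show "(\<lambda>j. dens (f t (length (s j))) \<pi> (s j)) \<longlonglongrightarrow> X t \<pi>"
        by (intro tendsto_of_diagonal_bound[of "max (length \<pi>) (Suc t)"] A(2)) auto
    qed
  qed
  have "conv_global \<tau> \<Gamma>"
    unfolding conv_global_def by (intro conjI allI impI seq(1) tendsto_of_diagonal_bound[OF \<tau>(5)])
  then show ?thesis
    using seq scale[OF seq(1) \<tau>(3)] loc[OF seq(1) \<tau>(3)] scale[OF seq(2) \<tau>(4)] loc[OF seq(2) \<tau>(4)] by blast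
qed

end
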